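(* Let $F=\mathbb R$ or $\mathbb C$, and let $V$ be a finite dimensional vector space over $F$. Let $Q$ be a rational function on $V$, $P_1,\dots,P_k$ nonzero polynomials on $V$, $Q^*$ a rational function on $V^*$, $P_1^*,\dots,P_l^*$ nonzero polynomials on $V^*$, and let $\chi_1,\dots,\chi_k,\chi_1^*,\dots,\chi_l^*$ be multiplicative characters of $F$. Assume that the pole divisor of $Q$ is contained in the divisor $P_1\cdots P_k=0$ and the pole divisor of $Q^*$ is contained in $P_1^*\cdots P_l^*=0$. Suppose that for every nontrivial unitary additive character $\psi$ of $F$ there is a constant $C_\psi\in\mathbb C$ such that $$\widehat{G^{P_1,\dots,P_k,-Q}_{\chi_1,\dots,\chi_k}}(\cdot,\psi)=C_\psi\, G^{P_1^*,\dots,P_l^*,Q^*}_{\chi_1^*,\dots,\chi_l^*}(\cdot,\psi)$$ as distributions on $V^*$, and that the Hessian determinant $\det Q''$ is not identically zero. Then: (i) the rational map of algebraic varieties $\underline V\to\underline V^*$ given by $x\mapsto Q'(x)$ is a birational isomorphism; (ii) $Q^*$ is the Legendre transform of $Q$.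
   Context: $Q'$ and $Q''$ denote the first and second differentials of $Q$; $\underline V$, $\underline V^*$ are $V$, $V^*$ regarded as algebraic varieties. A multiplicative character of $F$ is a continuous homomorphism $F^*\to\mathbb C^*$. For a rational function $Q$, polynomials $P_j$ and multiplicative characters $\chi_j$ put $$G^{P_1,\dots,P_k,Q}_{\chi_1,\dots,\chi_k}(x,\psi)=\psi(Q(x))\prod_{j=1}^k\chi_j(P_j(x)).$$ This function defines a distribution on $V$ depending meromorphically on $(\chi_1,\dots,\chi_k)$ (it is given by the function itself when all $\chi_j$ have large real part, where $|\chi_j(x)|=|x|^{\dim_{\mathbb R}F\cdot \mathrm{Re}\,\chi_j}$, and by meromorphic continuation otherwise). The characters are assumed to be such that both sides of the identity are defined in this way (i.e. are not at poles of the families). The Fourier transform is $\hat f(y)=\int_V\psi(yx)f(x)\,dx$ for a Haar measure $dx$ on $V$, extended to (tempered) distributions by duality. Legendre transform: if $\det Q''(v_0)\neq0$ and $p_0=Q'(v_0)\in V^*$, then $L(Q)$ is the function near $p_0$ given by $L(Q)(p)=pv_p-Q(v_p)$, where $v_p$ is the unique critical point of $v\mapsto pv-Q(v)$ near $v_0$. Equivalently $L(Q)(Q'(v))=Q'(v)v-Q(v)$. For rational $Q$ with $\det Q''\not\equiv0$ this is an algebraic function.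
   Formalization: In (ii), Q* is shown to be the Legendre transform of Q only up to one additive constant, because the hypotheses do not change when a constant is added to Q* (e.g. Q = x²/2, Q* = y²/2 + 1 on ℝ). *)

theory Defs
  imports "HOL-Analysis.Analysis"
begin

section \<open>The ground field and the vector spaces\<close>

text \<open>
  The ground field \<open>F\<close> is a type of the following class, whose members are, as normed fields,
  exactly copies of \<open>\<real>\<close> and of \<open>\<complex>\<close> (the inner product is determined by the norm).
  \<open>DIM('a)\<close> is the dimension of \<open>F\<close> over \<open>\<real>\<close>.
\<close>

class real_or_complex = real_normed_field + euclidean_space +
  assumes isometric_to_real_or_complex:
    "\<exists>h :: 'a \<Rightarrow> complex. (\<forall>x y. h (x + y) = h x + h y) \<and> (\<forall>x y. h (x * y) = h x * h y)
       \<and> (\<forall>x. norm (h x) = norm x) \<and> (range h = \<real> \<or> range h = UNIV)"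

instance real :: real_or_complex
  by standard (rule exI[of _ complex_of_real], auto simp: Reals_def)

instance complex :: real_or_complex
  by standard (rule exI[of _ id], auto)

text \<open>
  Both \<open>V\<close> and \<open>V\<^sup>*\<close> are \<open>F\<^sup>n\<close>, in dual bases: the pairing \<open>yx\<close> of \<open>y\<close> in \<open>V\<^sup>*\<close> with
  \<open>x\<close> in \<open>V\<close> is \<^term>\<open>scalar_product y x\<close>. The \<open>F\<close>-scaling is \<^term>\<open>(*s)\<close>.
\<close>


section \<open>Polynomials and rational functions\<close>

text \<open>As \<open>F\<close> is infinite, polynomials on \<open>V\<close> are the same thing as polynomial functions.\<close>

inductive polynomial_fun :: "('f::comm_ring_1 ^ 'n \<Rightarrow> 'f) \<Rightarrow> bool" where
  const: "polynomial_fun (\<lambda>x. c)"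
| coord: "polynomial_fun (\<lambda>x. x $ i)"
| add: "polynomial_fun p \<Longrightarrow> polynomial_fun q \<Longrightarrow> polynomial_fun (\<lambda>x. p x + q x)"
| mult: "polynomial_fun p \<Longrightarrow> polynomial_fun q \<Longrightarrow> polynomial_fun (\<lambda>x. p x * q x)"

definition nonzero_polynomial :: "('f::comm_ring_1 ^ 'n \<Rightarrow> 'f) \<Rightarrow> bool" where
  "nonzero_polynomial p \<longleftrightarrow> polynomial_fun p \<and> p \<noteq> (\<lambda>x. 0)"

text \<open>Validity on a nonempty Zariski open subset.\<close>

definition generically :: "('f::comm_ring_1 ^ 'n \<Rightarrow> bool) \<Rightarrow> bool" where
  "generically R \<longleftrightarrow> (\<exists>d. nonzero_polynomial d \<and> (\<forall>x. d x \<noteq> 0 \<longrightarrow> R x))"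

text \<open>
  A rational function is represented by any total function that agrees generically with a
  quotient of polynomials; its values elsewhere carry no information. Two such functions
  represent the same rational function iff they agree generically. Everything below depends only
  on the rational function and not on the representing total function.
\<close>

definition represents_quotient ::
  "('f::field ^ 'n \<Rightarrow> 'f) \<Rightarrow> ('f ^ 'n \<Rightarrow> 'f) \<Rightarrow> ('f ^ 'n \<Rightarrow> 'f) \<Rightarrow> bool" where
  "represents_quotient Q a b \<longleftrightarrow>
     polynomial_fun a \<and> nonzero_polynomial b \<and> generically (\<lambda>x. Q x = a x / b x)"

definition rational_fun :: "('f::field ^ 'n \<Rightarrow> 'f) \<Rightarrow> bool" where
  "rational_fun Q \<longleftrightarrow> (\<exists>a b. represents_quotient Q a b)"

definition polynomial_dvd :: "('f::comm_ring_1 ^ 'n \<Rightarrow> 'f) \<Rightarrow> ('f ^ 'n \<Rightarrow> 'f) \<Rightarrow> bool" where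
  "polynomial_dvd p q \<longleftrightarrow> (\<exists>r. polynomial_fun r \<and> q = (\<lambda>x. p x * r x))"

definition irreducible_polynomial :: "('f::comm_ring_1 ^ 'n \<Rightarrow> 'f) \<Rightarrow> bool" where
  "irreducible_polynomial p \<longleftrightarrow>
     polynomial_fun p \<and> (\<nexists>c. p = (\<lambda>x. c)) \<and>
     (\<forall>a b. polynomial_fun a \<and> polynomial_fun b \<and> p = (\<lambda>x. a x * b x) \<longrightarrow>
        (\<exists>c. a = (\<lambda>x. c)) \<or> (\<exists>c. b = (\<lambda>x. c)))"

text \<open>
  The prime divisor \<open>p = 0\<close> occurs in the pole divisor of \<open>Q\<close> iff \<open>p\<close> cannot be avoided in the
  denominator of \<open>Q\<close> (equivalently, it divides the reduced denominator). The divisors are those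
  of the algebraic variety: over \<open>\<real>\<close> the set of real points of \<open>p = 0\<close> may well be empty.
\<close>

definition pole_component :: "('f::field ^ 'n \<Rightarrow> 'f) \<Rightarrow> ('f ^ 'n \<Rightarrow> 'f) \<Rightarrow> bool" where
  "pole_component Q p \<longleftrightarrow> irreducible_polynomial p \<and>
     (\<forall>a b. represents_quotient Q a b \<longrightarrow> polynomial_dvd p b)"

definition pole_divisor_contained_in :: "('f::field ^ 'n \<Rightarrow> 'f) \<Rightarrow> ('f ^ 'n \<Rightarrow> 'f) \<Rightarrow> bool" where
  "pole_divisor_contained_in Q P \<longleftrightarrow> (\<forall>p. pole_component Q p \<longrightarrow> polynomial_dvd p P)"

definition rational_map :: "('f::field ^ 'n \<Rightarrow> 'f ^ 'm) \<Rightarrow> bool" where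
  "rational_map f \<longleftrightarrow> (\<forall>i. rational_fun (\<lambda>x. f x $ i))"

definition dominant_map :: "('f::field ^ 'n \<Rightarrow> 'f ^ 'm) \<Rightarrow> bool" where
  "dominant_map f \<longleftrightarrow> (\<forall>p. nonzero_polynomial p \<longrightarrow> \<not> generically (\<lambda>x. p (f x) = 0))"

text \<open>Dominance makes the composites below well defined as rational maps.\<close>

definition birational_isomorphism :: "('f::field ^ 'n \<Rightarrow> 'f ^ 'm) \<Rightarrow> bool" where
  "birational_isomorphism f \<longleftrightarrow> rational_map f \<and> dominant_map f \<and>
     (\<exists>g. rational_map g \<and> dominant_map g \<and>
        generically (\<lambda>x. g (f x) = x) \<and> generically (\<lambda>y. f (g y) = y))"


section \<open>Differentials and the Legendre transform\<close>

definition partial_deriv ::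
  "'n \<Rightarrow> ('f::real_normed_field ^ 'n \<Rightarrow> 'f) \<Rightarrow> 'f ^ 'n \<Rightarrow> 'f" where
  "partial_deriv i Q x = deriv (\<lambda>t. Q (x + t *s axis i 1)) 0"

definition differential :: "('f::real_normed_field ^ 'n \<Rightarrow> 'f) \<Rightarrow> 'f ^ 'n \<Rightarrow> 'f ^ 'n" where
  "differential Q x = (\<chi> i. partial_deriv i Q x)"

definition hessian :: "('f::real_normed_field ^ 'n \<Rightarrow> 'f) \<Rightarrow> 'f ^ 'n \<Rightarrow> 'f ^ 'n ^ 'n" where
  "hessian Q x = (\<chi> i j. partial_deriv i (partial_deriv j Q) x)"

definition critical_point :: "('f::real_or_complex ^ 'n \<Rightarrow> 'f) \<Rightarrow> 'f ^ 'n \<Rightarrow> bool" where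
  "critical_point g v \<longleftrightarrow> (g has_derivative (\<lambda>w. 0)) (at v)"

text \<open>\<open>L\<close> is the Legendre transform of \<open>Q\<close> near the point \<open>p\<^sub>0 = Q'(v\<^sub>0)\<close>.\<close>

definition legendre_transform_near ::
  "('f::real_or_complex ^ 'n \<Rightarrow> 'f) \<Rightarrow> ('f ^ 'n \<Rightarrow> 'f) \<Rightarrow> 'f ^ 'n \<Rightarrow> bool" where
  "legendre_transform_near Q L v0 \<longleftrightarrow>
     det (hessian Q v0) \<noteq> 0 \<and>
     (\<exists>N M. open N \<and> v0 \<in> N \<and> open M \<and> differential Q v0 \<in> M \<and>
        (\<forall>p\<in>M. \<exists>v\<in>N. critical_point (\<lambda>w. scalar_product p w - Q w) v \<and>
           (\<forall>u\<in>N. critical_point (\<lambda>w. scalar_product p w - Q w) u \<longrightarrow> u = v) \<and>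
           L p = scalar_product p v - Q v))"

text \<open>
  The Legendre transform of a rational function is an a priori multivalued algebraic function.
  A single valued function is this Legendre transform if it is so near \<open>Q'(v\<^sub>0)\<close> for generic
  \<open>v\<^sub>0\<close>. An identity \<open>\<psi>(-Q)^ = C\<^sub>\<psi> \<psi>(Q\<^sup>*)\<close> with arbitrary constants \<open>C\<^sub>\<psi>\<close> cannot distinguish \<open>Q\<^sup>*\<close>
  from \<open>Q\<^sup>* + c\<close>, so it can determine \<open>Q\<^sup>*\<close> as a Legendre transform only up to a constant.
\<close>

definition is_legendre_transform ::
  "('f::real_or_complex ^ 'n \<Rightarrow> 'f) \<Rightarrow> ('f ^ 'n \<Rightarrow> 'f) \<Rightarrow> bool" where
  "is_legendre_transform Q L \<longleftrightarrow> generically (legendre_transform_near Q L)"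


section \<open>Characters\<close>

definition nontrivial_unitary_additive_char :: "('f::real_or_complex \<Rightarrow> complex) \<Rightarrow> bool" where
  "nontrivial_unitary_additive_char \<psi> \<longleftrightarrow> continuous_on UNIV \<psi> \<and>
     (\<forall>x y. \<psi> (x + y) = \<psi> x * \<psi> y) \<and> (\<forall>x. norm (\<psi> x) = 1) \<and> (\<exists>x. \<psi> x \<noteq> 1)"

text \<open>A character of \<open>F\<^sup>*\<close> is a function on \<open>F\<close> whose value at \<open>0\<close> is irrelevant.\<close>

definition multiplicative_char :: "('f::real_or_complex \<Rightarrow> complex) \<Rightarrow> bool" where
  "multiplicative_char chi \<longleftrightarrow> continuous_on (- {0}) chi \<and> (\<forall>x. x \<noteq> 0 \<longrightarrow> chi x \<noteq> 0) \<and>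
     (\<forall>x y. x \<noteq> 0 \<longrightarrow> y \<noteq> 0 \<longrightarrow> chi (x * y) = chi x * chi y)"

text \<open>
  The character \<open>\<chi> \<bar>\<cdot>\<bar>\<^sup>d\<^sup>s\<close> with \<open>d = dim\<^sub>\<real> F\<close>, whose real part is \<open>Re \<chi> + Re s\<close>. For \<open>s\<close> in \<open>\<complex>\<close>
  these run through the connected component of \<open>\<chi>\<close> in the complex manifold of all
  multiplicative characters.
\<close>

definition twist :: "('f::real_or_complex \<Rightarrow> complex) \<Rightarrow> complex \<Rightarrow> 'f \<Rightarrow> complex" where
  "twist chi s x = chi x * complex_of_real (norm x) powr (of_nat DIM('f) * s)"

text \<open>
  The polynomials are indexed by a nonempty finite type; an empty list of polynomials amounts to
  the single polynomial \<open>1\<close> with the trivial character.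
\<close>

definition G_fun :: "('k::finite \<Rightarrow> 'f::real_or_complex ^ 'n \<Rightarrow> 'f) \<Rightarrow> ('f ^ 'n \<Rightarrow> 'f) \<Rightarrow>
    ('k \<Rightarrow> 'f \<Rightarrow> complex) \<Rightarrow> ('f \<Rightarrow> complex) \<Rightarrow> 'f ^ 'n \<Rightarrow> complex" where
  "G_fun P Q chi \<psi> x = \<psi> (Q x) * (\<Prod>j\<in>UNIV. chi j (P j x))"


section \<open>Schwartz functions, tempered distributions, Fourier transform\<close>

definition dir_deriv :: "'v::real_normed_vector \<Rightarrow> ('v \<Rightarrow> complex) \<Rightarrow> 'v \<Rightarrow> complex" where
  "dir_deriv v f x = vector_derivative (\<lambda>t. f (x + t *\<^sub>R v)) (at 0)"

definition iter_deriv :: "'v::real_normed_vector list \<Rightarrow> ('v \<Rightarrow> complex) \<Rightarrow> 'v \<Rightarrow> complex" where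
  "iter_deriv vs f = foldr dir_deriv vs f"

definition smooth_fun :: "('v::euclidean_space \<Rightarrow> complex) \<Rightarrow> bool" where
  "smooth_fun f \<longleftrightarrow> (\<forall>vs. set vs \<subseteq> Basis \<longrightarrow> (\<forall>x. iter_deriv vs f differentiable (at x)))"

definition schwartz :: "('v::euclidean_space \<Rightarrow> complex) set" where
  "schwartz = {f. smooth_fun f \<and>
     (\<forall>N vs. set vs \<subseteq> Basis \<longrightarrow>
        (\<exists>C. \<forall>x. (1 + norm x) ^ N * norm (iter_deriv vs f x) \<le> C))}"

definition schwartz_seminorm :: "nat \<Rightarrow> ('v::euclidean_space \<Rightarrow> complex) \<Rightarrow> real" where
  "schwartz_seminorm N f =
     (SUP (vs, x) \<in> {vs. set vs \<subseteq> Basis \<and> length vs \<le> N} \<times> UNIV.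
        (1 + norm x) ^ N * norm (iter_deriv vs f x))"

text \<open>Tempered distributions matter only through their values on \<^term>\<open>schwartz\<close>.\<close>

definition tempered_distribution :: "(('v::euclidean_space \<Rightarrow> complex) \<Rightarrow> complex) \<Rightarrow> bool" where
  "tempered_distribution T \<longleftrightarrow>
     (\<forall>f\<in>schwartz. \<forall>g\<in>schwartz. T (\<lambda>x. f x + g x) = T f + T g) \<and>
     (\<forall>f\<in>schwartz. \<forall>c. T (\<lambda>x. c * f x) = c * T f) \<and>
     (\<exists>N C. \<forall>f\<in>schwartz. norm (T f) \<le> C * schwartz_seminorm N f)"

text \<open>
  The distribution given by a function. Lebesgue measure serves as Haar measure; it is taken to be
  complete since a function representing a rational function is arbitrary on a null set.
\<close>

definition distribution_of :: "('v::euclidean_space \<Rightarrow> complex) \<Rightarrow> ('v \<Rightarrow> complex) \<Rightarrow> complex" where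
  "distribution_of g f = (LINT x|lebesgue. g x * f x)"

text \<open>
  The Fourier transform on functions is symmetric in \<open>V\<close> and \<open>V\<^sup>*\<close>. On distributions it is its
  transpose.
\<close>

definition fourier ::
  "('f::real_or_complex \<Rightarrow> complex) \<Rightarrow> ('f ^ 'n \<Rightarrow> complex) \<Rightarrow> 'f ^ 'n \<Rightarrow> complex" where
  "fourier \<psi> f y = (LINT x|lebesgue. \<psi> (scalar_product y x) * f x)"

definition fourier_distribution :: "('f::real_or_complex \<Rightarrow> complex) \<Rightarrow>
    (('f ^ 'n \<Rightarrow> complex) \<Rightarrow> complex) \<Rightarrow> ('f ^ 'n \<Rightarrow> complex) \<Rightarrow> complex" where
  "fourier_distribution \<psi> T \<phi> = T (fourier \<psi> \<phi>)"


section \<open>Meromorphic families of distributions\<close>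

text \<open>Holomorphic functions of several complex variables.\<close>

definition holomorphic_several :: "(complex ^ 'k \<Rightarrow> complex) \<Rightarrow> (complex ^ 'k) set \<Rightarrow> bool" where
  "holomorphic_several h U \<longleftrightarrow>
     (\<forall>s\<in>U. \<exists>h'. (h has_derivative h') (at s) \<and> (\<forall>c v. h' (c *s v) = c * h' v))"

text \<open>
  \<open>T\<close> is a meromorphic family, on all of \<open>\<complex>\<^sup>k\<close>, of tempered distributions that is holomorphic on
  the open set \<open>U\<close>: locally, it is a quotient of a holomorphic family by one holomorphic function
  \<open>h\<close>, not identically zero, outside of whose zeros \<open>T\<close> is holomorphic.
\<close>

definition meromorphic_family ::
  "(complex ^ 'k) set \<Rightarrow> (complex ^ 'k \<Rightarrow> ('v::euclidean_space \<Rightarrow> complex) \<Rightarrow> complex) \<Rightarrow> bool" where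
  "meromorphic_family U T \<longleftrightarrow>
     open U \<and>
     (\<forall>s\<in>U. tempered_distribution (T s)) \<and>
     (\<forall>f\<in>schwartz. holomorphic_several (\<lambda>s. T s f) U) \<and>
     (\<forall>s0. \<exists>W h. open W \<and> connected W \<and> s0 \<in> W \<and>
        holomorphic_several h W \<and> (\<exists>s\<in>W. h s \<noteq> 0) \<and> {s\<in>W. h s \<noteq> 0} \<subseteq> U \<and>
        (\<forall>f\<in>schwartz. \<exists>H. holomorphic_several H W \<and> (\<forall>s\<in>W \<inter> U. H s = h s * T s f)))"

text \<open>
  The family of distributions \<open>G\<close> has no pole at \<open>\<chi>\<close>, and \<open>T\<^sub>0\<close> is its value there: the family,
  which is given by the function when all the characters have large real part, extends to a
  meromorphic one that is holomorphic near \<open>\<chi>\<close>, that is, near \<open>s = 0\<close>.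
\<close>

definition G_distribution :: "('k::finite \<Rightarrow> 'f::real_or_complex ^ 'n \<Rightarrow> 'f) \<Rightarrow> ('f ^ 'n \<Rightarrow> 'f) \<Rightarrow>
    ('k \<Rightarrow> 'f \<Rightarrow> complex) \<Rightarrow> ('f \<Rightarrow> complex) \<Rightarrow> (('f ^ 'n \<Rightarrow> complex) \<Rightarrow> complex) \<Rightarrow> bool" where
  "G_distribution P Q chi \<psi> T0 \<longleftrightarrow>
     (\<exists>U (T :: complex ^ 'k \<Rightarrow> ('f ^ 'n \<Rightarrow> complex) \<Rightarrow> complex).
        meromorphic_family U T \<and>
        (\<exists>c. \<forall>s\<in>U. (\<forall>j. Re (s $ j) > c) \<longrightarrow>
           (\<forall>f\<in>schwartz. T s f = distribution_of (G_fun P Q (\<lambda>j. twist (chi j) (s $ j)) \<psi>) f)) \<and>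
        0 \<in> U \<and> (\<forall>f\<in>schwartz. T0 f = T 0 f))"

end

theory Submission
  imports Defs "HOL-Complex_Analysis.Complex_Analysis"
begin

text \<open>
  The point is that \<open>Q\<^sup>*'\<close> is a left inverse of \<open>Q'\<close>. Let \<open>e\<close> be the product of the
  \<open>P\<^sup>*\<^sub>j\<close> and a denominator of \<open>Q\<^sup>*\<close>. The function \<open>G\<^sup>*\<close> with phase \<open>\<psi>(tQ\<^sup>*)\<close> satisfies first order equations
  with polynomial coefficients, namely \<open>e\<^sup>2 \<partial>\<^sub>i G\<^sup>* = (c t e\<^sup>2 \<partial>\<^sub>i Q\<^sup>* + \<dots>) G\<^sup>*\<close>. They hold for the distribution when the
  characters have large real part, by integration by parts (the factor \<open>e\<^sup>2\<close> and \<open>\<bar>\<psi>\<bar> = 1\<close> make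
  all boundary terms vanish), and hence in general by meromorphic continuation. The Fourier
  transform turns them into equations of fixed order for the distribution \<open>G\<close> on \<open>V\<close>, in which \<open>y\<close> is
  replaced by \<open>\<partial> / (c t)\<close>; the unknown constant \<open>C\<^sub>\<psi>\<close> drops out. Away from the singular set \<open>G\<close> is the
  function \<open>\<psi>(-tQ) g\<close>, and letting \<open>t \<rightarrow> \<infinity>\<close> one reads off \<open>e(Q'(x))\<^sup>2 (x - Q\<^sup>*'(Q'(x))) = 0\<close>. As
  \<open>det Q'' \<noteq> 0\<close>, the map \<open>Q'\<close> is dominant, so that \<open>e(Q'(x))\<close> does not vanish identically. Finally the
  differential of \<open>Q\<^sup>*(Q'(x)) - Q'(x) x + Q(x)\<close> is zero.
\<close>

subsection \<open>Polynomials\<close>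

text \<open>A distribution \<open>T s\<close> is known only through its values on Schwartz
  functions, and outside the region of large real parts only through continuation in
  \<open>s\<close>. So every equation is tested on one function and written as a linear combination
  of values of \<open>T s\<close> at fixed functions, with coefficients entire in \<open>s\<close>;
  an identity theorem applies to this form. The functions used for testing are transforms, at
  parameter \<open>-t\<close>, of \<open>chr t (Q x)\<close> times a test function supported where
  neither the denominator of Q nor any \<open>P j\<close> vanishes. This has two effects.
  Multiplication by a polynomial on the dual side becomes differentiation of the oscillating factor,
  which brings down Q'. After Fourier inversion the factor \<open>chr t (Q x)\<close> cancels the
  phase \<open>chr t (- Q x)\<close> of the function on V. What remains is an integral without
  oscillation that is a polynomial in \<open>1 / t\<close>, so its limit is read off from an exact
  finite expansion and no remainder has to be estimated. Over \<complex> a real derivative of a real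
  phase mixes holomorphic and antiholomorphic parts; a Wirtinger combination of two real directions
  isolates the holomorphic one.\<close>

lemma polynomial_fun_uminus:
  assumes "polynomial_fun p" shows "polynomial_fun (\<lambda>x. - p x)"
  using polynomial_fun.mult[OF polynomial_fun.const[of "-1"] assms] by simp

lemma polynomial_fun_diff:
  assumes "polynomial_fun p" "polynomial_fun q" shows "polynomial_fun (\<lambda>x. p x - q x)"
  using polynomial_fun.add[OF assms(1) polynomial_fun_uminus[OF assms(2)]] by simp

lemma polynomial_fun_power:
  assumes "polynomial_fun p" shows "polynomial_fun (\<lambda>x. p x ^ m)"
  by (induction m) (auto intro: polynomial_fun.intros assms)

lemma polynomial_fun_sum:
  assumes "\<And>i. i \<in> I \<Longrightarrow> polynomial_fun (p i)" shows "polynomial_fun (\<lambda>x. \<Sum>i\<in>I. p i x)"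
  using assms by (induction I rule: infinite_finite_induct) (auto intro: polynomial_fun.intros)

lemma polynomial_fun_prod:
  assumes "\<And>i. i \<in> I \<Longrightarrow> polynomial_fun (p i)" shows "polynomial_fun (\<lambda>x. \<Prod>i\<in>I. p i x)"
  using assms by (induction I rule: infinite_finite_induct) (auto intro: polynomial_fun.intros)

lemmas polynomial_fun_intros = polynomial_fun.intros polynomial_fun_uminus polynomial_fun_diff
  polynomial_fun_power polynomial_fun_sum polynomial_fun_prod

text \<open>Restriction to a line reduces questions about several variables to root counting in one
  variable.\<close>

lemma polynomial_fun_line:
  assumes "polynomial_fun p"
  shows "\<exists>q. \<forall>t. p (a + t *s v) = poly q t"
  using assms
proof induction
  case (const c)
  show ?case by (rule exI[of _ "[:c:]"]) simp
next
  case (coord i)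
  show ?case by (rule exI[of _ "[:a $ i, v $ i:]"]) (simp add: mult.commute)
next
  case (add p q)
  then show ?case by (metis poly_add)
next
  case (mult p q)
  then show ?case by (metis poly_mult)
qed

lemma scaleR_eq_vector_scalar_mult:
  fixes v :: "'f::real_normed_field ^ 'n"
  shows "r *\<^sub>R v = of_real r *s v"
  by (simp add: vec_eq_iff) (simp add: scaleR_conv_of_real)

text \<open>On the line from \<open>a\<close> to \<open>x\<close>, a whole interval of real
  parameters stays in \<open>S\<close>, so the restricted polynomial has infinitely many roots; at
  parameter 1 it takes the value \<open>p x\<close>.\<close>

lemma polynomial_fun_eq_zero:
  fixes p :: "'f::real_or_complex ^ 'n \<Rightarrow> 'f"
  assumes p: "polynomial_fun p" and S: "open S" "a \<in> S" and zero: "\<And>x. x \<in> S \<Longrightarrow> p x = 0"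
  shows "p x = 0"
proof -
  obtain q where q: "\<And>t. p (a + t *s (x - a)) = poly q t"
    using polynomial_fun_line[OF p] by metis
  have "open ((\<lambda>r. a + r *\<^sub>R (x - a)) -` S)"
    by (intro open_vimage S continuous_intros)
  then obtain e where e: "e > 0" "ball 0 e \<subseteq> (\<lambda>r. a + r *\<^sub>R (x - a)) -` S"
    using S(2) by (force simp: open_contains_ball)
  have "(of_real :: real \<Rightarrow> 'f) ` ball 0 e \<subseteq> {t. poly q t = 0}"
    using e zero by (auto simp flip: q simp: scaleR_eq_vector_scalar_mult subset_iff)
  moreover have "infinite ((of_real :: real \<Rightarrow> 'f) ` ball 0 e)"
    using e(1) by (subst finite_image_iff) (auto simp: inj_on_def ball_eq_greaterThanLessThan)
  ultimately have "q = 0"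
    using poly_roots_finite finite_subset by blast
  then show ?thesis using q[of 1] by simp
qed

lemma nonzero_polynomialD: "nonzero_polynomial p \<Longrightarrow> polynomial_fun p"
  by (simp add: nonzero_polynomial_def)

text \<open>Join a point where \<open>p\<close> is nonzero to a point where \<open>q\<close> is
  nonzero. On this line both restrictions are nonzero polynomials in one variable, and so is their
  product, which has a non-root because the field is infinite.\<close>

lemma nonzero_polynomial_mult:
  fixes p q :: "'f::real_or_complex ^ 'n \<Rightarrow> 'f"
  assumes "nonzero_polynomial p" "nonzero_polynomial q"
  shows "nonzero_polynomial (\<lambda>x. p x * q x)"
proof -
  obtain a b where ab: "p a \<noteq> 0" "q b \<noteq> 0"
    using assms by (auto simp: nonzero_polynomial_def fun_eq_iff)
  obtain P where P: "\<And>t. p (a + t *s (b - a)) = poly P t"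
    using polynomial_fun_line[OF nonzero_polynomialD[OF assms(1)]] by metis
  obtain R where R: "\<And>t. q (a + t *s (b - a)) = poly R t"
    using polynomial_fun_line[OF nonzero_polynomialD[OF assms(2)]] by metis
  have "poly P 0 \<noteq> 0" "poly R 1 \<noteq> 0"
    using ab by (simp_all flip: P R)
  then have "P * R \<noteq> 0" by auto
  then have "finite {t. poly (P * R) t = 0}"
    by (rule poly_roots_finite)
  then have "{t. poly (P * R) t = 0} \<noteq> UNIV"
    by (metis infinite_UNIV_char_0)
  then obtain t where "poly (P * R) t \<noteq> 0"
    by auto
  then have "p (a + t *s (b - a)) * q (a + t *s (b - a)) \<noteq> 0"
    by (simp only: P R) simp
  then show ?thesis
    using assms unfolding nonzero_polynomial_def fun_eq_iff
    by (auto intro!: polynomial_fun.intros)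
qed

lemma nonzero_polynomial_prod:
  fixes p :: "'i \<Rightarrow> 'f::real_or_complex ^ 'n \<Rightarrow> 'f"
  assumes "\<And>i. i \<in> I \<Longrightarrow> nonzero_polynomial (p i)"
  shows "nonzero_polynomial (\<lambda>x. \<Prod>i\<in>I. p i x)"
  using assms
proof (induction I rule: infinite_finite_induct)
  case (insert i I)
  then show ?case using nonzero_polynomial_mult[of "p i"] by simp
qed (auto simp: nonzero_polynomial_def fun_eq_iff intro: polynomial_fun.intros)

lemma nonzero_polynomial_power:
  fixes p :: "'f::real_or_complex ^ 'n \<Rightarrow> 'f"
  assumes "nonzero_polynomial p"
  shows "nonzero_polynomial (\<lambda>x. p x ^ m)"
  using nonzero_polynomial_prod[of "{..<m}" "\<lambda>_. p"] assms by simp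

section \<open>Calculus of generic validity\<close>

lemma generically_mono:
  assumes "generically R" "\<And>x. R x \<Longrightarrow> R' x" shows "generically R'"
  using assms unfolding generically_def by blast

lemma generically_nonzero: "nonzero_polynomial p \<Longrightarrow> generically (\<lambda>x. p x \<noteq> 0)"
  unfolding generically_def by blast

lemma generically_conj:
  fixes R :: "'f::real_or_complex ^ 'n \<Rightarrow> bool"
  assumes "generically R" "generically R'" shows "generically (\<lambda>x. R x \<and> R' x)"
proof -
  obtain d d' where "nonzero_polynomial d" "\<And>x. d x \<noteq> 0 \<Longrightarrow> R x"
    "nonzero_polynomial d'" "\<And>x. d' x \<noteq> 0 \<Longrightarrow> R' x"
    using assms unfolding generically_def by blast
  then show ?thesis
    unfolding generically_def by (intro exI[of _ "\<lambda>x. d x * d' x"]) (auto intro: nonzero_polynomial_mult)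
qed

lemma generically_ex:
  fixes R :: "'f::real_or_complex ^ 'n \<Rightarrow> bool"
  assumes "generically R" shows "\<exists>x. R x"
  using assms unfolding generically_def nonzero_polynomial_def by (auto simp: fun_eq_iff)

lemma generically_all:
  fixes R :: "'i::finite \<Rightarrow> 'f::real_or_complex ^ 'n \<Rightarrow> bool"
  assumes "\<And>i. generically (R i)" shows "generically (\<lambda>x. \<forall>i. R i x)"
proof -
  obtain d where d: "\<And>i. nonzero_polynomial (d i)" "\<And>i x. d i x \<noteq> 0 \<Longrightarrow> R i x"
    using assms unfolding generically_def by metis
  show ?thesis
    unfolding generically_def using d
    by (intro exI[of _ "\<lambda>x. \<Prod>i\<in>UNIV. d i x"]) (auto intro!: nonzero_polynomial_prod)
qed

lemma generically_polynomial_eq_zero: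
  fixes p :: "'f::real_or_complex ^ 'n \<Rightarrow> 'f"
  assumes "polynomial_fun p" "generically (\<lambda>x. p x = 0)" shows "p x = 0"
proof (rule ccontr)
  assume "p x \<noteq> 0"
  then have "nonzero_polynomial p"
    using assms(1) by (auto simp: nonzero_polynomial_def)
  from generically_conj[OF generically_nonzero[OF this] assms(2)] show False
    by (auto dest: generically_ex)
qed

section \<open>Analytic properties of polynomials\<close>

lemma continuous_polynomial_fun:
  fixes p :: "'f::real_normed_field ^ 'n \<Rightarrow> 'f"
  assumes "polynomial_fun p" shows "continuous_on S p"
  using assms by induction (auto intro!: continuous_intros)

lemma open_nonzero_polynomial:
  fixes p :: "'f::real_normed_field ^ 'n \<Rightarrow> 'f"
  assumes "polynomial_fun p" shows "open {x. p x \<noteq> 0}"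
  by (intro open_Collect_neq continuous_polynomial_fun assms continuous_intros)

lemma polynomial_fun_has_derivative:
  fixes p :: "'f::{real_normed_field,euclidean_space} ^ 'n \<Rightarrow> 'f"
  assumes "polynomial_fun p"
  shows "\<exists>p'. (\<forall>i. polynomial_fun (p' i)) \<and> (\<forall>x. (p has_derivative (\<lambda>v. \<Sum>i\<in>UNIV. p' i x * v $ i)) (at x))"
  using assms
proof induction
  case (const c)
  show ?case by (rule exI[of _ "\<lambda>i x. 0"]) (auto intro: polynomial_fun.intros)
next
  case (coord j)
  have "((\<lambda>x::'f^'n. x $ j) has_derivative (\<lambda>v. \<Sum>i\<in>UNIV. (if i = j then 1 else 0) * v $ i)) (at x)" for x
    by (rule has_derivative_eq_rhs[OF bounded_linear.has_derivative[OF bounded_linear_vec_nth has_derivative_ident]])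
       (simp add: if_distrib if_distribR cong: if_cong)
  then show ?case
    by (intro exI[of _ "\<lambda>i x. if i = j then 1 else 0"]) (auto intro: polynomial_fun.intros)
next
  case (add p q)
  then obtain p' q' where *: "\<And>i. polynomial_fun (p' i)" "\<And>i. polynomial_fun (q' i)"
    "\<And>x. (p has_derivative (\<lambda>v. \<Sum>i\<in>UNIV. p' i x * v $ i)) (at x)"
    "\<And>x. (q has_derivative (\<lambda>v. \<Sum>i\<in>UNIV. q' i x * v $ i)) (at x)"
    by blast
  show ?case
    by (intro exI[of _ "\<lambda>i x. p' i x + q' i x"] conjI allI polynomial_fun.intros *)
       (rule has_derivative_eq_rhs[OF has_derivative_add[OF *(3,4)]], simp add: sum.distrib algebra_simps)
next
  case (mult p q)
  then obtain p' q' where *: "\<And>i. polynomial_fun (p' i)" "\<And>i. polynomial_fun (q' i)"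
    "\<And>x. (p has_derivative (\<lambda>v. \<Sum>i\<in>UNIV. p' i x * v $ i)) (at x)"
    "\<And>x. (q has_derivative (\<lambda>v. \<Sum>i\<in>UNIV. q' i x * v $ i)) (at x)"
    by blast
  show ?case
    by (intro exI[of _ "\<lambda>i x. p x * q' i x + p' i x * q x"] conjI allI polynomial_fun.intros * mult)
       (rule has_derivative_eq_rhs[OF has_derivative_mult[OF *(3,4)]],
        simp add: sum.distrib algebra_simps sum_distrib_left)
qed

subsection \<open>Rational functions\<close>

text \<open>The exceptional set on which \<open>Q\<close> may differ from the quotient is the zero
  set of some \<open>d\<close>. Multiplying numerator and denominator by \<open>d\<close> moves it
  into the zero set of the denominator, so that a single polynomial controls all bad points.\<close>

lemma rational_fun_iff:
  fixes Q :: "'f::real_or_complex ^ 'n \<Rightarrow> 'f"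
  shows "rational_fun Q \<longleftrightarrow>
    (\<exists>a b. polynomial_fun a \<and> nonzero_polynomial b \<and> (\<forall>x. b x \<noteq> 0 \<longrightarrow> Q x = a x / b x))"
proof
  assume "rational_fun Q"
  then obtain a b d where *: "polynomial_fun a" "nonzero_polynomial b" "nonzero_polynomial d"
    "\<And>x. d x \<noteq> 0 \<Longrightarrow> Q x = a x / b x"
    unfolding rational_fun_def represents_quotient_def generically_def by blast
  then show "\<exists>a b. polynomial_fun a \<and> nonzero_polynomial b \<and> (\<forall>x. b x \<noteq> 0 \<longrightarrow> Q x = a x / b x)"
    by (intro exI[of _ "\<lambda>x. a x * d x"] exI[of _ "\<lambda>x. b x * d x"])
       (auto intro: nonzero_polynomial_mult polynomial_fun.intros simp: nonzero_polynomialD)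
next
  assume "\<exists>a b. polynomial_fun a \<and> nonzero_polynomial b \<and> (\<forall>x. b x \<noteq> 0 \<longrightarrow> Q x = a x / b x)"
  then show "rational_fun Q"
    unfolding rational_fun_def represents_quotient_def generically_def by metis
qed

lemma rational_funE:
  fixes Q :: "'f::real_or_complex ^ 'n \<Rightarrow> 'f"
  assumes "rational_fun Q"
  obtains a b where "polynomial_fun a" "nonzero_polynomial b" "\<And>x. b x \<noteq> 0 \<Longrightarrow> Q x = a x / b x"
  using assms unfolding rational_fun_iff by blast

lemma nonzero_polynomial_one: "nonzero_polynomial (\<lambda>x::'f::real_or_complex^'n. 1)"
  by (auto simp: nonzero_polynomial_def fun_eq_iff intro: polynomial_fun.intros)

lemma rational_fun_polynomial:
  fixes p :: "'f::real_or_complex ^ 'n \<Rightarrow> 'f"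
  assumes "polynomial_fun p" shows "rational_fun p"
  unfolding rational_fun_iff using assms
  by (intro exI[of _ p] exI[of _ "\<lambda>_. 1"]) (auto intro: nonzero_polynomial_one)

lemma rational_fun_add:
  fixes Q R :: "'f::real_or_complex ^ 'n \<Rightarrow> 'f"
  assumes "rational_fun Q" "rational_fun R" shows "rational_fun (\<lambda>x. Q x + R x)"
proof -
  from assms obtain a b c d where *: "polynomial_fun a" "nonzero_polynomial b" "polynomial_fun c"
    "nonzero_polynomial d"
    "\<And>x. b x \<noteq> 0 \<Longrightarrow> Q x = a x / b x" "\<And>x. d x \<noteq> 0 \<Longrightarrow> R x = c x / d x"
    by (metis rational_funE)
  show ?thesis unfolding rational_fun_iff
    by (intro exI[of _ "\<lambda>x. a x * d x + c x * b x"] exI[of _ "\<lambda>x. b x * d x"])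
       (auto intro!: nonzero_polynomial_mult polynomial_fun_intros simp: * nonzero_polynomialD field_simps)
qed

lemma rational_fun_mult:
  fixes Q R :: "'f::real_or_complex ^ 'n \<Rightarrow> 'f"
  assumes "rational_fun Q" "rational_fun R" shows "rational_fun (\<lambda>x. Q x * R x)"
proof -
  from assms obtain a b c d where *: "polynomial_fun a" "nonzero_polynomial b" "polynomial_fun c"
    "nonzero_polynomial d"
    "\<And>x. b x \<noteq> 0 \<Longrightarrow> Q x = a x / b x" "\<And>x. d x \<noteq> 0 \<Longrightarrow> R x = c x / d x"
    by (metis rational_funE)
  show ?thesis unfolding rational_fun_iff
    by (intro exI[of _ "\<lambda>x. a x * c x"] exI[of _ "\<lambda>x. b x * d x"])
       (auto intro!: nonzero_polynomial_mult polynomial_fun_intros simp: * nonzero_polynomialD)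
qed

lemma rational_fun_diff:
  fixes Q R :: "'f::real_or_complex ^ 'n \<Rightarrow> 'f"
  assumes "rational_fun Q" "rational_fun R" shows "rational_fun (\<lambda>x. Q x - R x)"
  using rational_fun_add[OF assms(1) rational_fun_mult[OF rational_fun_polynomial[OF polynomial_fun.const[of "-1"]] assms(2)]]
  by simp

lemma rational_fun_sum:
  fixes Q :: "'i \<Rightarrow> 'f::real_or_complex ^ 'n \<Rightarrow> 'f"
  assumes "\<And>i. i \<in> I \<Longrightarrow> rational_fun (Q i)" shows "rational_fun (\<lambda>x. \<Sum>i\<in>I. Q i x)"
  using assms by (induction I rule: infinite_finite_induct)
    (auto intro: rational_fun_polynomial polynomial_fun.intros rational_fun_add)

lemma rational_fun_prod:
  fixes Q :: "'i \<Rightarrow> 'f::real_or_complex ^ 'n \<Rightarrow> 'f"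
  assumes "\<And>i. i \<in> I \<Longrightarrow> rational_fun (Q i)" shows "rational_fun (\<lambda>x. \<Prod>i\<in>I. Q i x)"
  using assms by (induction I rule: infinite_finite_induct)
    (auto intro: rational_fun_polynomial polynomial_fun.intros rational_fun_mult)

lemma rational_fun_compose:
  fixes f :: "'f::real_or_complex ^ 'n \<Rightarrow> 'f ^ 'm"
  assumes "polynomial_fun p" "rational_map f" shows "rational_fun (\<lambda>x. p (f x))"
  using assms
  by (induction rule: polynomial_fun.induct)
    (auto intro: rational_fun_polynomial polynomial_fun.intros rational_fun_mult rational_fun_add
      simp: rational_map_def)

text \<open>For rational functions the negation of "generically zero" is again a generic statement.
  This is what makes hypotheses of the form "not identically zero" usable.\<close>

lemma rational_fun_dichotomy:
  fixes Q :: "'f::real_or_complex ^ 'n \<Rightarrow> 'f"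
  assumes "rational_fun Q"
  shows "generically (\<lambda>x. Q x = 0) \<or> generically (\<lambda>x. Q x \<noteq> 0)"
proof -
  obtain a b where ab: "polynomial_fun a" "nonzero_polynomial b" "\<And>x. b x \<noteq> 0 \<Longrightarrow> Q x = a x / b x"
    using assms unfolding rational_fun_iff by blast
  show ?thesis
  proof (cases "nonzero_polynomial a")
    case True
    have "generically (\<lambda>x. Q x \<noteq> 0)"
      by (rule generically_mono[OF generically_conj[OF generically_nonzero[OF True] generically_nonzero[OF ab(2)]]])
         (simp add: ab)
    then show ?thesis ..
  next
    case False
    then have "a = (\<lambda>x. 0)" using ab(1) by (simp add: nonzero_polynomial_def)
    then have "generically (\<lambda>x. Q x = 0)"
      by (intro generically_mono[OF generically_nonzero[OF ab(2)]]) (simp add: ab)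
    then show ?thesis ..
  qed
qed

lemma generically_nonzero_compose:
  fixes f :: "'f::real_or_complex ^ 'n \<Rightarrow> 'f ^ 'm"
  assumes "nonzero_polynomial p" "rational_map f" "dominant_map f"
  shows "generically (\<lambda>x. p (f x) \<noteq> 0)"
  using rational_fun_dichotomy[OF rational_fun_compose[OF nonzero_polynomialD[OF assms(1)] assms(2)]] assms(1,3)
  unfolding dominant_map_def by blast

lemma generically_compose:
  fixes f :: "'f::real_or_complex ^ 'n \<Rightarrow> 'f ^ 'm"
  assumes "generically R" "rational_map f" "dominant_map f"
  shows "generically (\<lambda>x. R (f x))"
proof -
  obtain d where d: "nonzero_polynomial d" "\<And>x. d x \<noteq> 0 \<Longrightarrow> R x"
    using assms(1) unfolding generically_def by blast
  show ?thesis
    by (rule generically_mono[OF generically_nonzero_compose[OF d(1) assms(2,3)]]) (rule d(2))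
qed

lemma generically_zero_compose_iff:
  fixes f :: "'f::real_or_complex ^ 'n \<Rightarrow> 'f ^ 'm"
  assumes "rational_fun Q" "rational_map f" "dominant_map f" "generically (\<lambda>x. Q (f x) = 0)"
  shows "generically (\<lambda>y. Q y = 0)"
  using rational_fun_dichotomy[OF assms(1)]
proof
  assume "generically (\<lambda>x. Q x \<noteq> 0)"
  from generically_conj[OF generically_compose[OF this assms(2,3)] assms(4)]
  show ?thesis by (auto dest: generically_ex)
qed

text \<open>Dominance keeps the denominator \<open>b (f x)\<close> from vanishing generically; hence
  its own numerator \<open>c'\<close> is a nonzero polynomial and may enter the denominator of the
  composite.\<close>

lemma rational_fun_compose_rational:
  fixes f :: "'f::real_or_complex ^ 'n \<Rightarrow> 'f ^ 'm"
  assumes "rational_fun Q" "rational_map f" "dominant_map f"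
  shows "rational_fun (\<lambda>x. Q (f x))"
proof -
  obtain a b where ab: "polynomial_fun a" "nonzero_polynomial b" "\<And>x. b x \<noteq> 0 \<Longrightarrow> Q x = a x / b x"
    using assms(1) unfolding rational_fun_iff by blast
  obtain c d where cd: "polynomial_fun c"
    "nonzero_polynomial d" "\<And>x. d x \<noteq> 0 \<Longrightarrow> a (f x) = c x / d x"
    using rational_fun_compose[OF ab(1) assms(2)] unfolding rational_fun_iff by blast
  obtain c' d' where cd':
    "polynomial_fun c'" "nonzero_polynomial d'" "\<And>x. d' x \<noteq> 0 \<Longrightarrow> b (f x) = c' x / d' x"
    using rational_fun_compose[OF nonzero_polynomialD[OF ab(2)] assms(2)] unfolding rational_fun_iff by blast
  have gen: "generically (\<lambda>x. b (f x) \<noteq> 0 \<and> d x \<noteq> 0 \<and> d' x \<noteq> 0)"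
    by (intro generically_conj generically_nonzero_compose ab assms generically_nonzero cd cd')
  have "c' \<noteq> (\<lambda>x. 0)"
    using generically_ex[OF gen] cd'(3) by auto
  then have "nonzero_polynomial c'"
    using cd' by (simp add: nonzero_polynomial_def)
  then have "nonzero_polynomial (\<lambda>x. d x * c' x)"
    by (rule nonzero_polynomial_mult[OF cd(2)])
  moreover have "generically (\<lambda>x. Q (f x) = (c x * d' x) / (d x * c' x))"
    by (rule generically_mono[OF gen]) (auto simp: ab cd cd')
  moreover have "polynomial_fun (\<lambda>x. c x * d' x)"
    using cd(1) nonzero_polynomialD[OF cd'(2)] by (rule polynomial_fun.mult)
  ultimately show ?thesis
    unfolding rational_fun_def represents_quotient_def by blast
qed

text \<open>A generic left inverse of a dominant map does everything. If a polynomial vanishes on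
  the image of \<open>g\<close>, composing with \<open>f\<close> shows that it vanishes generically,
  so \<open>g\<close> is dominant. And \<open>f (g y) - y\<close> becomes zero after substituting
  \<open>y = f x\<close>, hence is generically zero because \<open>f\<close> is dominant.\<close>

lemma birational_isomorphismI:
  fixes f g :: "'f::real_or_complex ^ 'n \<Rightarrow> 'f ^ 'n"
  assumes f: "rational_map f" "dominant_map f" and g: "rational_map g"
    and gf: "generically (\<lambda>x. g (f x) = x)"
  shows "birational_isomorphism f"
proof -
  have "p x = 0" if "polynomial_fun p" "generically (\<lambda>y. p (g y) = 0)" for p :: "'f^'n \<Rightarrow> 'f" and x
    by (rule generically_polynomial_eq_zero[OF that(1)],
        rule generically_mono[OF generically_conj[OF gf generically_compose[OF that(2) f]]]) auto
  then have dom: "dominant_map g"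
    unfolding dominant_map_def nonzero_polynomial_def by (auto simp: fun_eq_iff)
  have "generically (\<lambda>y. f (g y) $ i - y $ i = 0)" for i
  proof (rule generically_zero_compose_iff[OF _ f])
    show "rational_fun (\<lambda>y. f (g y) $ i - y $ i)"
    proof (rule rational_fun_diff)
      show "rational_fun (\<lambda>y. f (g y) $ i)"
        using rational_fun_compose_rational[OF _ g dom, of "\<lambda>x. f x $ i"] f(1)
        by (simp add: rational_map_def)
      show "rational_fun (\<lambda>y::'f^'n. y $ i)"
        by (rule rational_fun_polynomial[OF polynomial_fun.coord])
    qed
    show "generically (\<lambda>x. f (g (f x)) $ i - f x $ i = 0)"
      by (rule generically_mono[OF gf]) simp
  qed
  then have "generically (\<lambda>y. \<forall>i. f (g y) $ i - y $ i = 0)"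
    by (rule generically_all)
  then have "generically (\<lambda>y. f (g y) = y)"
    by (rule generically_mono) (simp add: vec_eq_iff)
  then show ?thesis
    unfolding birational_isomorphism_def using f g dom gf by blast
qed

subsection \<open>Differentials of rational functions\<close>

lemma bounded_linear_scalar_product:
  fixes q :: "'f::real_normed_field ^ 'n"
  shows "bounded_linear (scalar_product q)"
  unfolding scalar_product_def[abs_def]
  by (intro bounded_linear_sum bounded_linear_const_mult bounded_linear_vec_nth)

lemma bounded_linear_axis: "bounded_linear (axis i :: 'a::real_normed_vector \<Rightarrow> 'a ^ 'n)"
proof (rule bounded_linear_intro[of _ 1])
  fix x y :: 'a and r :: real
  show "axis i (x + y) = (axis i x + axis i y :: 'a^'n)" "axis i (r *\<^sub>R x) = (r *\<^sub>R axis i x :: 'a^'n)"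
    by (simp_all add: axis_def vec_eq_iff)
  have "norm (axis i x :: 'a^'n) \<le> (\<Sum>j\<in>UNIV. norm ((axis i x :: 'a^'n) $ j))"
    unfolding norm_vec_def by (rule L2_set_le_sum) simp
  also have "\<dots> = (\<Sum>j\<in>UNIV. if j = i then norm x else 0)"
    by (intro sum.cong) (auto simp: axis_def)
  finally show "norm (axis i x :: 'a^'n) \<le> norm x * 1"
    by simp
qed

lemma has_derivative_vec_lambda:
  fixes f :: "'n::finite \<Rightarrow> 'a::real_normed_vector \<Rightarrow> 'b::real_normed_vector"
  assumes "\<And>i. (f i has_derivative f' i) (at x)"
  shows "((\<lambda>x. \<chi> i. f i x) has_derivative (\<lambda>v. \<chi> i. f' i v)) (at x)"
proof -
  have sum_axis: "(\<chi> i. g i) = (\<Sum>i\<in>UNIV. axis i (g i))" for g :: "'n \<Rightarrow> 'b"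
    by (simp add: vec_eq_iff sum_component axis_def if_distrib cong: if_cong)
  show ?thesis
    unfolding sum_axis
    by (intro has_derivative_sum bounded_linear.has_derivative[OF bounded_linear_axis] assms)
qed

lemma scalar_product_axis:
  fixes q :: "'f::real_normed_field ^ 'n"
  shows "scalar_product q (axis i r) = q $ i * r" "scalar_product (axis i r) q = r * q $ i"
  by (simp_all add: scalar_product_def axis_def if_distrib if_distribR cong: if_cong)

lemma scalar_product_add:
  fixes p q v :: "'f::real_normed_field ^ 'n"
  shows "scalar_product (p + q) v = scalar_product p v + scalar_product q v"
    "scalar_product v (p + q) = scalar_product v p + scalar_product v q"
    "scalar_product (p - q) v = scalar_product p v - scalar_product q v"
    "scalar_product v (p - q) = scalar_product v p - scalar_product v q"
  by (simp_all add: scalar_product_def algebra_simps sum.distrib sum_subtractf)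

lemma scalar_product_commute:
  fixes p q :: "'f::real_normed_field ^ 'n"
  shows "scalar_product p q = scalar_product q p"
  by (simp add: scalar_product_def mult.commute)

lemma partial_deriv_eqI:
  fixes Q :: "'f::real_or_complex ^ 'n \<Rightarrow> 'f"
  assumes "(Q has_derivative scalar_product q) (at x)"
  shows "partial_deriv i Q x = q $ i"
proof -
  have "t *s axis i 1 = (axis i t :: 'f^'n)" for t
    by (simp add: vec_eq_iff axis_def)
  then have "((\<lambda>t::'f. x + t *s axis i 1) has_derivative (axis i :: 'f \<Rightarrow> 'f^'n)) (at 0)"
    using has_derivative_add[OF has_derivative_const[of x] bounded_linear_imp_has_derivative[OF bounded_linear_axis[of i]]]
    by simp
  then have "((\<lambda>t. Q (x + t *s axis i 1)) has_derivative (\<lambda>t. scalar_product q (axis i t))) (at 0)"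
    using has_derivative_compose[of "\<lambda>t. x + t *s axis i 1" "\<lambda>t. axis i t" 0 UNIV Q "scalar_product q"] assms
    by simp
  then have "((\<lambda>t. Q (x + t *s axis i 1)) has_field_derivative q $ i) (at 0)"
    by (simp add: has_field_derivative_def scalar_product_axis)
  then show ?thesis
    unfolding partial_deriv_def by (rule DERIV_imp_deriv)
qed

lemma differential_eqI:
  fixes Q :: "'f::real_or_complex ^ 'n \<Rightarrow> 'f"
  assumes "(Q has_derivative scalar_product q) (at x)"
  shows "differential Q x = q"
  using partial_deriv_eqI[OF assms] by (simp add: differential_def vec_eq_iff)

text \<open>The quotient rule is left unreduced, with denominator the square of \<open>b\<close>, so
  that differentiation creates no singularities outside the zeros of \<open>b\<close>.\<close>

lemma quotient_has_derivative:
  fixes Q :: "'f::real_or_complex ^ 'n \<Rightarrow> 'f"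
  assumes a: "polynomial_fun a" and b: "polynomial_fun b" and Q: "\<And>x. b x \<noteq> 0 \<Longrightarrow> Q x = a x / b x"
  obtains n where "\<And>i. polynomial_fun (n i)"
    "\<And>x. b x \<noteq> 0 \<Longrightarrow> (Q has_derivative scalar_product (\<chi> i. n i x / (b x)\<^sup>2)) (at x)"
    "\<And>x i. b x \<noteq> 0 \<Longrightarrow> partial_deriv i Q x = n i x / (b x)\<^sup>2"
proof -
  obtain a' where a': "\<And>i. polynomial_fun (a' i)"
    "\<And>x. (a has_derivative (\<lambda>v. \<Sum>i\<in>UNIV. a' i x * v $ i)) (at x)"
    using polynomial_fun_has_derivative[OF a] by blast
  obtain b' where b': "\<And>i. polynomial_fun (b' i)"
    "\<And>x. (b has_derivative (\<lambda>v. \<Sum>i\<in>UNIV. b' i x * v $ i)) (at x)"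
    using polynomial_fun_has_derivative[OF b] by blast
  let ?n = "\<lambda>i x. a' i x * b x - a x * b' i x"
  have der: "(Q has_derivative scalar_product (\<chi> i. ?n i x / (b x)\<^sup>2)) (at x)" if x: "b x \<noteq> 0" for x
  proof (rule has_derivative_transform_within_open[OF _ open_nonzero_polynomial[OF b]])
    show "((\<lambda>x. a x / b x) has_derivative scalar_product (\<chi> i. ?n i x / (b x)\<^sup>2)) (at x)"
      by (rule has_derivative_eq_rhs[OF has_derivative_divide'[OF a'(2) b'(2) x]])
         (simp add: fun_eq_iff scalar_product_def power2_eq_square sum_distrib_left
            sum_distrib_right sum_subtractf[symmetric] sum_divide_distrib algebra_simps)
  qed (use x Q in auto)
  show thesis
  proof (rule that[of ?n])
    show "partial_deriv i Q x = ?n i x / (b x)\<^sup>2" if "b x \<noteq> 0" for x i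
      using partial_deriv_eqI[OF der[OF that]] by simp
  qed (use der in \<open>auto intro!: polynomial_fun_intros a a' b b'\<close>)
qed

lemma rational_fun_partial_deriv:
  fixes Q :: "'f::real_or_complex ^ 'n \<Rightarrow> 'f"
  assumes "rational_fun Q" shows "rational_fun (partial_deriv i Q)"
proof -
  obtain a b where ab: "polynomial_fun a" "nonzero_polynomial b" "\<And>x. b x \<noteq> 0 \<Longrightarrow> Q x = a x / b x"
    using assms unfolding rational_fun_iff by blast
  obtain n where n: "\<And>i. polynomial_fun (n i)" "\<And>x i. b x \<noteq> 0 \<Longrightarrow> partial_deriv i Q x = n i x / (b x)\<^sup>2"
    by (rule quotient_has_derivative[OF ab(1) nonzero_polynomialD[OF ab(2)] ab(3)]) auto
  show ?thesis unfolding rational_fun_iff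
    using n by (intro exI[of _ "n i"] exI[of _ "\<lambda>x. (b x)\<^sup>2"])
      (auto intro: nonzero_polynomial_power ab)
qed

lemma rational_map_differential:
  fixes Q :: "'f::real_or_complex ^ 'n \<Rightarrow> 'f"
  assumes "rational_fun Q" shows "rational_map (differential Q)"
  using rational_fun_partial_deriv[OF assms] by (simp add: rational_map_def differential_def)

lemma generically_has_derivative:
  fixes Q :: "'f::real_or_complex ^ 'n \<Rightarrow> 'f"
  assumes "rational_fun Q"
  shows "generically (\<lambda>x. (Q has_derivative scalar_product (differential Q x)) (at x))"
proof -
  obtain a b where ab: "polynomial_fun a" "nonzero_polynomial b" "\<And>x. b x \<noteq> 0 \<Longrightarrow> Q x = a x / b x"
    using assms unfolding rational_fun_iff by blast
  obtain n where n: "\<And>x. b x \<noteq> 0 \<Longrightarrow> (Q has_derivative scalar_product (\<chi> i. n i x / (b x)\<^sup>2)) (at x)"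
    by (rule quotient_has_derivative[OF ab(1) nonzero_polynomialD[OF ab(2)] ab(3)]) auto
  show ?thesis
    by (rule generically_mono[OF generically_nonzero[OF ab(2)]]) (use n differential_eqI[OF n] in simp)
qed

text \<open>In \<open>hessian Q x\<close> the row index is the direction of differentiation and the
  column index the component of Q', which is why the Jacobian matrix of Q' is the transpose.\<close>

lemma generically_has_derivative_differential:
  fixes Q :: "'f::real_or_complex ^ 'n \<Rightarrow> 'f"
  assumes "rational_fun Q"
  shows "generically (\<lambda>x. (differential Q has_derivative (\<lambda>v. transpose (hessian Q x) *v v)) (at x))"
proof -
  have "generically (\<lambda>x. \<forall>j. (partial_deriv j Q has_derivative scalar_product (differential (partial_deriv j Q) x)) (at x))"
    by (intro generically_all generically_has_derivative rational_fun_partial_deriv assms)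
  then show ?thesis
  proof (rule generically_mono)
    fix x
    assume *: "\<forall>j. (partial_deriv j Q has_derivative scalar_product (differential (partial_deriv j Q) x)) (at x)"
    have "(differential Q has_derivative (\<lambda>v. \<chi> j. scalar_product (differential (partial_deriv j Q) x) v)) (at x)"
      unfolding differential_def[of Q, abs_def] by (rule has_derivative_vec_lambda) (use * in auto)
    moreover have "(\<chi> j. scalar_product (differential (partial_deriv j Q) x) v) = transpose (hessian Q x) *v v" for v
      by (simp add: vec_eq_iff scalar_product_def differential_def hessian_def transpose_def matrix_vector_mult_def)
    ultimately show "(differential Q has_derivative (\<lambda>v. transpose (hessian Q x) *v v)) (at x)"
      by simp
  qed
qed

lemma rational_fun_det_hessian:
  fixes Q :: "'f::real_or_complex ^ 'n \<Rightarrow> 'f"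
  assumes "rational_fun Q" shows "rational_fun (\<lambda>x. det (hessian Q x))"
  unfolding det_def hessian_def
  by (auto intro!: rational_fun_sum rational_fun_mult rational_fun_prod rational_fun_partial_deriv assms
      rational_fun_polynomial[OF polynomial_fun.const])

lemma generically_continuous:
  fixes Q :: "'f::real_or_complex ^ 'n \<Rightarrow> 'f"
  assumes "rational_fun Q" shows "generically (\<lambda>x. isCont Q x)"
  by (rule generically_mono[OF generically_has_derivative[OF assms]]) (rule has_derivative_continuous)

lemma norm_matrix_vector_mult_le:
  fixes A :: "'f::real_normed_field ^ 'n ^ 'm"
  shows "norm (A *v v) \<le> (\<Sum>i\<in>UNIV. \<Sum>j\<in>UNIV. norm (A $ i $ j)) * norm v"
proof -
  have "norm (A *v v) \<le> (\<Sum>i\<in>UNIV. norm ((A *v v) $ i))"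
    unfolding norm_vec_def by (rule L2_set_le_sum) simp
  also have "\<dots> \<le> (\<Sum>i\<in>UNIV. \<Sum>j\<in>UNIV. norm (A $ i $ j) * norm v)"
    unfolding matrix_vector_mult_def
    by (auto intro!: sum_mono sum_norm_le mult_left_mono Finite_Cartesian_Product.norm_nth_le simp: norm_mult)
  finally show ?thesis by (simp add: sum_distrib_right)
qed

lemma bounded_linear_matrix_vector_mult:
  fixes A :: "'f::real_normed_field ^ 'n ^ 'm"
  shows "bounded_linear ((*v) A)"
proof (rule bounded_linear_intro)
  show "A *v (x + y) = A *v x + A *v y" for x y by (rule matrix_vector_right_distrib)
  show "A *v (r *\<^sub>R x) = r *\<^sub>R (A *v x)" for r x
    by (simp add: scaleR_eq_vector_scalar_mult vector_scalar_commute)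
  show "norm (A *v x) \<le> norm x * (\<Sum>i\<in>UNIV. \<Sum>j\<in>UNIV. norm (A $ i $ j))" for x
    using norm_matrix_vector_mult_le[of A x] by (simp add: mult.commute)
qed

lemma matrix_vector_mult_diff_matrix:
  fixes A B :: "'f::real_normed_field ^ 'n ^ 'm"
  shows "A *v v - B *v v = (A - B) *v v"
  by (simp add: matrix_vector_mult_def vec_eq_iff algebra_simps sum_subtractf)

text \<open>Near a generic point Q' has a continuous invertible derivative, hence is injective on a
  ball, and by invariance of domain the image of the ball is open. A polynomial that vanishes on
  this image is zero.\<close>

lemma dominant_map_differential:
  fixes Q :: "'f::real_or_complex ^ 'n \<Rightarrow> 'f"
  assumes Q: "rational_fun Q" and det: "\<not> generically (\<lambda>x. det (hessian Q x) = 0)"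
  shows "dominant_map (differential Q)"
  unfolding dominant_map_def
proof (intro allI impI notI)
  fix p :: "'f^'n \<Rightarrow> 'f" assume p: "nonzero_polynomial p" and pQ: "generically (\<lambda>x. p (differential Q x) = 0)"
  have "generically (\<lambda>x. det (hessian Q x) \<noteq> 0)"
    using rational_fun_dichotomy[OF rational_fun_det_hessian[OF Q]] det by blast
  moreover have "generically (\<lambda>x. \<forall>i. \<forall>j. isCont (\<lambda>x. hessian Q x $ i $ j) x)"
    by (intro generically_all generically_continuous) (simp add: hessian_def rational_fun_partial_deriv Q)
  ultimately have "generically (\<lambda>x. p (differential Q x) = 0 \<and>
      (differential Q has_derivative (\<lambda>v. transpose (hessian Q x) *v v)) (at x) \<and>
      det (hessian Q x) \<noteq> 0 \<and> (\<forall>i. \<forall>j. isCont (\<lambda>x. hessian Q x $ i $ j) x))"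
    by (intro generically_conj pQ generically_has_derivative_differential Q)
  then obtain d where d: "nonzero_polynomial d" and *:
    "\<And>x. d x \<noteq> 0 \<Longrightarrow> p (differential Q x) = 0"
    "\<And>x. d x \<noteq> 0 \<Longrightarrow> (differential Q has_derivative (\<lambda>v. transpose (hessian Q x) *v v)) (at x)"
    "\<And>x. d x \<noteq> 0 \<Longrightarrow> det (hessian Q x) \<noteq> 0"
    "\<And>x i j. d x \<noteq> 0 \<Longrightarrow> isCont (\<lambda>x. hessian Q x $ i $ j) x"
    unfolding generically_def by blast
  define S where "S = {x. d x \<noteq> 0}"
  have S: "open S" unfolding S_def by (rule open_nonzero_polynomial[OF nonzero_polynomialD[OF d]])
  obtain a where a: "a \<in> S" using d by (auto simp: S_def nonzero_polynomial_def)
  let ?H = "\<lambda>x. transpose (hessian Q x)"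
  have "invertible (?H a)"
    using *(3)[of a] a by (simp add: S_def invertible_det_nz det_transpose)
  then obtain B where B: "B ** ?H a = mat 1"
    unfolding invertible_def by blast
  \<comment> \<open>The operator norm of a matrix is at most the sum of the norms of its entries, so
    continuity of the second partial derivatives gives continuity of the derivative in operator
    norm.\<close>
  have "\<exists>r>0. \<forall>x. dist a x < r \<longrightarrow> onorm (\<lambda>v. ?H x *v v - ?H a *v v) < e" if "e > 0" for e
  proof -
    let ?s = "\<lambda>x. \<Sum>i\<in>UNIV. \<Sum>j\<in>UNIV. norm ((?H x - ?H a) $ i $ j)"
    have "isCont ?s a"
      using *(4)[of a] a by (auto intro!: continuous_intros simp: S_def transpose_def)
    then obtain r where r: "r > 0" "\<And>x. dist a x < r \<Longrightarrow> dist (?s x) (?s a) < e"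
      using \<open>e > 0\<close> unfolding continuous_at_eps_delta by (metis dist_commute)
    have "onorm (\<lambda>v. ?H x *v v - ?H a *v v) < e" if "dist a x < r" for x
    proof -
      have "onorm (\<lambda>v. ?H x *v v - ?H a *v v) \<le> ?s x"
        unfolding matrix_vector_mult_diff_matrix by (rule onorm_le) (rule norm_matrix_vector_mult_le)
      also have "?s x < e" using r(2)[OF that] by (simp add: dist_real_def)
      finally show ?thesis .
    qed
    with r(1) show ?thesis by blast
  qed
  then obtain r where r: "r > 0" "ball a r \<subseteq> S" "inj_on (differential Q) (ball a r)"
    by (rule has_derivative_locally_injective[OF a S bounded_linear_matrix_vector_mult[of B], of "\<lambda>x v. ?H x *v v", rotated 2])
       (use *(2) S_def B in \<open>auto simp: fun_eq_iff matrix_vector_mul_assoc simp del: transpose_matrix_vector\<close>)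
  have "continuous_on (ball a r) (differential Q)"
    using r(2) *(2) by (intro continuous_at_imp_continuous_on) (auto intro: has_derivative_continuous simp: S_def)
  then have "open (differential Q ` ball a r)"
    by (rule invariance_of_domain[OF _ open_ball r(3)])
  moreover have "differential Q a \<in> differential Q ` ball a r" using r(1) by simp
  ultimately have "p y = 0" for y
    by (rule polynomial_fun_eq_zero[OF nonzero_polynomialD[OF p]]) (use r *(1) in \<open>auto simp: S_def\<close>)
  then show False using p by (auto simp: nonzero_polynomial_def)
qed

subsection \<open>The Legendre transform\<close>

lemma critical_point_iff:
  fixes Q :: "'f::real_or_complex ^ 'n \<Rightarrow> 'f"
  assumes "(Q has_derivative scalar_product (differential Q u)) (at u)"
  shows "critical_point (\<lambda>w. scalar_product p w - Q w) u \<longleftrightarrow> differential Q u = p"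
proof -
  have der: "((\<lambda>w. scalar_product p w - Q w) has_derivative scalar_product (p - differential Q u)) (at u)"
    by (rule has_derivative_eq_rhs[OF has_derivative_diff[OF bounded_linear_imp_has_derivative[OF bounded_linear_scalar_product] assms]])
       (simp add: fun_eq_iff scalar_product_add)
  show ?thesis
  proof
    assume "critical_point (\<lambda>w. scalar_product p w - Q w) u"
    then have "scalar_product (p - differential Q u) = (\<lambda>w. 0)"
      unfolding critical_point_def by (rule has_derivative_unique[OF der])
    then have "scalar_product (p - differential Q u) (axis i 1) = 0" for i by simp
    then show "differential Q u = p" by (simp add: scalar_product_axis vec_eq_iff)
  next
    assume "differential Q u = p"
    then have "scalar_product (p - differential Q u) = (\<lambda>w. 0)" by (simp add: scalar_product_def fun_eq_iff)
    with der show "critical_point (\<lambda>w. scalar_product p w - Q w) u"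
      unfolding critical_point_def by simp
  qed
qed

text \<open>Over \<real> the complement of a zero set may be disconnected, so a vanishing derivative
  yields constancy only on a ball. The polynomial identity \<open>a x = c * b x\<close> then carries
  the constant from the ball to all other components.\<close>

lemma rational_fun_generically_const:
  fixes K :: "'f::real_or_complex ^ 'n \<Rightarrow> 'f"
  assumes K: "rational_fun K" and der: "generically (\<lambda>x. (K has_derivative (\<lambda>v. 0)) (at x))"
  shows "\<exists>c. generically (\<lambda>x. K x = c)"
proof -
  obtain a b where ab: "polynomial_fun a" "nonzero_polynomial b" "\<And>x. b x \<noteq> 0 \<Longrightarrow> K x = a x / b x"
    using K unfolding rational_fun_iff by blast
  obtain d where d: "nonzero_polynomial d" "\<And>x. d x \<noteq> 0 \<Longrightarrow> (K has_derivative (\<lambda>v. 0)) (at x)"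
    using der unfolding generically_def by blast
  define S where "S = {x. b x * d x \<noteq> 0}"
  have bd: "nonzero_polynomial (\<lambda>x. b x * d x)" by (rule nonzero_polynomial_mult) fact+
  then have "open S" unfolding S_def by (intro open_nonzero_polynomial nonzero_polynomialD)
  moreover obtain x0 where "x0 \<in> S" using bd by (auto simp: nonzero_polynomial_def S_def fun_eq_iff)
  ultimately obtain r where r: "r > 0" "ball x0 r \<subseteq> S" by (meson open_contains_ball)
  have "\<exists>c. \<forall>x\<in>ball x0 r. K x = c"
  proof (rule has_derivative_zero_constant)
    fix x assume "x \<in> ball x0 r"
    then have "d x \<noteq> 0" using r(2) by (auto simp: S_def)
    then show "(K has_derivative (\<lambda>v. 0)) (at x within ball x0 r)"
      by (rule has_derivative_at_withinI[OF d(2)])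
  qed simp
  then obtain c where c: "\<And>x. x \<in> ball x0 r \<Longrightarrow> K x = c" by blast
  have "a x - c * b x = 0" for x
  proof (rule polynomial_fun_eq_zero[of "\<lambda>x. a x - c * b x" "ball x0 r" x0])
    show "polynomial_fun (\<lambda>x. a x - c * b x)"
      by (intro polynomial_fun_intros ab nonzero_polynomialD)
    show "a x - c * b x = 0" if "x \<in> ball x0 r" for x
    proof -
      have "b x \<noteq> 0" using that r(2) by (auto simp: S_def)
      then show ?thesis using c[OF that] ab(3)[of x] by (simp add: field_simps)
    qed
  qed (use r in auto)
  then have "generically (\<lambda>x. K x = c)"
    by (intro generically_mono[OF generically_nonzero[OF ab(2)]]) (simp add: ab(3) field_simps)
  then show ?thesis by blast
qed

lemma is_legendre_transformI:
  fixes Q :: "'f::real_or_complex ^ 'n \<Rightarrow> 'f"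
  assumes Q: "rational_fun Q" and Qs: "rational_fun Qs"
    and det: "\<not> generically (\<lambda>x. det (hessian Q x) = 0)"
    and inv: "generically (\<lambda>x. differential Qs (differential Q x) = x)"
  shows "\<exists>c. is_legendre_transform Q (\<lambda>p. Qs p + c)"
proof -
  note rat = rational_map_differential[OF Q] and dom = dominant_map_differential[OF Q det]
  have "generically (\<lambda>x. det (hessian Q x) \<noteq> 0)"
    using rational_fun_dichotomy[OF rational_fun_det_hessian[OF Q]] det by blast
  then have gen: "generically (\<lambda>x. det (hessian Q x) \<noteq> 0 \<and> differential Qs (differential Q x) = x \<and>
      (Q has_derivative scalar_product (differential Q x)) (at x) \<and>
      (differential Q has_derivative (\<lambda>v. transpose (hessian Q x) *v v)) (at x) \<and>
      (Qs has_derivative scalar_product (differential Qs (differential Q x))) (at (differential Q x)))"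
    by (intro generically_conj inv generically_has_derivative_differential Q generically_has_derivative
         generically_compose[OF generically_has_derivative[OF Qs] rat dom])
  define K where "K = (\<lambda>x. scalar_product (differential Q x) x - Q x - Qs (differential Q x))"
  have "rational_fun (\<lambda>x. scalar_product (differential Q x) x)"
    unfolding scalar_product_def
    using rat by (intro rational_fun_sum rational_fun_mult rational_fun_polynomial[OF polynomial_fun.coord])
      (simp add: rational_map_def)
  then have "rational_fun K"
    unfolding K_def by (intro rational_fun_diff[OF rational_fun_diff] Q rational_fun_compose_rational[OF Qs rat dom])
  moreover have "generically (\<lambda>x. (K has_derivative (\<lambda>v. 0)) (at x))"
  proof (rule generically_mono[OF gen], elim conjE)
    fix x assume *: "differential Qs (differential Q x) = x"
      "(Q has_derivative scalar_product (differential Q x)) (at x)"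
      "(differential Q has_derivative (\<lambda>v. transpose (hessian Q x) *v v)) (at x)"
      "(Qs has_derivative scalar_product (differential Qs (differential Q x))) (at (differential Q x))"
    have comp: "((\<lambda>x. differential Q x $ i) has_derivative (\<lambda>v. (transpose (hessian Q x) *v v) $ i)) (at x)" for i
      by (rule bounded_linear.has_derivative[OF bounded_linear_vec_nth *(3)])
    have "((\<lambda>x. scalar_product (differential Q x) x) has_derivative
      (\<lambda>v. scalar_product (differential Q x) v + scalar_product (transpose (hessian Q x) *v v) x)) (at x)"
      unfolding scalar_product_def
      by (rule has_derivative_eq_rhs[OF has_derivative_sum[OF has_derivative_mult[OF comp
           bounded_linear.has_derivative[OF bounded_linear_vec_nth has_derivative_ident]]]])
         (simp add: fun_eq_iff sum.distrib)
    moreover have "((\<lambda>x. Qs (differential Q x)) has_derivative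
      (\<lambda>v. scalar_product x (transpose (hessian Q x) *v v))) (at x)"
      using has_derivative_compose[OF *(3) *(4)] by (simp add: *(1))
    \<comment> \<open>The product rule gives two terms for the pairing of Q'(x) with
      \<open>x\<close>. The first is cancelled by the differential of \<open>Q\<close>, the second
      by that of \<open>Qs (differential Q x)\<close>, since the gradient of \<open>Qs\<close> at
      Q'(x) is \<open>x\<close>.\<close>
    ultimately have "(K has_derivative (\<lambda>v. scalar_product (differential Q x) v
        + scalar_product (transpose (hessian Q x) *v v) x - scalar_product (differential Q x) v
        - scalar_product x (transpose (hessian Q x) *v v))) (at x)"
      unfolding K_def by (intro has_derivative_diff *(2))
    then show "(K has_derivative (\<lambda>v. 0)) (at x)"
      by (simp add: scalar_product_commute[of x])
  qed
  ultimately obtain c where c: "generically (\<lambda>x. K x = c)"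
    using rational_fun_generically_const by blast
  from generically_conj[OF c gen] obtain d where d: "nonzero_polynomial d" and *:
    "\<And>x. d x \<noteq> 0 \<Longrightarrow> K x = c"
    "\<And>x. d x \<noteq> 0 \<Longrightarrow> det (hessian Q x) \<noteq> 0"
    "\<And>x. d x \<noteq> 0 \<Longrightarrow> differential Qs (differential Q x) = x"
    "\<And>x. d x \<noteq> 0 \<Longrightarrow> (Q has_derivative scalar_product (differential Q x)) (at x)"
    "\<And>x. d x \<noteq> 0 \<Longrightarrow> (differential Q has_derivative (\<lambda>v. transpose (hessian Q x) *v v)) (at x)"
    unfolding generically_def by blast
  \<comment> \<open>One set serves as the neighbourhood of every \<open>v0\<close>: on all of
    \<open>N\<close> the map Q' has the left inverse \<open>differential Qs\<close>, so it is
    globally injective there, and critical points in \<open>N\<close> are unique without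
    shrinking.\<close>
  define N where "N = {x. d x \<noteq> 0}"
  have N: "open N" unfolding N_def by (rule open_nonzero_polynomial[OF nonzero_polynomialD[OF d]])
  have inj: "inj_on (differential Q) N"
    by (rule inj_on_inverseI[of _ "differential Qs"]) (simp add: N_def *)
  have "continuous_on N (differential Q)"
    using *(5) by (intro continuous_at_imp_continuous_on) (auto intro: has_derivative_continuous simp: N_def)
  then have M: "open (differential Q ` N)"
    by (rule invariance_of_domain[OF _ N inj])
  have "legendre_transform_near Q (\<lambda>p. Qs p + c) v0" if "v0 \<in> N" for v0
    unfolding legendre_transform_near_def
  proof (rule conjI, use that *(2) in \<open>simp add: N_def\<close>,
      rule exI[of _ N], rule exI[of _ "differential Q ` N"], intro conjI N M that imageI ballI)
    fix p assume "p \<in> differential Q ` N"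
    then obtain v where v: "v \<in> N" "p = differential Q v" by blast
    have "critical_point (\<lambda>w. scalar_product p w - Q w) u \<longleftrightarrow> u = v" if "u \<in> N" for u
      using critical_point_iff[of Q u p] *(4)[of u] inj that v by (auto simp: N_def dest: inj_onD)
    moreover have "Qs p + c = scalar_product p v - Q v"
      using *(1)[of v] v by (simp add: N_def K_def algebra_simps)
    ultimately show "\<exists>v\<in>N. critical_point (\<lambda>w. scalar_product p w - Q w) v \<and>
      (\<forall>u\<in>N. critical_point (\<lambda>w. scalar_product p w - Q w) u \<longrightarrow> u = v) \<and>
      Qs p + c = scalar_product p v - Q v"
      using v(1) by blast
  qed
  then show ?thesis
    unfolding is_legendre_transform_def generically_def using d by (auto simp: N_def)
qed

subsection \<open>Smooth functions\<close>

lemma dir_deriv_eqI: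
  assumes "(f has_derivative f') (at x)"
  shows "dir_deriv v f x = f' v"
proof -
  have "((\<lambda>t. x + t *\<^sub>R v) has_derivative (\<lambda>t. t *\<^sub>R v)) (at 0)"
    by (auto intro!: derivative_eq_intros)
  then have "((\<lambda>t. f (x + t *\<^sub>R v)) has_derivative (\<lambda>t. f' (t *\<^sub>R v))) (at 0)"
    using has_derivative_compose[of "\<lambda>t. x + t *\<^sub>R v" "\<lambda>t. t *\<^sub>R v" 0 UNIV f f'] assms by simp
  then have "((\<lambda>t. f (x + t *\<^sub>R v)) has_vector_derivative f' v) (at 0)"
    using linear_scale[OF has_derivative_linear[OF assms]] by (simp add: has_vector_derivative_def)
  then show ?thesis
    unfolding dir_deriv_def by (rule vector_derivative_at)
qed

lemma has_derivative_dir_deriv: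
  assumes "f differentiable (at x)"
  shows "(f has_derivative (\<lambda>v. dir_deriv v f x)) (at x)"
proof -
  obtain f' where "(f has_derivative f') (at x)"
    using assms unfolding differentiable_def by blast
  moreover from this have "(\<lambda>v. dir_deriv v f x) = f'"
    by (simp add: dir_deriv_eqI fun_eq_iff)
  ultimately show ?thesis by simp
qed

text \<open>Recursion on the order, through derivatives in all directions, suits the product and
  chain rules, whose proofs are inductions on the order. The set \<open>S\<close> admits functions
  that are smooth only off a singular set.\<close>

primrec k_smooth_on :: "nat \<Rightarrow> 'v::euclidean_space set \<Rightarrow> ('v \<Rightarrow> complex) \<Rightarrow> bool" where
  "k_smooth_on 0 S f \<longleftrightarrow> (\<forall>x\<in>S. f differentiable (at x))"
| "k_smooth_on (Suc k) S f \<longleftrightarrow> (\<forall>x\<in>S. f differentiable (at x)) \<and> (\<forall>v. k_smooth_on k S (dir_deriv v f))"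

definition smooth_on :: "'v::euclidean_space set \<Rightarrow> ('v \<Rightarrow> complex) \<Rightarrow> bool" where
  "smooth_on S f \<longleftrightarrow> (\<forall>k. k_smooth_on k S f)"

lemma k_smooth_on_SucD: "k_smooth_on (Suc k) S f \<Longrightarrow> k_smooth_on k S f"
  by (induction k arbitrary: f) auto

lemma k_smooth_on_cong:
  assumes "open S" "k_smooth_on k S f" "\<And>x. x \<in> S \<Longrightarrow> g x = f x"
  shows "k_smooth_on k S g"
  using assms(2,3)
proof (induction k arbitrary: f g)
  case 0
  then show ?case
    unfolding differentiable_def k_smooth_on.simps
    by (metis has_derivative_transform_within_open assms(1))
next
  case (Suc k)
  have g: "(g has_derivative (\<lambda>v. dir_deriv v f x)) (at x)" if "x \<in> S" for x
    by (rule has_derivative_transform_within_open[OF has_derivative_dir_deriv assms(1) that])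
       (use Suc that in auto)
  show ?case
    using g Suc.IH[of "dir_deriv v f" "dir_deriv v g" for v] Suc.prems(1)
    by (auto simp: differentiable_def dir_deriv_eqI[OF g])
qed

lemma k_smooth_on_Un: "k_smooth_on k S f \<Longrightarrow> k_smooth_on k T f \<Longrightarrow> k_smooth_on k (S \<union> T) f"
  by (induction k arbitrary: f) auto

lemma k_smooth_on_subset: "k_smooth_on k S f \<Longrightarrow> T \<subseteq> S \<Longrightarrow> k_smooth_on k T f"
  by (induction k arbitrary: f) auto

lemma k_smooth_on_SucI:
  assumes "open S" "\<And>x. x \<in> S \<Longrightarrow> (f has_derivative f' x) (at x)" "\<And>v. k_smooth_on k S (\<lambda>x. f' x v)"
  shows "k_smooth_on (Suc k) S f"
  using assms k_smooth_on_cong[OF assms(1) assms(3), of "dir_deriv v f" v for v]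
  by (auto simp: differentiable_def dir_deriv_eqI[OF assms(2)])

lemma k_smooth_on_const: "k_smooth_on k S (\<lambda>x. c)"
proof -
  have [simp]: "dir_deriv v (\<lambda>x. c) = (\<lambda>x. 0)" for v and c :: complex
    by (rule ext) (rule dir_deriv_eqI[of _ "\<lambda>v. 0"], simp)
  show ?thesis by (induction k arbitrary: c) auto
qed

lemma k_smooth_on_linear:
  assumes "bounded_linear f" shows "k_smooth_on k S f"
proof -
  have [simp]: "dir_deriv v f = (\<lambda>x. f v)" for v
    by (rule ext) (rule dir_deriv_eqI[OF bounded_linear_imp_has_derivative[OF assms]])
  show ?thesis
    using bounded_linear_imp_differentiable[OF assms] by (cases k) (auto simp: k_smooth_on_const)
qed

lemma k_smooth_on_compose_linear:
  assumes L: "bounded_linear L" and S: "open S"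
  shows "k_smooth_on k S f \<Longrightarrow> k_smooth_on k S (\<lambda>x. L (f x))"
proof (induction k arbitrary: f)
  case 0
  then show ?case using bounded_linear.has_derivative[OF L] by (auto simp: differentiable_def) blast
next
  case (Suc k)
  show ?case
    by (rule k_smooth_on_SucI[OF S bounded_linear.has_derivative[OF L has_derivative_dir_deriv]])
       (use Suc in auto)
qed

lemma k_smooth_on_add:
  assumes S: "open S"
  shows "k_smooth_on k S f \<Longrightarrow> k_smooth_on k S g \<Longrightarrow> k_smooth_on k S (\<lambda>x. f x + g x)"
proof (induction k arbitrary: f g)
  case (Suc k)
  show ?case
    by (rule k_smooth_on_SucI[OF S has_derivative_add[OF has_derivative_dir_deriv has_derivative_dir_deriv]])
       (use Suc in auto)
qed auto

lemma k_smooth_on_mult: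
  assumes S: "open S"
  shows "k_smooth_on k S f \<Longrightarrow> k_smooth_on k S g \<Longrightarrow> k_smooth_on k S (\<lambda>x. f x * g x)"
proof (induction k arbitrary: f g)
  case (Suc k)
  show ?case
  proof (rule k_smooth_on_SucI[OF S has_derivative_mult[OF has_derivative_dir_deriv has_derivative_dir_deriv]])
    show "k_smooth_on k S (\<lambda>x. f x * dir_deriv v g x + dir_deriv v f x * g x)" for v
      using Suc.prems by (intro k_smooth_on_add[OF S] Suc.IH) (auto dest: k_smooth_on_SucD simp del: k_smooth_on.simps(2), simp_all)
  qed (use Suc in auto)
qed auto

lemma k_smooth_on_exp:
  assumes S: "open S"
  shows "k_smooth_on k S f \<Longrightarrow> k_smooth_on k S (\<lambda>x. exp (f x))"
proof (induction k arbitrary: f)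
  case 0
  have "((\<lambda>x. exp (f x)) has_derivative (\<lambda>v. exp (f x) * dir_deriv v f x)) (at x)" if "x \<in> S" for x
    using has_derivative_compose[OF has_derivative_dir_deriv[of f x] DERIV_exp[unfolded has_field_derivative_def]] 0 that
    by auto
  then show ?case by (auto simp: differentiable_def)
next
  case (Suc k)
  have "((\<lambda>x. exp (f x)) has_derivative (\<lambda>v. exp (f x) * dir_deriv v f x)) (at x)" if "x \<in> S" for x
    using has_derivative_compose[OF has_derivative_dir_deriv[of f x] DERIV_exp[unfolded has_field_derivative_def]] Suc.prems that
    by auto
  then show ?case
  proof (rule k_smooth_on_SucI[OF S])
    show "k_smooth_on k S (\<lambda>x. exp (f x) * dir_deriv v f x)" for v
      using Suc.IH[OF k_smooth_on_SucD[OF Suc.prems]] Suc.prems by (intro k_smooth_on_mult[OF S]) auto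
  qed
qed

lemma k_smooth_on_inverse:
  assumes S: "open S"
  shows "k_smooth_on k S f \<Longrightarrow> (\<And>x. x \<in> S \<Longrightarrow> f x \<noteq> 0) \<Longrightarrow> k_smooth_on k S (\<lambda>x. inverse (f x))"
proof (induction k)
  case 0
  then show ?case by (auto intro!: derivative_intros)
next
  case (Suc k)
  show ?case
  proof (rule k_smooth_on_SucI[OF S Deriv.has_derivative_inverse[OF _ has_derivative_dir_deriv]])
    have *: "k_smooth_on k S (\<lambda>x. inverse (f x))"
      using Suc.IH[OF k_smooth_on_SucD[OF Suc.prems(1)]] Suc.prems(2) by blast
    have "k_smooth_on k S (\<lambda>x. - 1 * (inverse (f x) * dir_deriv v f x * inverse (f x)))" for v
      using Suc.prems(1) by (intro k_smooth_on_mult[OF S] k_smooth_on_const *) auto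
    then show "k_smooth_on k S (\<lambda>x. - (inverse (f x) * dir_deriv v f x * inverse (f x)))" for v
      by simp
  qed (use Suc in auto)
qed

lemma smooth_on_const: "smooth_on S (\<lambda>x. c)"
  by (simp add: smooth_on_def k_smooth_on_const)

lemma smooth_on_linear: "bounded_linear f \<Longrightarrow> smooth_on S f"
  by (simp add: smooth_on_def k_smooth_on_linear)

lemma smooth_on_compose_linear:
  "open S \<Longrightarrow> smooth_on S f \<Longrightarrow> bounded_linear L \<Longrightarrow> smooth_on S (\<lambda>x. L (f x))"
  by (simp add: smooth_on_def k_smooth_on_compose_linear)

lemma smooth_on_add: "open S \<Longrightarrow> smooth_on S f \<Longrightarrow> smooth_on S g \<Longrightarrow> smooth_on S (\<lambda>x. f x + g x)"
  by (simp add: smooth_on_def k_smooth_on_add)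

lemma smooth_on_mult: "open S \<Longrightarrow> smooth_on S f \<Longrightarrow> smooth_on S g \<Longrightarrow> smooth_on S (\<lambda>x. f x * g x)"
  by (simp add: smooth_on_def k_smooth_on_mult)

lemma smooth_on_exp: "open S \<Longrightarrow> smooth_on S f \<Longrightarrow> smooth_on S (\<lambda>x. exp (f x))"
  by (simp add: smooth_on_def k_smooth_on_exp)

lemma smooth_on_inverse:
  "open S \<Longrightarrow> smooth_on S f \<Longrightarrow> (\<And>x. x \<in> S \<Longrightarrow> f x \<noteq> 0) \<Longrightarrow> smooth_on S (\<lambda>x. inverse (f x))"
  by (simp add: smooth_on_def k_smooth_on_inverse)

lemma smooth_on_cong:
  "open S \<Longrightarrow> smooth_on S f \<Longrightarrow> (\<And>x. x \<in> S \<Longrightarrow> g x = f x) \<Longrightarrow> smooth_on S g"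
  unfolding smooth_on_def using k_smooth_on_cong by blast

lemma smooth_on_subset: "smooth_on S f \<Longrightarrow> T \<subseteq> S \<Longrightarrow> smooth_on T f"
  unfolding smooth_on_def using k_smooth_on_subset by blast

lemma smooth_on_Un: "smooth_on S f \<Longrightarrow> smooth_on T f \<Longrightarrow> smooth_on (S \<union> T) f"
  unfolding smooth_on_def using k_smooth_on_Un by blast

lemma smooth_on_dir_deriv: "smooth_on S f \<Longrightarrow> smooth_on S (dir_deriv v f)"
  unfolding smooth_on_def using k_smooth_on.simps(2) by blast

lemma smooth_on_differentiable: "smooth_on S f \<Longrightarrow> x \<in> S \<Longrightarrow> f differentiable (at x)"
  unfolding smooth_on_def using k_smooth_on.simps(1) by blast

lemma smooth_on_has_derivative:
  "smooth_on S f \<Longrightarrow> x \<in> S \<Longrightarrow> (f has_derivative (\<lambda>v. dir_deriv v f x)) (at x)"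
  by (intro has_derivative_dir_deriv smooth_on_differentiable)

lemma smooth_on_continuous: "smooth_on S f \<Longrightarrow> continuous_on S f"
  by (intro continuous_at_imp_continuous_on ballI differentiable_imp_continuous_within smooth_on_differentiable)

lemma smooth_on_iter_deriv: "smooth_on S f \<Longrightarrow> smooth_on S (iter_deriv vs f)"
  by (induction vs) (auto simp: iter_deriv_def smooth_on_dir_deriv)

lemma smooth_on_UNIV_smooth_fun: "smooth_on UNIV f \<Longrightarrow> smooth_fun f"
  unfolding smooth_fun_def using smooth_on_iter_deriv smooth_on_differentiable by blast

subsection \<open>Test functions\<close>

text \<open>The standard flat function is the case \<open>m = 0\<close>. The extra power of
  \<open>r\<close> makes the family closed under differentiation up to linear combinations.\<close>

definition flat_fun :: "nat \<Rightarrow> real \<Rightarrow> real" where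
  "flat_fun m r = (if r > 0 then exp (- 1 / r) / r ^ m else 0)"

text \<open>This is the limit of the difference quotient at 0. From the right, pass to
  \<open>inverse r\<close>, which tends to infinity, where the exponential dominates every
  power.\<close>

lemma flat_fun_over_tendsto: "((\<lambda>r. flat_fun m r / r) \<longlongrightarrow> 0) (at 0)"
proof (rule filterlim_split_at)
  show "((\<lambda>r. flat_fun m r / r) \<longlongrightarrow> 0) (at_left 0)"
    by (rule tendsto_eventually) (auto simp: flat_fun_def eventually_at_filter)
  have "((\<lambda>r. inverse r ^ Suc m / exp (inverse r)) \<longlongrightarrow> (0::real)) (at_right 0)"
    by (rule filterlim_compose[OF tendsto_power_div_exp_0 filterlim_inverse_at_top_right])
  then show "((\<lambda>r. flat_fun m r / r) \<longlongrightarrow> 0) (at_right 0)"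
    by (rule Lim_transform_eventually)
       (auto simp: flat_fun_def eventually_at_filter field_simps exp_minus power_inverse)
qed

lemma flat_fun_has_derivative:
  "(flat_fun m has_real_derivative (flat_fun (m + 2) r - real m * flat_fun (m + 1) r)) (at r)"
proof -
  consider "r > 0" | "r < 0" | "r = 0" by linarith
  then show ?thesis
  proof cases
    case 1
    have "((\<lambda>r. exp (- 1 / r) / r ^ m) has_real_derivative (flat_fun (m + 2) r - real m * flat_fun (m + 1) r)) (at r)"
      using 1 by (cases m) (auto intro!: derivative_eq_intros simp: flat_fun_def field_simps power2_eq_square,
        metis One_nat_def Suc_pred gr0I power_Suc)
    then show ?thesis
      by (rule has_field_derivative_transform_within_open[of _ _ _ "{0<..}"])
         (use 1 in \<open>auto simp: flat_fun_def\<close>)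
  next
    case 2
    have "((\<lambda>r. 0) has_real_derivative (flat_fun (m + 2) r - real m * flat_fun (m + 1) r)) (at r)"
      using 2 by (auto simp: flat_fun_def)
    then show ?thesis
      by (rule has_field_derivative_transform_within_open[of _ _ _ "{..<0}"])
         (use 2 in \<open>auto simp: flat_fun_def\<close>)
  next
    case 3
    then show ?thesis
      using flat_fun_over_tendsto[of m] by (simp add: DERIV_def flat_fun_def[of _ 0])
  qed
qed

lemma k_smooth_on_flat_fun:
  assumes S: "open S" and u: "\<And>k. k_smooth_on k S (\<lambda>x. complex_of_real (u x))"
  shows "k_smooth_on k S (\<lambda>x. complex_of_real (flat_fun m (u x)))"
proof (induction k arbitrary: m)
  have der: "((\<lambda>x. complex_of_real (flat_fun m (u x))) has_derivative
    (\<lambda>v. (of_real (flat_fun (m + 2) (u x)) + of_real (- real m) * of_real (flat_fun (m + 1) (u x)))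
      * dir_deriv v (\<lambda>x. complex_of_real (u x)) x)) (at x)" if "x \<in> S" for x m
  proof -
    have *: "((\<lambda>x. complex_of_real (u x)) has_derivative (\<lambda>v. dir_deriv v (\<lambda>x. complex_of_real (u x)) x)) (at x)"
      using u[of 0] that by (intro has_derivative_dir_deriv) auto
    have "(u has_derivative (\<lambda>v. Re (dir_deriv v (\<lambda>x. complex_of_real (u x)) x))) (at x)"
      using bounded_linear.has_derivative[OF bounded_linear_Re *] by simp
    \<comment> \<open>The directional derivatives of a real-valued function, embedded into
      \<complex>, are real; so the chain rule can be run over \<real> and its result embedded
      afterwards.\<close>
    moreover from bounded_linear.has_derivative[OF bounded_linear_of_real this]
    have "dir_deriv v (\<lambda>x. complex_of_real (u x)) x = of_real (Re (dir_deriv v (\<lambda>x. complex_of_real (u x)) x))" for v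
      by (rule dir_deriv_eqI)
    ultimately have "(u has_derivative (\<lambda>v. Re (dir_deriv v (\<lambda>x. complex_of_real (u x)) x))) (at x)"
      and re: "\<And>v. dir_deriv v (\<lambda>x. complex_of_real (u x)) x = of_real (Re (dir_deriv v (\<lambda>x. complex_of_real (u x)) x))"
      by auto
    from has_derivative_compose[OF this(1) flat_fun_has_derivative[unfolded has_field_derivative_def]]
    have "((\<lambda>x. flat_fun m (u x)) has_derivative (\<lambda>v. (flat_fun (m + 2) (u x) - real m * flat_fun (m + 1) (u x))
      * Re (dir_deriv v (\<lambda>x. complex_of_real (u x)) x))) (at x)" .
    from bounded_linear.has_derivative[OF bounded_linear_of_real this] show ?thesis
      by (rule has_derivative_eq_rhs) (use re in \<open>simp add: fun_eq_iff\<close>)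
  qed
  { case 0
    show ?case using der by (auto simp: differentiable_def)
  next
    case (Suc k)
    show ?case
      by (rule k_smooth_on_SucI[OF S der])
         (use u[of "Suc k"] in \<open>auto intro!: k_smooth_on_mult[OF S] k_smooth_on_add[OF S] Suc.IH k_smooth_on_const simp flip: of_real_minus\<close>)
  }
qed

definition test_fun_on :: "'v::euclidean_space set \<Rightarrow> ('v \<Rightarrow> complex) \<Rightarrow> bool" where
  "test_fun_on S f \<longleftrightarrow> smooth_on UNIV f \<and> (\<exists>K. compact K \<and> K \<subseteq> S \<and> (\<forall>x. x \<notin> K \<longrightarrow> f x = 0))"

text \<open>The flat function is composed with \<open>r\<^sup>2 - (norm (x - a))\<^sup>2\<close>, a
  polynomial in the coordinates and therefore smooth also at the centre, and positive exactly on the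
  open ball.\<close>

lemma ex_bump:
  fixes a :: "'v::euclidean_space"
  assumes "r > 0"
  obtains \<eta> :: "'v \<Rightarrow> real" where "test_fun_on UNIV (\<lambda>x. complex_of_real (\<eta> x))" "\<And>x. \<eta> x \<ge> 0"
    "\<And>x. x \<in> ball a r \<Longrightarrow> \<eta> x > 0" "\<And>x. x \<notin> ball a r \<Longrightarrow> \<eta> x = 0"
proof
  let ?u = "\<lambda>x. r\<^sup>2 - (norm (x - a))\<^sup>2"
  let ?\<eta> = "\<lambda>x. flat_fun 0 (?u x)"
  have lin: "smooth_on UNIV (\<lambda>x. complex_of_real ((x - a) \<bullet> b))" for b
  proof -
    have "smooth_on UNIV (\<lambda>x. complex_of_real (x \<bullet> b) + complex_of_real (- (a \<bullet> b)))"
      by (intro smooth_on_add smooth_on_const smooth_on_linear bounded_linear_compose[OF bounded_linear_of_real]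
          bounded_linear_inner_left open_UNIV)
    then show ?thesis by (simp add: inner_diff_left)
  qed
  have "(\<lambda>x. complex_of_real (?u x)) = (\<lambda>x. complex_of_real (r\<^sup>2) +
      (\<Sum>b\<in>Basis. complex_of_real (- 1) * (complex_of_real ((x - a) \<bullet> b) * complex_of_real ((x - a) \<bullet> b))))"
    by (simp add: fun_eq_iff euclidean_inner[of "x - a" "x - a" for x] power2_norm_eq_inner sum_negf)
  moreover have "smooth_on UNIV (\<lambda>x. \<Sum>b\<in>B. complex_of_real (- 1) * (complex_of_real ((x - a) \<bullet> b) * complex_of_real ((x - a) \<bullet> b)))"
    for B by (induction B rule: infinite_finite_induct) (auto intro!: smooth_on_add smooth_on_mult smooth_on_const lin simp del: of_real_minus)
  ultimately have u: "smooth_on UNIV (\<lambda>x. complex_of_real (?u x))"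
    by (auto intro!: smooth_on_add smooth_on_const)
  have *: "norm (x - a) < r \<longleftrightarrow> ?u x > 0" for x
    using assms abs_less_iff power2_less_imp_less[of "norm (x - a)" r] power_strict_mono[of "norm (x - a)" r 2] by force
  show "?\<eta> x \<ge> 0" "x \<in> ball a r \<Longrightarrow> ?\<eta> x > 0" for x
    using *[of x] by (auto simp: flat_fun_def dist_norm norm_minus_commute)
  show zero: "x \<notin> ball a r \<Longrightarrow> ?\<eta> x = 0" for x
    using *[of x] by (auto simp: flat_fun_def dist_norm norm_minus_commute)
  show "test_fun_on UNIV (\<lambda>x. complex_of_real (?\<eta> x))"
    unfolding test_fun_on_def
  proof (intro conjI exI[of _ "cball a r"])
    show "smooth_on UNIV (\<lambda>x. complex_of_real (?\<eta> x))"
      using u unfolding smooth_on_def by (auto intro: k_smooth_on_flat_fun)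
  qed (use zero in auto)
qed

lemma test_fun_on_smooth: "test_fun_on S f \<Longrightarrow> smooth_on T f"
  unfolding test_fun_on_def using smooth_on_subset by blast

lemma test_fun_on_mono: "test_fun_on S f \<Longrightarrow> S \<subseteq> T \<Longrightarrow> test_fun_on T f"
  unfolding test_fun_on_def by blast

lemma test_fun_on_zero: "test_fun_on S (\<lambda>x. 0)"
  unfolding test_fun_on_def by (auto intro!: smooth_on_const exI[of _ "{}"])

lemma test_fun_on_add:
  assumes "test_fun_on S f" "test_fun_on S g" shows "test_fun_on S (\<lambda>x. f x + g x)"
proof -
  obtain K L where "compact K" "K \<subseteq> S" "\<And>x. x \<notin> K \<Longrightarrow> f x = 0" "compact L" "L \<subseteq> S" "\<And>x. x \<notin> L \<Longrightarrow> g x = 0"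
    using assms unfolding test_fun_on_def by blast
  then show ?thesis
    using assms unfolding test_fun_on_def
    by (intro conjI exI[of _ "K \<union> L"] smooth_on_add) auto
qed

text \<open>The factor \<open>u\<close> may be singular outside \<open>S\<close>: there the product
  is zero. The open sets \<open>S\<close> and the complement of the compact support cover the space,
  and smoothness is local.\<close>

lemma test_fun_on_mult:
  assumes "open S" "smooth_on S u" "test_fun_on S f" shows "test_fun_on S (\<lambda>x. u x * f x)"
proof -
  obtain K where K: "compact K" "K \<subseteq> S" "\<And>x. x \<notin> K \<Longrightarrow> f x = 0"
    using assms unfolding test_fun_on_def by blast
  have "smooth_on (S \<union> - K) (\<lambda>x. u x * f x)"
  proof (rule smooth_on_Un)
    show "smooth_on S (\<lambda>x. u x * f x)"
      by (intro smooth_on_mult assms test_fun_on_smooth[OF assms(3)])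
    show "smooth_on (- K) (\<lambda>x. u x * f x)"
      by (rule smooth_on_cong[OF _ smooth_on_const[of _ 0]]) (use K in \<open>auto intro: compact_imp_closed\<close>)
  qed
  moreover have "S \<union> - K = UNIV" using K by auto
  ultimately show ?thesis
    unfolding test_fun_on_def using K by (intro conjI exI[of _ K]) auto
qed

lemma test_fun_on_cmult: "test_fun_on S f \<Longrightarrow> test_fun_on S (\<lambda>x. c * f x)"
  unfolding test_fun_on_def by (auto intro!: smooth_on_mult smooth_on_const)

lemma test_fun_on_sum:
  assumes "\<And>i. i \<in> I \<Longrightarrow> test_fun_on S (f i)" shows "test_fun_on S (\<lambda>x. \<Sum>i\<in>I. f i x)"
  using assms by (induction I rule: infinite_finite_induct) (auto intro: test_fun_on_add test_fun_on_zero)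

lemma test_fun_on_dir_deriv:
  assumes "test_fun_on S f" shows "test_fun_on S (dir_deriv v f)"
proof -
  obtain K where K: "compact K" "K \<subseteq> S" "\<And>x. x \<notin> K \<Longrightarrow> f x = 0"
    using assms unfolding test_fun_on_def by blast
  have "dir_deriv v f x = 0" if "x \<notin> K" for x
    by (rule dir_deriv_eqI[of _ "\<lambda>v. 0"],
        rule has_derivative_transform_within_open[of "\<lambda>x. 0" _ _ _ "- K"])
       (use K that in \<open>auto intro: compact_imp_closed\<close>)
  then show ?thesis
    using assms K unfolding test_fun_on_def by (auto intro!: smooth_on_dir_deriv exI[of _ K])
qed

lemma test_fun_on_iter_deriv: "test_fun_on S f \<Longrightarrow> test_fun_on S (iter_deriv vs f)"
  by (induction vs) (auto simp: iter_deriv_def test_fun_on_dir_deriv)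

lemma continuous_test_fun: "test_fun_on S f \<Longrightarrow> continuous_on T f"
  using test_fun_on_smooth smooth_on_continuous by blast

lemma continuous_mult_test_fun:
  assumes "open S" "continuous_on S g" "test_fun_on S f"
  shows "continuous_on UNIV (\<lambda>x. g x * f x)"
proof -
  obtain K where K: "compact K" "K \<subseteq> S" "\<And>x. x \<notin> K \<Longrightarrow> f x = 0"
    using assms unfolding test_fun_on_def by blast
  have "continuous_on (S \<union> - K) (\<lambda>x. g x * f x)"
  proof (rule continuous_on_open_Un)
    show "continuous_on S (\<lambda>x. g x * f x)"
      by (intro continuous_intros assms continuous_test_fun[OF assms(3)])
    show "continuous_on (- K) (\<lambda>x. g x * f x)"
      by (subst continuous_on_cong[OF refl, of _ _ "\<lambda>x. 0"]) (use K in auto)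
  qed (use assms K in \<open>auto intro: compact_imp_closed\<close>)
  moreover have "S \<union> - K = UNIV" using K by auto
  ultimately show ?thesis by simp
qed

lemma integrable_continuous_compact_support:
  fixes f :: "'v::euclidean_space \<Rightarrow> complex"
  assumes "continuous_on UNIV f" "compact K" "\<And>x. x \<notin> K \<Longrightarrow> f x = 0"
  shows "integrable lborel f" "integrable lebesgue f"
proof -
  have "integrable lborel (\<lambda>x. indicator K x *\<^sub>R f x)"
    by (rule borel_integrable_compact[OF assms(2)]) (rule continuous_on_subset[OF assms(1)], simp)
  moreover have "(\<lambda>x. indicator K x *\<^sub>R f x) = f"
    using assms(3) by (auto simp: fun_eq_iff indicator_def)
  ultimately show "integrable lborel f" by simp
  then show "integrable lebesgue f"
    by (subst integrable_completion) auto
qed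

lemma integrable_mult_test_fun:
  assumes "open S" "continuous_on S g" "test_fun_on S f"
  shows "integrable lborel (\<lambda>x. g x * f x)" "integrable lebesgue (\<lambda>x. g x * f x)"
proof -
  obtain K where K: "compact K" "\<And>x. x \<notin> K \<Longrightarrow> f x = 0"
    using assms unfolding test_fun_on_def by blast
  show "integrable lborel (\<lambda>x. g x * f x)" "integrable lebesgue (\<lambda>x. g x * f x)"
    using integrable_continuous_compact_support[OF continuous_mult_test_fun[OF assms] K(1)] K(2) by simp_all
qed

lemma test_fun_weighted_bound:
  assumes "test_fun_on S f" shows "\<exists>C. \<forall>x. (1 + norm x) ^ N * norm (f x) \<le> C"
proof -
  obtain K where K: "compact K" "\<And>x. x \<notin> K \<Longrightarrow> f x = 0"
    using assms unfolding test_fun_on_def by blast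
  have "compact ((\<lambda>x. (1 + norm x) ^ N * norm (f x)) ` K)"
    by (intro compact_continuous_image K continuous_intros continuous_test_fun[OF assms])
  then obtain C where C: "\<And>x. x \<in> K \<Longrightarrow> (1 + norm x) ^ N * norm (f x) \<le> C"
    by (meson bounded_imp_bdd_above bdd_above.E compact_imp_bounded imageI)
  show ?thesis
    by (rule exI[of _ "max C 0"]) (metis C K(2) max.cobounded1 max.cobounded2 mult_zero_right norm_zero order_trans)
qed

lemma test_fun_schwartz: "test_fun_on S f \<Longrightarrow> f \<in> schwartz"
  unfolding schwartz_def
  using test_fun_weighted_bound[OF test_fun_on_iter_deriv] smooth_on_UNIV_smooth_fun[OF test_fun_on_smooth] by blast

subsection \<open>Integration\<close>

text \<open>The function \<open>f\<close> is arbitrary on \<open>N\<close> and need not be Borel. A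
  preimage under \<open>f\<close> is a preimage under \<open>g\<close> off \<open>N\<close> together
  with a subset of a null set, which is measurable because Lebesgue measure is complete.\<close>

lemma integral_lebesgue_spike:
  fixes f g :: "'v::euclidean_space \<Rightarrow> complex"
  assumes g: "g \<in> borel_measurable lborel" and N: "negligible N" and eq: "\<And>x. x \<notin> N \<Longrightarrow> f x = g x"
  shows "(LINT x|lebesgue. f x) = (LINT x|lborel. g x)"
proof -
  have N0: "N \<in> null_sets lebesgue" using N by (simp add: negligible_iff_null_sets)
  have g': "g \<in> borel_measurable lebesgue" using g by (rule measurable_completion)
  have "f \<in> borel_measurable lebesgue"
  proof (rule measurableI)
    fix B :: "complex set" assume B: "B \<in> sets borel"
    have "f -` B \<inter> N \<in> sets lebesgue"
      using completion.complete2[of "f -` B \<inter> N" N] N0 by auto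
    moreover have "g -` B \<inter> space lebesgue \<in> sets lebesgue"
      by (rule measurable_sets[OF g' B])
    ultimately have "(g -` B \<inter> space lebesgue - N) \<union> (f -` B \<inter> N) \<in> sets lebesgue"
      using N0 by (intro sets.Un sets.Diff) auto
    moreover have "f -` B \<inter> space lebesgue = (g -` B \<inter> space lebesgue - N) \<union> (f -` B \<inter> N)"
      using eq by auto
    ultimately show "f -` B \<inter> space lebesgue \<in> sets lebesgue" by simp
  qed auto
  then have "(LINT x|lebesgue. f x) = (LINT x|lebesgue. g x)"
    by (intro integral_cong_AE g' AE_I'[OF N0]) (use eq in auto)
  also have "\<dots> = (LINT x|lborel. g x)"
    using g by (rule integral_completion)
  finally show ?thesis .
qed

section \<open>Vanishing integrals of directional derivatives\<close>

lemma integrable_inverse_one_plus_square: "integrable lborel (\<lambda>x::real. 1 / (1 + x\<^sup>2))"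
proof -
  have "set_integrable lborel (einterval (-\<infinity>) \<infinity>) (\<lambda>x::real. 1 / (1 + x\<^sup>2))"
  proof (rule interval_integral_FTC_nonneg(1))
    show "DERIV arctan x :> 1 / (1 + x\<^sup>2)" for x
      using DERIV_arctan[of x] by (simp add: inverse_eq_divide)
    show "isCont (\<lambda>x::real. 1 / (1 + x\<^sup>2)) x" for x
      using sum_power2_eq_zero_iff[of 1 x] by (intro continuous_intros) auto
    show "((arctan \<circ> real_of_ereal) \<longlongrightarrow> - (pi / 2)) (at_right (- \<infinity>))"
      unfolding ereal_tendsto_simps by (rule tendsto_arctan_at_bot)
    show "((arctan \<circ> real_of_ereal) \<longlongrightarrow> pi / 2) (at_left \<infinity>)"
      unfolding ereal_tendsto_simps by (rule tendsto_arctan_at_top)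
  qed auto
  then show ?thesis by (simp add: set_integrable_def einterval_def)
qed

text \<open>The exponent is twice the dimension so that \<open>decay\<close> is dominated by the
  product of \<open>1 / (1 + (x \<bullet> b)\<^sup>2)\<close> over the coordinates, which is
  integrable by Fubini.\<close>

definition decay :: "'v::euclidean_space \<Rightarrow> real" where
  "decay x = 1 / (1 + norm x) ^ (2 * DIM('v))"

lemma decay_pos: "decay x > 0"
  unfolding decay_def by (intro divide_pos_pos zero_less_power add_pos_nonneg) auto

lemma integrable_decay: "integrable lborel (decay :: 'v::euclidean_space \<Rightarrow> real)"
proof (rule Bochner_Integration.integrable_bound)
  have "(\<integral>\<^sup>+x. (\<Prod>b\<in>Basis. ennreal (1 / (1 + (x \<bullet> b)\<^sup>2))) \<partial>(lborel :: 'v measure)) =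
      (\<Prod>b\<in>(Basis::'v set). (\<integral>\<^sup>+x. ennreal (1 / (1 + x\<^sup>2)) \<partial>lborel))"
    by (rule nn_integral_lborel_prod) auto
  also have "\<dots> = (\<Prod>b\<in>(Basis::'v set). ennreal (LINT x|lborel. 1 / (1 + x\<^sup>2)))"
    by (subst nn_integral_eq_integral[OF integrable_inverse_one_plus_square]) auto
  also have "\<dots> < \<infinity>"
    by (subst prod_ennreal) auto
  finally show "integrable lborel (\<lambda>x::'v. \<Prod>b\<in>Basis. 1 / (1 + (x \<bullet> b)\<^sup>2))"
    by (auto simp: integrable_iff_bounded prod_norm prod_ennreal abs_prod prod_nonneg)
  show "decay \<in> borel_measurable (lborel :: 'v measure)"
    unfolding decay_def[abs_def] by measurable
  show "AE x in (lborel :: 'v measure). norm (decay x) \<le> norm (\<Prod>b\<in>Basis. 1 / (1 + (x \<bullet> b)\<^sup>2))"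
  proof (rule AE_I2)
    fix x :: 'v
    have "(\<Prod>b\<in>(Basis::'v set). 1 / (1 + norm x)\<^sup>2) \<le> (\<Prod>b\<in>Basis. 1 / (1 + (x \<bullet> b)\<^sup>2))"
    proof (rule prod_mono, intro conjI)
      fix b :: 'v assume "b \<in> Basis"
      then have "(x \<bullet> b)\<^sup>2 \<le> (norm x)\<^sup>2"
        using Basis_le_norm[of b x] by (metis abs_le_square_iff abs_norm_cancel)
      then have "1 + (x \<bullet> b)\<^sup>2 \<le> (1 + norm x)\<^sup>2"
        by (simp add: power2_sum) (use norm_ge_zero[of x] in linarith)
      then show "1 / (1 + norm x)\<^sup>2 \<le> 1 / (1 + (x \<bullet> b)\<^sup>2)"
        by (intro frac_le) (auto intro: add_pos_nonneg)
    qed auto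
    then show "norm (decay x) \<le> norm (\<Prod>b\<in>Basis. 1 / (1 + (x \<bullet> b)\<^sup>2))"
      using decay_pos[of x] by (simp add: decay_def power_mult power_one_over)
  qed
qed

text \<open>This bounds a derivative at all points of a short segment by its majorant at one end,
  and so supplies an integrable majorant for difference quotients.\<close>

lemma decay_shift:
  fixes x v :: "'v::euclidean_space"
  assumes "norm v \<le> r"
  shows "decay (x + v) \<le> (1 + r) ^ (2 * DIM('v)) * decay x"
proof -
  have "1 + norm x \<le> 1 + (norm (x + v) + norm v)"
    using norm_triangle_ineq4[of "x + v" v] by simp
  also have "\<dots> \<le> (1 + norm (x + v)) * (1 + r)"
    using assms mult_nonneg_nonneg[OF norm_ge_zero[of "x + v"] order_trans[OF norm_ge_zero assms]]
    by (simp add: algebra_simps)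
  finally have "(1 + norm x) ^ (2 * DIM('v)) \<le> (1 + norm (x + v)) ^ (2 * DIM('v)) * (1 + r) ^ (2 * DIM('v))"
    unfolding power_mult_distrib[symmetric] by (intro power_mono) auto
  then show ?thesis
    unfolding decay_def by (simp add: field_simps add_pos_nonneg)
qed

lemma integral_translation:
  fixes f :: "'v::euclidean_space \<Rightarrow> complex"
  assumes "f \<in> borel_measurable lborel"
  shows "(LINT x|lborel. f (x + v)) = (LINT x|lborel. f x)"
proof -
  have "(LINT x|lborel. f x) = (LINT x|distr lborel borel ((+) v). f x)"
    by (simp add: lborel_distr_plus)
  also have "\<dots> = (LINT x|lborel. f (v + x))"
    using assms by (intro integral_distr) auto
  finally show ?thesis by (simp add: add.commute)
qed

text \<open>Difference quotients of \<open>W\<close> have integral zero by translation invariance,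
  and dominated convergence passes to the limit. A derivative along the single line through each
  point is all that is asked for, since the functions to which this is applied are extended by zero
  across a singular set.\<close>

lemma integral_dir_deriv_eq_zero:
  fixes W W' :: "'v::euclidean_space \<Rightarrow> complex"
  assumes W: "integrable lborel W"
    and der: "\<And>x. ((\<lambda>t. W (x + t *\<^sub>R v)) has_vector_derivative W' x) (at 0)"
    and bound: "\<And>x. norm (W' x) \<le> C * decay x"
  shows "W' \<in> borel_measurable lborel" "(LINT x|lborel. W' x) = 0"
proof -
  have C: "C \<ge> 0"
    using order_trans[OF norm_ge_zero bound[of 0]] by (simp add: decay_def)
  define D where "D = (\<lambda>n x. (W (x + (1 / real (Suc n)) *\<^sub>R v) - W x) * of_nat (Suc n))"
  have [measurable]: "W \<in> borel_measurable borel" using W by auto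
  have D_meas: "D n \<in> borel_measurable lborel" for n
    unfolding D_def by measurable
  have der': "((\<lambda>t. W (x + t *\<^sub>R v)) has_vector_derivative W' (x + s *\<^sub>R v)) (at s)" for x s
  proof -
    have "((\<lambda>t. W (x + s *\<^sub>R v + t *\<^sub>R v)) \<circ> (\<lambda>t. t - s) has_vector_derivative 1 *\<^sub>R W' (x + s *\<^sub>R v)) (at s)"
      by (rule vector_diff_chain_at) (use der in \<open>auto intro!: derivative_eq_intros\<close>)
    then show ?thesis by (simp add: o_def algebra_simps)
  qed
  have lim: "(\<lambda>n. D n x) \<longlonglongrightarrow> W' x" for x
  proof -
    have "\<exists>m. \<forall>n\<ge>m. norm (D n x - W' x) < e" if "e > 0" for e
    proof -
      have "e / 2 > 0" using that by simp
      then obtain d where d: "d > 0" "\<And>t. norm t < d \<Longrightarrow> norm (W (x + t *\<^sub>R v) - W x - t *\<^sub>R W' x) \<le> e / 2 * norm t"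
        using der[of x, unfolded has_vector_derivative_def has_derivative_at_alt, THEN conjunct2, rule_format, OF \<open>e / 2 > 0\<close>]
        by auto
      obtain m where m: "1 / real (Suc m) < d" using d(1) reals_Archimedean[of d] by (auto simp: inverse_eq_divide)
      have "norm (D n x - W' x) < e" if "n \<ge> m" for n
      proof -
        let ?t = "1 / real (Suc n)"
        have "?t \<le> 1 / real (Suc m)" using that by (simp add: frac_le)
        then have "norm (W (x + ?t *\<^sub>R v) - W x - ?t *\<^sub>R W' x) \<le> e / 2 * norm ?t"
          using m by (intro d(2)) (simp del: of_nat_Suc)
        moreover have "D n x - W' x = (W (x + ?t *\<^sub>R v) - W x - ?t *\<^sub>R W' x) * of_nat (Suc n)"
          by (simp add: D_def scaleR_conv_of_real field_simps del: of_nat_Suc)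
        ultimately have "norm (D n x - W' x) \<le> e / 2 * norm ?t * real (Suc n)"
          unfolding norm_mult norm_of_nat by (metis mult_right_mono of_nat_0_le_iff norm_mult norm_of_nat)
        then have "norm (D n x - W' x) \<le> e / 2"
          by (simp del: of_nat_Suc)
        then show ?thesis using \<open>e > 0\<close> by simp
      qed
      then show ?thesis by blast
    qed
    then show ?thesis
      unfolding LIMSEQ_iff by blast
  qed
  have D_bound: "norm (D n x) \<le> C * (1 + norm v) ^ (2 * DIM('v)) * decay x" for n x
  proof -
    let ?t = "1 / real (Suc n)"
    have "norm (W (x + ?t *\<^sub>R v) - W (x + 0 *\<^sub>R v)) \<le> (C * (1 + norm v) ^ (2 * DIM('v)) * decay x) * norm (?t - 0)"
    proof (rule differentiable_bound[of "{0..1}" "\<lambda>t. W (x + t *\<^sub>R v)" "\<lambda>s h. h *\<^sub>R W' (x + s *\<^sub>R v)"])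
      fix s :: real assume s: "s \<in> {0..1}"
      show "((\<lambda>t. W (x + t *\<^sub>R v)) has_derivative (\<lambda>h. h *\<^sub>R W' (x + s *\<^sub>R v))) (at s within {0..1})"
        using der'[of x s] unfolding has_vector_derivative_def by (rule has_derivative_at_withinI)
      have "norm (s *\<^sub>R v) \<le> norm v" using s by (simp add: mult_left_le_one_le)
      then have "C * decay (x + s *\<^sub>R v) \<le> C * ((1 + norm v) ^ (2 * DIM('v)) * decay x)"
        by (intro mult_left_mono decay_shift C)
      with bound[of "x + s *\<^sub>R v"] have "norm (W' (x + s *\<^sub>R v)) \<le> C * (1 + norm v) ^ (2 * DIM('v)) * decay x"
        by (simp add: mult.assoc)
      then show "onorm (\<lambda>h. h *\<^sub>R W' (x + s *\<^sub>R v)) \<le> C * (1 + norm v) ^ (2 * DIM('v)) * decay x"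
        by (intro onorm_le) (simp add: mult.commute mult_left_mono)
    qed auto
    then have "norm (W (x + ?t *\<^sub>R v) - W x) * real (Suc n) \<le> C * (1 + norm v) ^ (2 * DIM('v)) * decay x"
      by (simp add: field_simps del: of_nat_Suc)
    then show ?thesis by (simp add: D_def norm_mult del: of_nat_Suc)
  qed
  show meas: "W' \<in> borel_measurable lborel"
    by (rule borel_measurable_LIMSEQ_metric[OF D_meas lim])
  have "(\<lambda>n. LINT x|lborel. D n x) \<longlonglongrightarrow> (LINT x|lborel. W' x)"
    by (rule integral_dominated_convergence[where w="\<lambda>x. C * (1 + norm v) ^ (2 * DIM('v)) * decay x"])
       (use meas D_meas lim D_bound integrable_decay in auto)
  moreover have "(LINT x|lborel. D n x) = 0" for n
  proof -
    let ?W = "\<lambda>x. W (x + (1 / real (Suc n)) *\<^sub>R v)"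
    have "integrable lborel ?W"
    proof -
      have "integrable (distr lborel borel ((+) ((1 / real (Suc n)) *\<^sub>R v))) W"
        by (simp add: lborel_distr_plus W)
      then show ?thesis by (subst (asm) integrable_distr_eq) (auto simp: add.commute)
    qed
    then have "(LINT x|lborel. ?W x - W x) = 0"
      using W by (simp add: integral_translation)
    then show ?thesis unfolding D_def by simp
  qed
  ultimately show "(LINT x|lborel. W' x) = 0"
    by (simp add: LIMSEQ_const_iff)
qed

subsection \<open>Zero sets of polynomials\<close>

lemma negligible_zeros_polynomial:
  fixes p :: "'f::real_or_complex ^ 'n \<Rightarrow> 'f"
  assumes "nonzero_polynomial p"
  shows "negligible {x. p x = 0}"
proof -
  obtain a where a: "p a \<noteq> 0" using assms by (auto simp: nonzero_polynomial_def)
  define Z where "Z = (\<lambda>R. {x. p (a + x) = 0} \<inter> cball 0 R)"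
  have cont: "continuous_on UNIV (\<lambda>x. p (a + x))"
    using continuous_on_compose[of UNIV "(+) a" p] continuous_polynomial_fun[OF nonzero_polynomialD[OF assms]]
    by (simp add: o_def continuous_on_add)
  have Z_compact: "compact (Z R)" for R
    unfolding Z_def using closed_Collect_eq[OF cont continuous_on_const[of _ 0]]
    by (intro closed_Int_compact) auto
  \<comment> \<open>The dilates of a piece of the zero set about a point off it, by infinitely many ratios, cover
    every point only finitely often, because a polynomial has finitely many zeros on each line.\<close>
  have Z_null: "measure lebesgue (Z R) = 0" if "R > 0" for R
  proof -
    \<comment> \<open>Distinct ratios between 1 and 2: the dilates stay in one ball, which gives the
      integrable majorant, and none of them has smaller measure than \<open>Z R\<close>. Since their
      indicators tend to 0 pointwise, their measures tend to 0, and so \<open>Z R\<close> is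
      null.\<close>
    define c where "c = (\<lambda>k. 1 + 1 / real (Suc k))"
    have c: "1 \<le> c k" "c k \<le> 2" for k by (auto simp: c_def)
    define A where "A = (\<lambda>k. (\<lambda>x. c k *\<^sub>R x + 0) ` Z R)"
    have A_meas: "A k \<in> sets lebesgue" for k
      unfolding A_def by (intro lmeasurable_compact[THEN fmeasurableD] compact_continuous_image Z_compact continuous_intros)
    have A_sub: "A k \<subseteq> cball 0 (2 * R)" for k
    proof
      fix y assume "y \<in> A k"
      then obtain x where "x \<in> Z R" "y = c k *\<^sub>R x" by (auto simp: A_def)
      then show "y \<in> cball 0 (2 * R)"
        using c[of k] mult_mono[of "c k" 2 "norm x" R] that by (auto simp: Z_def)
    qed
    have fin: "finite {k. y \<in> A k}" for y
    proof -
      obtain q where q: "\<And>t. p (a + t *s y) = poly q t"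
        using polynomial_fun_line[OF nonzero_polynomialD[OF assms]] by metis
      have "q \<noteq> 0" using a q[of 0] by auto
      then have "finite {t. poly q t = 0}" by (rule poly_roots_finite)
      moreover have "(\<lambda>k. of_real (1 / c k)) ` {k. y \<in> A k} \<subseteq> {t. poly q t = 0}"
      proof safe
        fix k assume "y \<in> A k"
        then obtain x where x: "x \<in> Z R" "y = c k *\<^sub>R x" by (auto simp: A_def)
        then have xe: "x = of_real (1 / c k) *s y"
          using c[of k] by (simp only: scaleR_eq_vector_scalar_mult[symmetric]) simp
        have "p (a + x) = 0" using x(1) by (simp add: Z_def)
        then show "poly q (of_real (1 / c k)) = 0" by (simp only: q[symmetric] xe[symmetric])
      qed
      moreover have "inj_on (\<lambda>k. of_real (1 / c k) :: 'f) {k. y \<in> A k}"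
      proof (rule inj_onI)
        fix k l assume "of_real (1 / c k) = (of_real (1 / c l) :: 'f)"
        then have "1 / c k = 1 / c l" by (simp only: of_real_eq_iff)
        then have "c k = c l" using c[of k] c[of l] by (simp add: field_simps)
        then show "k = l" by (simp add: c_def)
      qed
      ultimately show ?thesis using finite_subset finite_imageD by blast
    qed
    have "(\<lambda>k. LINT x|lebesgue. indicator (A k) x :: real) \<longlonglongrightarrow> (LINT x::'f^'n|lebesgue. 0 :: real)"
    proof (rule integral_dominated_convergence[where w="indicator (cball 0 (2 * R))"])
      show "integrable lebesgue (indicator (cball 0 (2 * R)) :: _ \<Rightarrow> real)"
        by (subst integrable_completion)
          (auto intro!: integrable_real_indicator borel_measurable_indicator simp: emeasure_lborel_cball_finite[unfolded infinity_ennreal_def])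
      show "AE x in lebesgue. (\<lambda>k. indicator (A k) x :: real) \<longlonglongrightarrow> 0"
      proof (rule AE_I2, rule tendsto_eventually)
        fix y :: "'f^'n"
        obtain m where "\<And>k. y \<in> A k \<Longrightarrow> k < m"
          using fin[of y] by (metis finite_nat_set_iff_bounded mem_Collect_eq)
        then have "y \<notin> A k" if "k \<ge> m" for k using that by (meson not_le)
        then show "\<forall>\<^sub>F k in sequentially. indicator (A k) y = (0::real)"
          unfolding eventually_sequentially by (auto simp: indicator_def intro: exI[of _ m])
      qed
      show "AE x in lebesgue. norm (indicator (A k) x :: real) \<le> indicator (cball 0 (2 * R)) x" for k
        using A_sub[of k] by (intro AE_I2) (simp only: indicator_def, auto)
    qed (use A_meas in auto)
    then have "(\<lambda>k. measure lebesgue (A k)) \<longlonglongrightarrow> 0" by simp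
    moreover have "measure lebesgue (Z R) \<le> measure lebesgue (A k)" for k
    proof -
      have "measure lebesgue (A k) = \<bar>c k\<bar> ^ DIM('f^'n) * measure lebesgue (Z R)"
        unfolding A_def by (rule measure_lebesgue_affine)
      moreover have "1 \<le> \<bar>c k\<bar> ^ DIM('f^'n)" using c[of k] by (intro one_le_power) auto
      ultimately show ?thesis using mult_right_mono[of 1 "\<bar>c k\<bar> ^ DIM('f^'n)" "measure lebesgue (Z R)"] by simp
    qed
    ultimately have "measure lebesgue (Z R) \<le> 0"
      by (intro LIMSEQ_le_const) auto
    then show ?thesis by (simp add: measure_le_0_iff)
  qed
  have "negligible (Z (real (Suc n)))" for n
    using Z_null[of "real (Suc n)"] lmeasurable_compact[OF Z_compact[of "real (Suc n)"]] by (simp add: negligible_iff_measure)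
  then have "negligible (\<Union>n. Z (real (Suc n)))" by (intro negligible_Union_nat)
  then have "negligible ((+) a ` (\<Union>n. Z (real (Suc n))))" by (rule negligible_translation)
  moreover have "{x. p x = 0} \<subseteq> (+) a ` (\<Union>n. Z (real (Suc n)))"
  proof
    fix x assume x: "x \<in> {x. p x = 0}"
    obtain n where "norm (x - a) \<le> real n" using real_arch_simple by blast
    then have "x - a \<in> Z (real (Suc n))" using x by (simp add: Z_def)
    then show "x \<in> (+) a ` (\<Union>n. Z (real (Suc n)))" by (intro image_eqI[of _ _ "x - a"]) auto
  qed
  ultimately show ?thesis by (rule negligible_subset)
qed

subsection \<open>Identity theorem for meromorphic families\<close>

text \<open>Differentiability along complex lines is weaker than joint holomorphy, is immediate for
  integrals depending on a parameter, and is still strong enough for the identity theorem, which is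
  proved line by line.\<close>

definition line_holomorphic :: "(complex ^ 'k \<Rightarrow> complex) \<Rightarrow> (complex ^ 'k) set \<Rightarrow> bool" where
  "line_holomorphic f U \<longleftrightarrow> (\<forall>s\<in>U. \<forall>v. (\<lambda>z. f (s + z *s v)) field_differentiable (at 0))"

lemma line_holomorphic_subset: "line_holomorphic f U \<Longrightarrow> V \<subseteq> U \<Longrightarrow> line_holomorphic f V"
  unfolding line_holomorphic_def by blast

lemma line_holomorphic_const: "line_holomorphic (\<lambda>s. c) U"
  by (simp add: line_holomorphic_def)

lemma line_holomorphic_diff:
  "line_holomorphic f U \<Longrightarrow> line_holomorphic g U \<Longrightarrow> line_holomorphic (\<lambda>s. f s - g s) U"
  unfolding line_holomorphic_def by (auto intro: field_differentiable_diff)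

lemma line_holomorphic_mult:
  "line_holomorphic f U \<Longrightarrow> line_holomorphic g U \<Longrightarrow> line_holomorphic (\<lambda>s. f s * g s) U"
  unfolding line_holomorphic_def by (auto intro: field_differentiable_mult)

lemma line_holomorphic_sum:
  "(\<And>i. i \<in> I \<Longrightarrow> line_holomorphic (f i) U) \<Longrightarrow> line_holomorphic (\<lambda>s. \<Sum>i\<in>I. f i s) U"
  unfolding line_holomorphic_def by (auto intro!: field_differentiable_sum)

lemma line_holomorphic_nth: "line_holomorphic (\<lambda>s. s $ j) U"
  unfolding line_holomorphic_def by (auto intro!: derivative_intros)

lemma bounded_linear_vector_scalar_mult: "bounded_linear (\<lambda>z. z *s (v :: complex ^ 'k))"
proof -
  have "linear (\<lambda>z. z *s v)"
    by (rule linearI) (auto simp: vec_eq_iff algebra_simps)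
  then show ?thesis by (simp add: linear_conv_bounded_linear)
qed

lemma holomorphic_several_imp_line_holomorphic:
  assumes "holomorphic_several f U" shows "line_holomorphic f U"
  unfolding line_holomorphic_def
proof (intro ballI allI)
  fix s v assume "s \<in> U"
  then obtain f' where f': "(f has_derivative f') (at s)" "\<And>c v. f' (c *s v) = c * f' v"
    using assms unfolding holomorphic_several_def by blast
  have "((\<lambda>z. s + z *s v) has_derivative (\<lambda>z. z *s v)) (at 0)"
    using has_derivative_add[OF has_derivative_const[of s] bounded_linear_imp_has_derivative[OF bounded_linear_vector_scalar_mult[of v]]]
    by simp
  then have "((\<lambda>z. f (s + z *s v)) has_derivative (\<lambda>z. f' (z *s v))) (at 0)"
    using has_derivative_compose[of "\<lambda>z. s + z *s v" "\<lambda>z. z *s v" 0 UNIV f f'] f'(1) by simp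
  then have "((\<lambda>z. f (s + z *s v)) has_field_derivative f' v) (at 0)"
  proof -
    have "(\<lambda>z. f' (z *s v)) = (*) (f' v)" by (simp add: f'(2) fun_eq_iff mult.commute)
    with \<open>((\<lambda>z. f (s + z *s v)) has_derivative (\<lambda>z. f' (z *s v))) (at 0)\<close> show ?thesis
      by (simp add: has_field_derivative_def)
  qed
  then show "(\<lambda>z. f (s + z *s v)) field_differentiable (at 0)"
    unfolding field_differentiable_def by blast
qed

lemma line_holomorphic_imp_holomorphic_on:
  assumes "line_holomorphic f U"
  shows "(\<lambda>z. f (a + z *s v)) holomorphic_on {z. a + z *s v \<in> U}"
proof (rule holomorphic_onI)
  fix z0 assume "z0 \<in> {z. a + z *s v \<in> U}"
  then obtain D where D: "((\<lambda>z. f ((a + z0 *s v) + z *s v)) has_field_derivative D) (at 0)"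
    using assms unfolding line_holomorphic_def field_differentiable_def by blast
  have "((\<lambda>z. f (a + z *s v)) has_field_derivative D) (at z0)"
    using DERIV_shift[of "\<lambda>z. f (a + z *s v)" D 0 z0] D
    by (simp add: vector_sadd_rdistrib add.commute add.left_commute)
  then show "(\<lambda>z. f (a + z *s v)) field_differentiable at z0 within {z. a + z *s v \<in> U}"
    unfolding field_differentiable_def using has_field_derivative_at_within by blast
qed

text \<open>The interior of the zero set is shown to be closed in \<open>W\<close>. Around a limit
  point take a ball in \<open>W\<close> and a point \<open>a\<close> of the interior inside that
  ball; any \<open>y\<close> in the ball lies on a complex line through \<open>a\<close>, whose
  slice of the ball is convex, and the identity theorem in one variable moves the zeros from near
  \<open>a\<close> to \<open>y\<close>.\<close>

lemma line_holomorphic_eq_zero: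
  assumes W: "open W" "connected W" and f: "line_holomorphic f W"
    and V: "open V" "V \<subseteq> W" "V \<noteq> {}" "\<And>s. s \<in> V \<Longrightarrow> f s = 0" and s: "s \<in> W"
  shows "f s = 0"
proof -
  define A where "A = interior {s\<in>W. f s = 0}"
  have A0: "f s = 0" if "s \<in> A" for s using that interior_subset unfolding A_def by blast
  have AW: "A \<subseteq> W" unfolding A_def using interior_subset by blast
  have "V \<subseteq> A" unfolding A_def using V by (intro interior_maximal) auto
  have "s1 \<in> A" if s1: "s1 \<in> W" "s1 \<in> closure A" for s1
  proof -
    obtain r where r: "r > 0" "ball s1 r \<subseteq> W" using W(1) s1(1) by (meson open_contains_ball)
    obtain a where a: "a \<in> A" "a \<in> ball s1 r"
      using s1(2) r(1) unfolding closure_approachable by (auto simp: dist_commute)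
    have "f y = 0" if y: "y \<in> ball s1 r" for y
    proof -
      let ?l = "\<lambda>z. a + z *s (y - a)"
      let ?S = "{z. ?l z \<in> ball s1 r}"
      have lin: "linear (\<lambda>z. z *s (y - a))"
        using bounded_linear_vector_scalar_mult bounded_linear.linear by blast
      have cont: "continuous_on UNIV ?l"
        using bounded_linear_vector_scalar_mult by (intro continuous_intros linear_continuous_on)
      have "convex ?S"
      proof -
        have "?S = (\<lambda>z. z *s (y - a)) -` ((\<lambda>x. - a + x) ` ball s1 r)"
          by (force simp: image_iff)
        also have "convex \<dots>"
          by (intro convex_linear_vimage[OF lin] convex_translation convex_ball)
        finally show ?thesis .
      qed
      then have "connected ?S" by (rule convex_connected)
      moreover have "open ?S" using open_vimage[OF open_ball cont] by (simp add: vimage_def)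
      moreover have "open {z. ?l z \<in> A \<inter> ball s1 r}"
        using open_vimage[OF open_Int[OF open_interior open_ball] cont] by (simp add: vimage_def A_def)
      moreover have "{z. ?l z \<in> A \<inter> ball s1 r} \<noteq> {}"
      proof -
        have "0 \<in> {z. ?l z \<in> A \<inter> ball s1 r}" using a by simp
        then show ?thesis by blast
      qed
      moreover have "(\<lambda>z. f (?l z)) holomorphic_on ?S"
        by (rule line_holomorphic_imp_holomorphic_on[OF line_holomorphic_subset[OF f r(2)]])
      moreover have "1 \<in> ?S" using y by simp
      ultimately have "f (?l 1) = 0"
        by (intro analytic_continuation_open[of "{z. ?l z \<in> A \<inter> ball s1 r}" ?S "\<lambda>z. f (?l z)" "\<lambda>z. 0" 1])
           (auto simp del: mem_ball vector_ssub_ldistrib intro!: A0)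
      then show ?thesis by simp
    qed
    then have "ball s1 r \<subseteq> A" unfolding A_def using r by (intro interior_maximal) auto
    then show ?thesis using r(1) by auto
  qed
  then have "closedin (top_of_set W) A"
    unfolding closedin_limpt using AW closure_def by (metis Un_iff mem_Collect_eq)
  moreover have "openin (top_of_set W) A"
    unfolding openin_open_eq[OF W(1)] using AW by (simp add: A_def)
  ultimately have "A = {} \<or> A = W"
    using W(2) unfolding connected_clopen by blast
  then show ?thesis using A0 s V(3) \<open>V \<subseteq> A\<close> by blast
qed

lemma meromorphic_eq_zero:
  fixes \<Phi> :: "complex ^ 'k \<Rightarrow> complex"
  assumes U: "open U" and \<Phi>: "line_holomorphic \<Phi> U"
    and local: "\<And>s0. \<exists>W h H. open W \<and> connected W \<and> s0 \<in> W \<and> holomorphic_several h W \<and>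
      (\<exists>s\<in>W. h s \<noteq> 0) \<and> {s\<in>W. h s \<noteq> 0} \<subseteq> U \<and>
      line_holomorphic H W \<and> (\<forall>s\<in>W \<inter> U. H s = h s * \<Phi> s)"
    and zero: "\<And>s. s \<in> U \<Longrightarrow> (\<And>j. Re (s $ j) > c) \<Longrightarrow> \<Phi> s = 0"
    and s: "s \<in> U"
  shows "\<Phi> s = 0"
proof -
  define A where "A = {s0. \<exists>V. open V \<and> s0 \<in> V \<and> (\<forall>s\<in>V \<inter> U. \<Phi> s = 0)}"
  have "A = \<Union>{V. open V \<and> (\<forall>s\<in>V \<inter> U. \<Phi> s = 0)}" unfolding A_def by auto
  then have "open A" by auto
  have "closure A \<subseteq> A"
  proof
    fix s0 assume s0: "s0 \<in> closure A"
    obtain W h H where W: "open W" "connected W" "s0 \<in> W" and h: "holomorphic_several h W"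
      and h0: "\<exists>s\<in>W. h s \<noteq> 0" "{s\<in>W. h s \<noteq> 0} \<subseteq> U"
      and H: "line_holomorphic H W" "\<forall>s\<in>W \<inter> U. H s = h s * \<Phi> s"
      using local[of s0] by (elim exE conjE) (rule that, assumption+)
    note hl = holomorphic_several_imp_line_holomorphic[OF h]
    have h_nz: "\<exists>s\<in>V. h s \<noteq> 0" if "open V" "V \<subseteq> W" "V \<noteq> {}" for V
      using line_holomorphic_eq_zero[OF W(1,2) hl that] h0(1) by blast
    have "continuous_on W h"
      using h unfolding holomorphic_several_def
      by (intro continuous_at_imp_continuous_on) (blast intro: has_derivative_continuous)
    then have open_nz: "open {s\<in>V. h s \<noteq> 0}" if "open V" "V \<subseteq> W" for V
      using that continuous_open_preimage[of V h "- {0}"] continuous_on_subset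
      by (auto simp: vimage_def Int_def)
    from s0 W obtain s1 where "s1 \<in> W" "s1 \<in> A"
      using open_Int_closure_eq_empty[OF W(1), of A] by blast
    then obtain V where V: "open V" "s1 \<in> V" "\<And>s. s \<in> V \<Longrightarrow> s \<in> U \<Longrightarrow> \<Phi> s = 0"
      unfolding A_def by blast
    have HW: "H s = 0" if "s \<in> W" for s
    proof (rule line_holomorphic_eq_zero[OF W(1,2) H(1) open_nz[of "V \<inter> W"] _ _ _ that])
      show "{s \<in> V \<inter> W. h s \<noteq> 0} \<noteq> {}"
        using h_nz[of "V \<inter> W"] V W \<open>s1 \<in> W\<close> by auto
    qed (use V W h0 H in auto)
    \<comment> \<open>That \<open>H\<close> vanishes gives nothing at zeros of \<open>h\<close>.
      Those lying in \<open>U\<close> are reached by a second use of the identity theorem, for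
      \<Phi> itself on a small ball.\<close>
    have "\<Phi> s = 0" if s: "s \<in> W" "s \<in> U" for s
    proof -
      obtain r where r: "r > 0" "ball s r \<subseteq> W \<inter> U"
        using open_Int[OF W(1) U] s by (meson IntI open_contains_ball)
      show ?thesis
      proof (rule line_holomorphic_eq_zero[OF open_ball connected_ball _ open_nz[OF open_ball]])
        show "{y \<in> ball s r. h y \<noteq> 0} \<noteq> {}"
          using h_nz[OF open_ball, of s r] r by auto
        show "\<Phi> y = 0" if "y \<in> {y \<in> ball s r. h y \<noteq> 0}" for y
        proof -
          have "y \<in> W \<inter> U" "h y \<noteq> 0" using that r by auto
          then show ?thesis using HW[of y] H(2) by auto
        qed
      qed (use r \<Phi> line_holomorphic_subset in auto)
    qed
    then show "s0 \<in> A" unfolding A_def using W by blast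
  qed
  then have "closed A" by (simp add: closure_subset_eq)
  moreover have "A \<noteq> {}"
  proof -
    have "{s :: complex ^ 'k. \<forall>j. Re (s $ j) > c} = (\<Inter>j. {s. Re (s $ j) > c})" by auto
    also have "open \<dots>"
      by (intro open_INT finite ballI open_Collect_less continuous_intros)
    finally have "open {s :: complex ^ 'k. \<forall>j. Re (s $ j) > c}" .
    moreover have "(\<chi> j. of_real (c + 1)) \<in> {s :: complex ^ 'k. \<forall>j. Re (s $ j) > c}" by simp
    ultimately have "(\<chi> j. of_real (c + 1)) \<in> A" unfolding A_def using zero by blast
    then show ?thesis by blast
  qed
  ultimately have "A = UNIV" using \<open>open A\<close> clopen by blast
  then show ?thesis unfolding A_def using s by blast
qed

text \<open>This is the shape in which equations are continued: differential equations give
  coefficients \<open>a i\<close> polynomial in \<open>s\<close> with \<open>E = 0\<close>, and the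
  comparison of a family with an integral gives one term with \<open>E\<close> entire.\<close>

lemma meromorphic_family_identity:
  fixes T :: "complex ^ 'k \<Rightarrow> ('v::euclidean_space \<Rightarrow> complex) \<Rightarrow> complex"
  assumes T: "meromorphic_family U T" and f: "\<And>i. i \<in> I \<Longrightarrow> f i \<in> schwartz"
    and a: "\<And>i. i \<in> I \<Longrightarrow> line_holomorphic (a i) UNIV" and E: "line_holomorphic E UNIV"
    and eq: "\<And>s. s \<in> U \<Longrightarrow> (\<And>j. Re (s $ j) > c) \<Longrightarrow> (\<Sum>i\<in>I. a i s * T s (f i)) = E s"
    and s: "s \<in> U"
  shows "(\<Sum>i\<in>I. a i s * T s (f i)) = E s"
proof -
  have "(\<Sum>i\<in>I. a i s * T s (f i)) - E s = 0"
  proof (rule meromorphic_eq_zero[of U _ c])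
    show "open U" using T by (simp add: meromorphic_family_def)
    have "line_holomorphic (\<lambda>s. T s (f i)) U" if "i \<in> I" for i
      using T f[OF that] by (auto simp: meromorphic_family_def intro: holomorphic_several_imp_line_holomorphic)
    then show "line_holomorphic (\<lambda>s. (\<Sum>i\<in>I. a i s * T s (f i)) - E s) U"
      by (intro line_holomorphic_diff line_holomorphic_sum line_holomorphic_mult line_holomorphic_subset[OF E]
          line_holomorphic_subset[OF a]) auto
    fix s0
    from T[unfolded meromorphic_family_def, THEN conjunct2, THEN conjunct2, THEN conjunct2, rule_format, of s0]
    obtain W h where W: "open W" "connected W" "s0 \<in> W" "holomorphic_several h W" "\<exists>s\<in>W. h s \<noteq> 0"
      "{s\<in>W. h s \<noteq> 0} \<subseteq> U"
      and family: "\<forall>f\<in>schwartz. \<exists>H. holomorphic_several H W \<and> (\<forall>s\<in>W \<inter> U. H s = h s * T s f)"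
      by (elim exE conjE) (rule that, assumption+)
    have "\<forall>i\<in>I. \<exists>H. holomorphic_several H W \<and> (\<forall>s\<in>W \<inter> U. H s = h s * T s (f i))"
      using family f by blast
    then obtain H where H: "\<And>i. i \<in> I \<Longrightarrow> holomorphic_several (H i) W"
      "\<And>i s. i \<in> I \<Longrightarrow> s \<in> W \<inter> U \<Longrightarrow> H i s = h s * T s (f i)"
      unfolding bchoice_iff by blast
    have "line_holomorphic (\<lambda>s. (\<Sum>i\<in>I. a i s * H i s) - h s * E s) W"
      using H(1) W(4)
      by (intro line_holomorphic_diff line_holomorphic_sum line_holomorphic_mult line_holomorphic_subset[OF E]
          line_holomorphic_subset[OF a] holomorphic_several_imp_line_holomorphic) auto
    moreover have "(\<Sum>i\<in>I. a i s * H i s) - h s * E s = h s * ((\<Sum>i\<in>I. a i s * T s (f i)) - E s)"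
      if "s \<in> W \<inter> U" for s
      using H(2)[OF _ that] by (simp add: algebra_simps sum_distrib_left cong: sum.cong)
    ultimately show "\<exists>W h H. open W \<and> connected W \<and> s0 \<in> W \<and> holomorphic_several h W \<and>
      (\<exists>s\<in>W. h s \<noteq> 0) \<and> {s\<in>W. h s \<noteq> 0} \<subseteq> U \<and>
      line_holomorphic H W \<and> (\<forall>s\<in>W \<inter> U. H s = h s * ((\<Sum>i\<in>I. a i s * T s (f i)) - E s))"
      using W by blast
  qed (use eq s in auto)
  then show ?thesis by simp
qed

subsection \<open>Fourier transform of test functions\<close>

lemma integral_eq_integral_cbox:
  fixes f :: "'v::euclidean_space \<Rightarrow> complex"
  assumes "continuous_on UNIV f" "\<And>x. x \<notin> cbox a b \<Longrightarrow> f x = 0"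
  shows "(LINT x|lborel. f x) = integral (cbox a b) f"
proof -
  have "(LINT x|lborel. f x) = integral UNIV f"
    by (rule integral_lborel[symmetric])
       (rule integrable_continuous_compact_support[OF assms(1) compact_cbox assms(2)])
  also have "\<dots> = integral UNIV (\<lambda>x. if x \<in> cbox a b then f x else 0)"
    using assms(2) by (intro arg_cong[where f="integral UNIV"]) (auto simp: fun_eq_iff)
  also have "\<dots> = integral (cbox a b) f"
    by (rule Henstock_Kurzweil_Integration.integral_restrict_UNIV)
  finally show ?thesis .
qed

lemma integral_affine:
  fixes f :: "'v::euclidean_space \<Rightarrow> complex"
  assumes "f \<in> borel_measurable lborel" "c \<noteq> 0"
  shows "(LINT x|lborel. f x) = \<bar>c\<bar> ^ DIM('v) *\<^sub>R (LINT x|lborel. f (a + c *\<^sub>R x))"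
proof -
  have [measurable]: "f \<in> borel_measurable borel" using assms(1) by simp
  have "(LINT x|lborel. f x) = (LINT x|density (distr lborel borel (\<lambda>x. a + c *\<^sub>R x)) (\<lambda>_. ennreal (\<bar>c\<bar> ^ DIM('v))). f x)"
    by (subst lborel_affine[OF assms(2), of a]) simp
  also have "\<dots> = (LINT x|distr lborel borel (\<lambda>x. a + c *\<^sub>R x). \<bar>c\<bar> ^ DIM('v) *\<^sub>R f x)"
    by (subst integral_density) auto
  also have "\<dots> = (LINT x|lborel. \<bar>c\<bar> ^ DIM('v) *\<^sub>R f (a + c *\<^sub>R x))"
    by (subst integral_distr) auto
  finally show ?thesis by simp
qed

lemma test_fun_on_cbox:
  assumes "test_fun_on S f"
  obtains a where "\<And>x. x \<notin> cbox (-a) a \<Longrightarrow> f x = 0"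
proof -
  obtain K where K: "compact K" "\<And>x. x \<notin> K \<Longrightarrow> f x = 0"
    using assms unfolding test_fun_on_def by blast
  obtain a where "K \<subseteq> cbox (-a) a"
    using bounded_subset_cbox_symmetric[OF compact_imp_bounded[OF K(1)]] by blast
  then show thesis using that[of a] K(2) by blast
qed

text \<open>The map \<open>D\<close> identifies the dual space with V as a Euclidean space, so that
  \<open>D y \<bullet> x\<close> is the real part of the pairing. Fourier analysis can then be done
  on a real inner product space; symmetry of \<open>D\<close> reflects symmetry of the pairing in
  coordinates.\<close>

locale symmetric_isometry =
  fixes D :: "'v::euclidean_space \<Rightarrow> 'v"
  assumes D_sym: "D y \<bullet> x = D x \<bullet> y" and D_norm: "norm (D y) = norm y"
begin

text \<open>Linearity is a consequence of symmetry, since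
  \<open>D (x + y) \<bullet> z = D z \<bullet> (x + y)\<close> for all \<open>z\<close>.\<close>

lemma D_bounded_linear: "bounded_linear D"
proof (rule bounded_linear_intro[of _ 1])
  show "D (x + y) = D x + D y" for x y
    by (rule euclidean_eqI) (simp add: D_sym[of "x + y"] inner_add_left inner_add_right D_sym[of _ x] D_sym[of _ y])
  show "D (r *\<^sub>R x) = r *\<^sub>R D x" for r x
    by (rule euclidean_eqI) (simp add: D_sym[of "r *\<^sub>R x"] D_sym[of _ x])
qed (simp add: D_norm)

lemma D_scaleR: "D (r *\<^sub>R x) = r *\<^sub>R D x"
  by (rule linear_scale[OF bounded_linear.linear[OF D_bounded_linear]])

lemma continuous_on_D [continuous_intros]: "continuous_on S f \<Longrightarrow> continuous_on S (\<lambda>x. D (f x))"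
  by (rule bounded_linear.continuous_on[OF D_bounded_linear])

definition wave :: "real \<Rightarrow> 'v \<Rightarrow> 'v \<Rightarrow> complex" where
  "wave t y x = exp (\<i> * of_real (t * (D y \<bullet> x)))"

lemma norm_wave [simp]: "norm (wave t y x) = 1"
  by (simp add: wave_def)

lemma wave_zero [simp]: "wave t 0 x = 1" "wave t y 0 = 1"
  using linear_0[OF bounded_linear.linear[OF D_bounded_linear]] by (simp_all add: wave_def)

lemma wave_diff: "wave t y (x - z) = wave t y x * wave (-t) y z"
  by (simp add: wave_def inner_diff_right algebra_simps flip: exp_add)

lemma wave_scale: "wave t (r *\<^sub>R y) x = wave t y (r *\<^sub>R x)"
  by (simp add: wave_def D_scaleR)

lemma cnj_wave: "cnj (wave t y x) = wave (-t) y x"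
  by (simp add: wave_def exp_cnj)

lemma continuous_on_wave [continuous_intros]:
  "continuous_on S f \<Longrightarrow> continuous_on S g \<Longrightarrow> continuous_on S (\<lambda>x. wave t (f x) (g x))"
  unfolding wave_def by (intro continuous_intros)

lemma wave_has_derivative:
  "((\<lambda>x. wave t y x) has_derivative (\<lambda>v. \<i> * of_real (t * (D y \<bullet> v)) * wave t y x)) (at x)"
proof -
  have "((\<lambda>x. \<i> * complex_of_real (t * (D y \<bullet> x))) has_derivative (\<lambda>v. \<i> * of_real (t * (D y \<bullet> v)))) (at x)"
    by (auto intro!: derivative_eq_intros)
  from has_derivative_compose[OF this DERIV_exp[unfolded has_field_derivative_def]]
  show ?thesis by (simp add: wave_def mult.commute)
qed

definition ft :: "real \<Rightarrow> ('v \<Rightarrow> complex) \<Rightarrow> 'v \<Rightarrow> complex" where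
  "ft t f y = (LINT x|lborel. wave t y x * f x)"

lemma integrable_wave_test:
  assumes "test_fun_on S f" shows "integrable lborel (\<lambda>x. wave t y x * f x)"
  using test_fun_on_mono[OF assms, of UNIV] by (intro integrable_mult_test_fun[of UNIV]) (auto intro!: continuous_intros)

lemma ft_add:
  assumes "test_fun_on S f" "test_fun_on S g"
  shows "ft t (\<lambda>x. f x + g x) y = ft t f y + ft t g y"
  unfolding ft_def by (simp add: distrib_left integrable_wave_test[OF assms(1)] integrable_wave_test[OF assms(2)])

lemma ft_cmult: "ft t (\<lambda>x. c * f x) y = c * ft t f y"
  unfolding ft_def by (simp add: mult.left_commute[of _ c])

lemma ft_sum:
  assumes "\<And>i. i \<in> I \<Longrightarrow> test_fun_on S (f i)"
  shows "ft t (\<lambda>x. \<Sum>i\<in>I. f i x) y = (\<Sum>i\<in>I. ft t (f i) y)"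
  unfolding ft_def sum_distrib_left
  by (rule Bochner_Integration.integral_sum) (rule integrable_wave_test[OF assms])

lemma ft_bound:
  assumes "test_fun_on S f" shows "norm (ft t f y) \<le> (LINT x|lborel. norm (f x))"
  unfolding ft_def using integral_norm_bound[of lborel "\<lambda>x. wave t y x * f x"] by (simp add: norm_mult)

text \<open>Integration by parts: the directional derivative of \<open>wave t y x * f x\<close> has
  integral zero.\<close>

lemma ft_dir_deriv_fun:
  assumes "test_fun_on S f"
  shows "ft t (dir_deriv v f) y = - (\<i> * of_real (t * (D y \<bullet> v))) * ft t f y"
proof -
  let ?c = "\<i> * complex_of_real (t * (D y \<bullet> v))"
  have f: "test_fun_on UNIV f" "test_fun_on UNIV (dir_deriv v f)"
    using test_fun_on_mono[OF assms, of UNIV] by (auto intro: test_fun_on_dir_deriv)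
  obtain C where C: "\<And>x. (1 + norm x) ^ (2 * DIM('v)) * norm (f x) \<le> C"
    using test_fun_weighted_bound[OF f(1)] by blast
  obtain C' where C': "\<And>x. (1 + norm x) ^ (2 * DIM('v)) * norm (dir_deriv v f x) \<le> C'"
    using test_fun_weighted_bound[OF f(2)] by blast
  have "(LINT x|lborel. wave t y x * dir_deriv v f x + ?c * (wave t y x * f x)) = 0"
  proof (rule integral_dir_deriv_eq_zero(2))
    show "integrable lborel (\<lambda>x. wave t y x * f x)" by (rule integrable_wave_test[OF f(1)])
    show "((\<lambda>r. wave t y (x + r *\<^sub>R v) * f (x + r *\<^sub>R v)) has_vector_derivative
        wave t y x * dir_deriv v f x + ?c * (wave t y x * f x)) (at 0)" for x
    proof -
      have lin: "((\<lambda>r. x + r *\<^sub>R v) has_derivative (\<lambda>r. r *\<^sub>R v)) (at 0)"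
        by (auto intro!: derivative_eq_intros)
      have "((\<lambda>x. wave t y x * f x) has_derivative
        (\<lambda>v. wave t y x * dir_deriv v f x + \<i> * of_real (t * (D y \<bullet> v)) * wave t y x * f x)) (at x)"
        by (intro has_derivative_mult wave_has_derivative smooth_on_has_derivative[OF test_fun_on_smooth[OF f(1)]]) auto
      then have "((\<lambda>x. wave t y x * f x) has_derivative
        (\<lambda>v. wave t y x * dir_deriv v f x + \<i> * of_real (t * (D y \<bullet> v)) * wave t y x * f x)) (at (x + 0 *\<^sub>R v))"
        by simp
      from has_derivative_compose[OF lin this]
      have der: "((\<lambda>r. wave t y (x + r *\<^sub>R v) * f (x + r *\<^sub>R v)) has_derivative
        (\<lambda>r. wave t y x * dir_deriv (r *\<^sub>R v) f x + \<i> * of_real (t * (D y \<bullet> (r *\<^sub>R v))) * wave t y x * f x)) (at 0)" .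
      have "dir_deriv (r *\<^sub>R v) f x = r *\<^sub>R dir_deriv v f x" for r
        using linear_scale[OF has_derivative_linear[OF smooth_on_has_derivative[OF test_fun_on_smooth[OF f(1)], of x UNIV]]]
        by simp
      with der show ?thesis
        unfolding has_vector_derivative_def
        by (auto elim!: has_derivative_eq_rhs simp: fun_eq_iff algebra_simps scaleR_conv_of_real)
    qed
    show "norm (wave t y x * dir_deriv v f x + ?c * (wave t y x * f x)) \<le> (C' + norm ?c * C) * decay x" for x
    proof -
      have pos: "(1 + norm x) ^ (2 * DIM('v)) > 0" by (intro zero_less_power add_pos_nonneg) auto
      have "norm (f x) \<le> C * decay x" "norm (dir_deriv v f x) \<le> C' * decay x"
        using C[of x] C'[of x] pos by (simp_all add: decay_def field_simps)
      then have "norm (dir_deriv v f x) + norm ?c * norm (f x) \<le> C' * decay x + norm ?c * (C * decay x)"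
        by (intro add_mono mult_left_mono) auto
      then show ?thesis
        using norm_triangle_ineq[of "wave t y x * dir_deriv v f x" "?c * (wave t y x * f x)"]
        by (simp add: norm_mult algebra_simps del: of_real_mult)
    qed
  qed
  then have "ft t (dir_deriv v f) y + ?c * ft t f y = 0"
    unfolding ft_def using integrable_wave_test[OF f(1)] integrable_wave_test[OF f(2)] by simp
  then show ?thesis by (simp add: add_eq_0_iff2)
qed

lemma test_fun_on_linear_mult:
  assumes "test_fun_on S f" "open S" "bounded_linear g"
  shows "test_fun_on S (\<lambda>x. g x * f x)"
  using assms by (intro test_fun_on_mult smooth_on_linear)

lemma test_fun_on_inner_mult:
  assumes "test_fun_on S f" "open S"
  shows "test_fun_on S (\<lambda>x. c * of_real (t * (v \<bullet> x)) * f x)"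
proof (rule test_fun_on_linear_mult[OF assms])
  show "bounded_linear (\<lambda>x. c * complex_of_real (t * (v \<bullet> x)))"
    by (intro bounded_linear_const_mult bounded_linear_compose[OF bounded_linear_of_real] bounded_linear_inner_right)
qed

text \<open>Compact support replaces the integral by one over a fixed box, where differentiation
  under the integral sign applies. The rule requires the derivative as a continuous function with
  values in bounded linear maps, which is \<open>fx\<close>.\<close>

lemma ft_has_derivative:
  assumes "test_fun_on S f"
  shows "(ft t f has_derivative (\<lambda>v. ft t (\<lambda>x. \<i> * of_real (t * (D v \<bullet> x)) * f x) y)) (at y)"
proof -
  have f: "test_fun_on UNIV f" using test_fun_on_mono[OF assms] by blast
  note cont_f = continuous_test_fun[OF f]
  obtain a where a: "\<And>x. x \<notin> cbox (-a) a \<Longrightarrow> f x = 0"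
    using test_fun_on_cbox[OF f] by blast
  define fx where "fx = (\<lambda>y x. blinfun_scaleR_left (\<i> * of_real t * wave t y x * f x) o\<^sub>L blinfun_inner_left (D x))"
  have fx_apply: "blinfun_apply (fx y x) v = wave t y x * (\<i> * of_real (t * (D v \<bullet> x)) * f x)" for y x v
    unfolding fx_def by (simp add: scaleR_conv_of_real D_sym[of x v] inner_commute[of v] algebra_simps)
  have cont_fx: "continuous_on A (\<lambda>(y, x). fx y x)" for A
  proof -
    have "continuous_on A (\<lambda>p. f (snd p))"
      by (rule continuous_on_compose2[OF cont_f[of UNIV]]) (auto intro!: continuous_intros)
    then show ?thesis
      unfolding fx_def split_beta
      by (intro continuous_intros bounded_linear.continuous_on[OF bounded_linear_blinfun_scaleR_left]
          bounded_linear.continuous_on[OF bounded_linear_blinfun_inner_left])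
  qed
  have "((\<lambda>y. integral (cbox (-a) a) (\<lambda>x. wave t y x * f x)) has_derivative integral (cbox (-a) a) (fx y)) (at y within UNIV)"
  proof (rule leibniz_rule)
    show "((\<lambda>y. wave t y x * f x) has_derivative blinfun_apply (fx y x)) (at y within UNIV)" for y x
    proof -
      have *: "(\<lambda>y. wave t y x) = wave t x" by (simp add: fun_eq_iff wave_def D_sym)
      have "((\<lambda>y. wave t y x) has_derivative (\<lambda>v. \<i> * of_real (t * (D x \<bullet> v)) * wave t x y)) (at y)"
        unfolding * by (rule wave_has_derivative)
      from has_derivative_mult_left[OF this, of "f x"]
      show ?thesis
        by (rule has_derivative_eq_rhs)
           (auto simp: fun_eq_iff fx_apply wave_def D_sym[of x] algebra_simps)
    qed
    show "(\<lambda>x. wave t y x * f x) integrable_on cbox (-a) a" for y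
      by (intro integrable_continuous continuous_intros cont_f)
    show "continuous_on (UNIV \<times> cbox (-a) a) (\<lambda>(y, x). fx y x)" by (rule cont_fx)
  qed auto
  moreover have "integral (cbox (-a) a) (\<lambda>x. wave t y x * f x) = ft t f y" for y
    unfolding ft_def
    by (rule integral_eq_integral_cbox[symmetric]) (auto intro!: continuous_intros cont_f simp: a)
  moreover have "blinfun_apply (integral (cbox (-a) a) (fx y)) = (\<lambda>v. ft t (\<lambda>x. \<i> * of_real (t * (D v \<bullet> x)) * f x) y)"
  proof
    fix v
    have "continuous_on (cbox (-a) a) (fx y)"
    proof -
      have "continuous_on (cbox (-a) a) (\<lambda>x. (y, x))" by (intro continuous_intros)
      from continuous_on_compose2[OF cont_fx[of UNIV] this] show ?thesis by simp
    qed
    then have "fx y integrable_on cbox (-a) a" by (rule integrable_continuous)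
    from blinfun_apply_integral[OF this]
    have "blinfun_apply (integral (cbox (-a) a) (fx y)) v = integral (cbox (-a) a) (\<lambda>x. wave t y x * (\<i> * of_real (t * (D v \<bullet> x)) * f x))"
      by (simp add: fx_apply)
    also have "\<dots> = ft t (\<lambda>x. \<i> * of_real (t * (D v \<bullet> x)) * f x) y"
      unfolding ft_def
      by (rule integral_eq_integral_cbox[symmetric]) (auto intro!: continuous_intros cont_f simp: a)
    finally show "blinfun_apply (integral (cbox (-a) a) (fx y)) v = ft t (\<lambda>x. \<i> * of_real (t * (D v \<bullet> x)) * f x) y" .
  qed
  ultimately show ?thesis by simp
qed

lemma dir_deriv_ft:
  assumes "test_fun_on S f"
  shows "dir_deriv v (ft t f) = ft t (\<lambda>x. \<i> * of_real (t * (D v \<bullet> x)) * f x)"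
  by (rule ext) (rule dir_deriv_eqI[OF ft_has_derivative[OF assms]])

lemma smooth_on_ft:
  assumes "test_fun_on UNIV f" shows "smooth_on S (ft t f)"
proof -
  have "k_smooth_on k UNIV (ft t f)" for k
    using assms
  proof (induction k arbitrary: f)
    case 0
    then show ?case
      unfolding k_smooth_on.simps differentiable_def using ft_has_derivative by blast
  next
    case (Suc k)
    then show ?case
      using ft_has_derivative[OF Suc.prems] test_fun_on_inner_mult[OF Suc.prems]
      by (auto simp: differentiable_def dir_deriv_ft[OF Suc.prems])
  qed
  then show ?thesis unfolding smooth_on_def using k_smooth_on_subset by blast
qed

text \<open>Derivatives of transforms are again transforms of test functions, so bounds proved for
  all such transforms hold for their derivatives as well.\<close>

lemma iter_deriv_ft:
  assumes "test_fun_on UNIV f" shows "\<exists>g. test_fun_on UNIV g \<and> iter_deriv vs (ft t f) = ft t g"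
proof (induction vs)
  case Nil
  then show ?case using assms by (auto simp: iter_deriv_def)
next
  case (Cons v vs)
  then obtain g where g: "test_fun_on UNIV g" "iter_deriv vs (ft t f) = ft t g" by blast
  then have "iter_deriv (v # vs) (ft t f) = dir_deriv v (ft t g)" by (simp add: iter_deriv_def)
  then show ?case
    using dir_deriv_ft[OF g(1)] test_fun_on_inner_mult[OF g(1) open_UNIV] by metis
qed

text \<open>Each further power of \<open>norm y\<close> is paid for by one derivative of
  \<open>f\<close>: as \<open>D\<close> preserves norms, \<open>norm y\<close> is at most the sum of
  the coordinates of \<open>D y\<close> in absolute value, and each of these becomes a directional
  derivative of \<open>f\<close> divided by \<open>t\<close>.\<close>

lemma ft_weighted_bound:
  assumes t: "t \<noteq> 0" and f: "test_fun_on UNIV f"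
  shows "\<exists>C. \<forall>y. (1 + norm y) ^ N * norm (ft t f y) \<le> C"
  using f
proof (induction N arbitrary: f)
  case 0
  show ?case using ft_bound[OF 0] by auto
next
  case (Suc N)
  obtain C0 where C0: "\<And>y. (1 + norm y) ^ N * norm (ft t f y) \<le> C0"
    using Suc.IH[OF Suc.prems] by blast
  have "\<forall>v. \<exists>C. \<forall>y. (1 + norm y) ^ N * norm (ft t (dir_deriv v f) y) \<le> C"
    using Suc.IH[OF test_fun_on_dir_deriv[OF Suc.prems]] by blast
  then obtain C where C: "\<And>v y. (1 + norm y) ^ N * norm (ft t (dir_deriv v f) y) \<le> C v"
    by metis
  have "(1 + norm y) ^ Suc N * norm (ft t f y) \<le> C0 + (\<Sum>v\<in>Basis. C v / \<bar>t\<bar>)" for y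
  proof -
    have "norm y \<le> (\<Sum>v\<in>Basis. \<bar>D y \<bullet> v\<bar>)"
      using norm_le_l1[of "D y"] by (simp add: D_norm)
    then have "norm y * norm (ft t f y) \<le> (\<Sum>v\<in>Basis. \<bar>D y \<bullet> v\<bar>) * norm (ft t f y)"
      by (rule mult_right_mono) simp
    also have "\<dots> = (\<Sum>v\<in>Basis. norm (ft t (dir_deriv v f) y) / \<bar>t\<bar>)"
      using t by (simp add: ft_dir_deriv_fun[OF Suc.prems] norm_mult sum_distrib_right abs_mult)
    finally have "norm (ft t f y) + norm y * norm (ft t f y) \<le> norm (ft t f y) + (\<Sum>v\<in>Basis. norm (ft t (dir_deriv v f) y) / \<bar>t\<bar>)"
      by simp
    then have "(1 + norm y) ^ N * ((1 + norm y) * norm (ft t f y)) \<le>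
        (1 + norm y) ^ N * (norm (ft t f y) + (\<Sum>v\<in>Basis. norm (ft t (dir_deriv v f) y) / \<bar>t\<bar>))"
      by (intro mult_left_mono) (auto simp: algebra_simps)
    also have "\<dots> = (1 + norm y) ^ N * norm (ft t f y) + (\<Sum>v\<in>Basis. (1 + norm y) ^ N * norm (ft t (dir_deriv v f) y) / \<bar>t\<bar>)"
      by (simp add: distrib_left sum_distrib_left)
    also have "\<dots> \<le> C0 + (\<Sum>v\<in>Basis. C v / \<bar>t\<bar>)"
      by (intro add_mono sum_mono divide_right_mono C0 C) auto
    finally show ?thesis by (simp add: mult.assoc mult.left_commute)
  qed
  then show ?case by blast
qed

lemma ft_schwartz:
  assumes "t \<noteq> 0" "test_fun_on UNIV f" shows "ft t f \<in> schwartz"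
proof -
  have "\<exists>C. \<forall>x. (1 + norm x) ^ N * norm (iter_deriv vs (ft t f) x) \<le> C" for N vs
    using iter_deriv_ft[OF assms(2), of vs t] ft_weighted_bound[OF assms(1)] by metis
  then show ?thesis
    unfolding schwartz_def using smooth_on_UNIV_smooth_fun[OF smooth_on_ft[OF assms(2)]] by blast
qed

lemma continuous_ft: "test_fun_on UNIV f \<Longrightarrow> continuous_on S (ft t f)"
  by (rule smooth_on_continuous[OF smooth_on_ft])

lemma integrable_ft:
  assumes "t \<noteq> 0" "test_fun_on UNIV f" shows "integrable lborel (ft t f)"
proof -
  obtain C where C: "\<And>y. (1 + norm y) ^ (2 * DIM('v)) * norm (ft t f y) \<le> C"
    using ft_weighted_bound[OF assms] by blast
  show ?thesis
  proof (rule Bochner_Integration.integrable_bound)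
    show "integrable lborel (\<lambda>y. C * decay y)" by (rule integrable_mult_right) (rule integrable_decay)
    show "ft t f \<in> borel_measurable lborel"
      using borel_measurable_continuous_onI[OF continuous_ft[OF assms(2), of UNIV]] by simp
    show "AE y in lborel. norm (ft t f y) \<le> norm (C * decay y)"
    proof (rule AE_I2)
      fix y :: 'v
      have "(1 + norm y) ^ (2 * DIM('v)) > 0" by (intro zero_less_power add_pos_nonneg) auto
      then have "norm (ft t f y) \<le> C * decay y"
        using C[of y] by (simp add: decay_def field_simps)
      then show "norm (ft t f y) \<le> norm (C * decay y)" by simp
    qed
  qed
qed

section \<open>Fourier inversion up to a constant\<close>

lemma wave_commute: "wave t y x = wave t x y"
  by (simp add: wave_def D_sym)

text \<open>The cutoff \<open>b (r *\<^sub>R y)\<close> makes the double integral behind two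
  successive transforms absolutely convergent. The substitutions
  \<open>z = x - r *\<^sub>R u\<close> and \<open>w = r *\<^sub>R y\<close> produce powers of
  \<open>r\<close> that cancel, and Fubini turns the result into an average of \<open>f\<close> at
  scale \<open>r\<close> around \<open>x\<close>.\<close>

lemma ft_mollified:
  assumes t: "t \<noteq> 0" and b: "test_fun_on UNIV b" and f: "test_fun_on UNIV f" and r: "r > 0"
  shows "(LINT y|lborel. b (r *\<^sub>R y) * (wave t y x * ft (-t) f y)) = (LINT u|lborel. f (x - r *\<^sub>R u) * ft t b u)"
proof -
  let ?d = "DIM('v)"
  note cont = continuous_test_fun[OF b] continuous_test_fun[OF f]
  have cont_f: "continuous_on S (\<lambda>p. f (g p))" if "continuous_on S g" for S and g :: "'w::topological_space \<Rightarrow> 'v"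
    by (rule continuous_on_compose2[OF cont(2)[of UNIV] that]) simp
  have cont_b: "continuous_on S (\<lambda>p. b (g p))" if "continuous_on S g" for S and g :: "'w::topological_space \<Rightarrow> 'v"
    by (rule continuous_on_compose2[OF cont(1)[of UNIV] that]) simp
  have cont_ft: "continuous_on S (\<lambda>p. ft (-t) f (g p))" if "continuous_on S g" for S and g :: "'v \<Rightarrow> 'v"
    by (rule continuous_on_compose2[OF continuous_ft[OF f, of UNIV] that]) simp
  have 1: "wave t y x * ft (-t) f y = r ^ ?d *\<^sub>R (LINT u|lborel. wave t (r *\<^sub>R y) u * f (x - r *\<^sub>R u))" for y
  proof -
    have "wave t y x * ft (-t) f y = (LINT z|lborel. wave t y (x - z) * f z)"
      unfolding ft_def wave_diff by (simp add: mult.assoc)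
    also have "\<dots> = \<bar>-r\<bar> ^ ?d *\<^sub>R (LINT u|lborel. wave t y (x - (x + (-r) *\<^sub>R u)) * f (x + (-r) *\<^sub>R u))"
      using r by (intro integral_affine) (auto intro!: borel_measurable_continuous_onI continuous_intros cont_f)
    finally show ?thesis using r by (simp add: wave_scale)
  qed
  define g where "g = (\<lambda>w. b w * (wave t ((1 / r) *\<^sub>R w) x * ft (-t) f ((1 / r) *\<^sub>R w)))"
  have "(LINT w|lborel. g w) = r ^ ?d *\<^sub>R (LINT y|lborel. b (r *\<^sub>R y) * (wave t y x * ft (-t) f y))"
  proof -
    have "(LINT w|lborel. g w) = \<bar>r\<bar> ^ ?d *\<^sub>R (LINT y|lborel. g (0 + r *\<^sub>R y))"
      unfolding g_def using r
      by (intro integral_affine) (auto intro!: borel_measurable_continuous_onI continuous_intros cont_b cont_ft)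
    then show ?thesis using r by (simp add: g_def)
  qed
  moreover have "g w = r ^ ?d *\<^sub>R (LINT u|lborel. b w * (wave t w u * f (x - r *\<^sub>R u)))" for w
    unfolding g_def 1 using r by simp
  ultimately have 2: "(LINT y|lborel. b (r *\<^sub>R y) * (wave t y x * ft (-t) f y)) =
      (LINT w|lborel. LINT u|lborel. b w * (wave t w u * f (x - r *\<^sub>R u)))"
    using r by simp
  obtain K where K: "compact K" "\<And>x. x \<notin> K \<Longrightarrow> b x = 0"
    using b unfolding test_fun_on_def by blast
  obtain L where L: "compact L" "\<And>x. x \<notin> L \<Longrightarrow> f x = 0"
    using f unfolding test_fun_on_def by blast
  let ?L = "(\<lambda>z. (1 / r) *\<^sub>R (x - z)) ` L"
  have "integrable lborel (\<lambda>p. b (snd p) * (wave t (snd p) (fst p) * f (x - r *\<^sub>R fst p)))"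
  proof (rule integrable_continuous_compact_support(1))
    show "compact (?L \<times> K)" by (intro compact_Times compact_continuous_image continuous_intros K L)
    show "b (snd p) * (wave t (snd p) (fst p) * f (x - r *\<^sub>R fst p)) = 0" if "p \<notin> ?L \<times> K" for p
    proof (cases "snd p \<in> K")
      case True
      then have "fst p \<notin> ?L" using that by (auto simp: mem_Times_iff)
      moreover have "fst p = (1 / r) *\<^sub>R (x - (x - r *\<^sub>R fst p))" using r by simp
      ultimately have "x - r *\<^sub>R fst p \<notin> L" by blast
      then show ?thesis using L by simp
    qed (use K in simp)
    show "continuous_on UNIV (\<lambda>p. b (snd p) * (wave t (snd p) (fst p) * f (x - r *\<^sub>R fst p)))"
      by (intro continuous_intros cont_b cont_f)
  qed
  then have "integrable (lborel \<Otimes>\<^sub>M lborel) (case_prod (\<lambda>u w. b w * (wave t w u * f (x - r *\<^sub>R u))))"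
    unfolding lborel_prod by (simp add: case_prod_unfold)
  from lborel_pair.Fubini_integral[OF this]
  have "(LINT w|lborel. LINT u|lborel. b w * (wave t w u * f (x - r *\<^sub>R u))) =
      (LINT u|lborel. LINT w|lborel. f (x - r *\<^sub>R u) * (wave t u w * b w))"
    by (simp add: wave_commute mult_ac)
  with 2 show ?thesis by (simp add: ft_def)
qed

text \<open>Let \<open>r\<close> tend to 0 in the mollified identity: the cutoff tends to the
  constant \<open>b 0\<close>, the shifted argument of \<open>f\<close> to \<open>x\<close>, and the
  transforms are integrable majorants up to constants.\<close>

lemma ft_ft:
  assumes t: "t \<noteq> 0" and b: "test_fun_on UNIV b" and f: "test_fun_on UNIV f"
  shows "b 0 * ft t (ft (-t) f) x = f x * (LINT u|lborel. ft t b u)"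
proof -
  define r where "r = (\<lambda>n. 1 / real (Suc n))"
  have r: "r n > 0" "r \<longlonglongrightarrow> 0" for n
    unfolding r_def using LIMSEQ_inverse_real_of_nat by (simp_all add: inverse_eq_divide)
  have t': "- t \<noteq> 0" using t by simp
  note cont = continuous_test_fun[OF b, of UNIV] continuous_test_fun[OF f, of UNIV]
  obtain B where B: "\<And>x. norm (b x) \<le> B" using test_fun_weighted_bound[OF b, of 0] by auto
  obtain C where C: "\<And>x. norm (f x) \<le> C" using test_fun_weighted_bound[OF f, of 0] by auto
  have lim_b: "(\<lambda>n. b (r n *\<^sub>R y)) \<longlonglongrightarrow> b 0" for y
  proof -
    have "(\<lambda>n. r n *\<^sub>R y) \<longlonglongrightarrow> 0 *\<^sub>R y" by (intro tendsto_intros r)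
    then show ?thesis using cont(1) by (intro isCont_tendsto_compose[of 0 b]) (auto simp: continuous_on_eq_continuous_at)
  qed
  have lim_f: "(\<lambda>n. f (x - r n *\<^sub>R u)) \<longlonglongrightarrow> f x" for u
  proof -
    have "(\<lambda>n. x - r n *\<^sub>R u) \<longlonglongrightarrow> x - 0 *\<^sub>R u" by (intro tendsto_intros r)
    then show ?thesis using cont(2) by (intro isCont_tendsto_compose[of x f]) (auto simp: continuous_on_eq_continuous_at)
  qed
  have ft_meas: "ft (-t) f \<in> borel_measurable borel" "ft t b \<in> borel_measurable borel"
    by (intro borel_measurable_continuous_onI continuous_ft b f)+
  have bf_meas: "(\<lambda>y. b (c *\<^sub>R y)) \<in> borel_measurable borel" "(\<lambda>u. f (x - c *\<^sub>R u)) \<in> borel_measurable borel"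
      "wave t y \<in> borel_measurable borel" "(\<lambda>y. wave t y x) \<in> borel_measurable borel" for c y
    by (intro borel_measurable_continuous_onI continuous_intros continuous_on_compose2[OF cont(1)] continuous_on_compose2[OF cont(2)]; simp)+
  have "(\<lambda>n. LINT y|lborel. b (r n *\<^sub>R y) * (wave t y x * ft (-t) f y)) \<longlonglongrightarrow> (LINT y|lborel. b 0 * (wave t y x * ft (-t) f y))"
  proof (rule integral_dominated_convergence[where w="\<lambda>y. B * norm (ft (-t) f y)"])
    show "integrable lborel (\<lambda>y. B * norm (ft (-t) f y))"
      by (intro integrable_mult_right integrable_norm integrable_ft t' f)
    show "AE y in lborel. (\<lambda>n. b (r n *\<^sub>R y) * (wave t y x * ft (-t) f y)) \<longlonglongrightarrow> b 0 * (wave t y x * ft (-t) f y)"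
      by (intro AE_I2 tendsto_intros lim_b)
    show "AE y in lborel. norm (b (r n *\<^sub>R y) * (wave t y x * ft (-t) f y)) \<le> B * norm (ft (-t) f y)" for n
      by (intro AE_I2) (simp add: norm_mult mult_right_mono B)
  qed (use ft_meas bf_meas in auto)
  moreover have "(\<lambda>n. LINT u|lborel. f (x - r n *\<^sub>R u) * ft t b u) \<longlonglongrightarrow> (LINT u|lborel. f x * ft t b u)"
  proof (rule integral_dominated_convergence[where w="\<lambda>u. C * norm (ft t b u)"])
    show "integrable lborel (\<lambda>u. C * norm (ft t b u))"
      by (intro integrable_mult_right integrable_norm integrable_ft t b)
    show "AE u in lborel. (\<lambda>n. f (x - r n *\<^sub>R u) * ft t b u) \<longlonglongrightarrow> f x * ft t b u"
      by (intro AE_I2 tendsto_intros lim_f)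
    show "AE u in lborel. norm (f (x - r n *\<^sub>R u) * ft t b u) \<le> C * norm (ft t b u)" for n
      by (intro AE_I2) (simp add: norm_mult mult_right_mono C)
  qed (use ft_meas bf_meas in auto)
  ultimately have "(LINT y|lborel. b 0 * (wave t y x * ft (-t) f y)) = (LINT u|lborel. f x * ft t b u)"
    unfolding ft_mollified[OF t b f r(1)] by (rule LIMSEQ_unique)
  then show ?thesis by (simp add: ft_def[of t "ft (-t) f"] wave_commute[of t x])
qed

text \<open>The constant is left as a quotient depending on an auxiliary bump function. It will
  multiply a quantity to be proved zero, so its being nonzero is the point.\<close>

theorem ft_inversion:
  assumes t: "t \<noteq> 0"
  shows "\<exists>\<kappa>. \<kappa> \<noteq> 0 \<and> (\<forall>f x. test_fun_on UNIV f \<longrightarrow> ft t (ft (-t) f) x = \<kappa> * f x)"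
proof -
  obtain \<eta> :: "'v \<Rightarrow> real" where \<eta>: "test_fun_on UNIV (\<lambda>x. complex_of_real (\<eta> x))" "\<And>x. \<eta> x \<ge> 0" "\<eta> 0 > 0"
    using ex_bump[of 1 "0::'v"] by (metis centre_in_ball zero_less_one)
  define b where "b = (\<lambda>x. complex_of_real (\<eta> x))"
  have b: "test_fun_on UNIV b" "b 0 \<noteq> 0" using \<eta> by (auto simp: b_def)
  define I where "I = (LINT u|lborel. ft t b u)"
  have eq: "ft t (ft (-t) f) x = I / b 0 * f x" if "test_fun_on UNIV f" for f x
    using ft_ft[OF t b(1) that, of x] b(2) by (simp add: I_def field_simps)
  have zeroI: "f x = 0" if "continuous_on UNIV f" "AE x in lborel. f x = 0" for f :: "'v \<Rightarrow> real" and x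
    using mem_closed_if_AE_lebesgue[OF closed_Collect_eq[OF that(1) continuous_on_const], of 0 x] AE_completion[OF that(2)]
    by simp
  \<comment> \<open>If the constant vanished, so would the squared norm of the transform of a bump function.\<close>
  have "I \<noteq> 0"
  proof
    assume "I = 0"
    define \<phi> where "\<phi> = ft (-t) b"
    have t': "- t \<noteq> 0" using t by simp
    have \<phi>: "integrable lborel \<phi>" "continuous_on UNIV \<phi>"
      unfolding \<phi>_def by (rule integrable_ft[OF t' b(1)] continuous_ft[OF b(1)])+
    have \<phi>_cont: "continuous_on S (\<lambda>p. \<phi> (g p))" if "continuous_on S g" for S and g :: "'v \<times> 'v \<Rightarrow> 'v"
      by (rule continuous_on_compose2[OF \<phi>(2) that]) simp
    have b_cont: "continuous_on S (\<lambda>p. b (g p))" if "continuous_on S g" for S and g :: "'v \<times> 'v \<Rightarrow> 'v"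
      by (rule continuous_on_compose2[OF continuous_test_fun[OF b(1), of UNIV] that]) simp
    \<comment> \<open>As \<open>b\<close> is real, conjugation changes the sign of the parameter.
      Fubini then rewrites the integral of \<open>(norm (\<phi> y))\<^sup>2\<close> as the integral
      of \<open>b x * ft t \<phi> x\<close>, where a vanishing constant would make the second factor
      zero. At the origin \<phi> is the integral of the bump, which is positive.\<close>
    have "cnj (\<phi> y) = ft t b y" for y
      unfolding \<phi>_def ft_def
      by (subst integral_bounded_linear[OF bounded_linear_cnj integrable_wave_test[OF b(1)], symmetric])
         (simp add: cnj_wave b_def)
    then have "complex_of_real ((norm (\<phi> y))\<^sup>2) = \<phi> y * ft t b y" for y
      by (simp only: complex_norm_square)
    also have "\<phi> y * ft t b y = (LINT x|lborel. \<phi> y * (wave t y x * b x))" for y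
      unfolding ft_def by (rule integral_mult_right_zero[symmetric])
    also have "(LINT x|lborel. \<phi> y * (wave t y x * b x)) = (LINT x|lborel. b x * (wave t x y * \<phi> y))" for y
      by (simp add: mult_ac wave_commute[of t y])
    finally have "(LINT y|lborel. complex_of_real ((norm (\<phi> y))\<^sup>2)) = (LINT y|lborel. LINT x|lborel. b x * (wave t x y * \<phi> y))"
      by (simp only:)
    also have "\<dots> = (LINT x|lborel. LINT y|lborel. b x * (wave t x y * \<phi> y))"
    proof (rule lborel_pair.Fubini_integral, rule lborel_pair.Fubini_integrable)
      have "continuous_on UNIV (\<lambda>(x, y). b x * (wave t x y * \<phi> y))"
        unfolding split_beta by (intro continuous_intros \<phi>_cont b_cont)
      then show "(\<lambda>(x, y). b x * (wave t x y * \<phi> y)) \<in> borel_measurable (lborel \<Otimes>\<^sub>M lborel)"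
        unfolding lborel_prod by (auto intro: borel_measurable_continuous_onI)
      have "integrable lborel b"
        using integrable_wave_test[OF b(1), of t 0] by simp
      then show "integrable lborel (\<lambda>x. LINT y|lborel. norm (case (x, y) of (x, y) \<Rightarrow> b x * (wave t x y * \<phi> y)))"
        by (simp add: norm_mult)
      show "AE x in lborel. integrable lborel (\<lambda>y. case (x, y) of (x, y) \<Rightarrow> b x * (wave t x y * \<phi> y))"
      proof (rule AE_I2)
        fix x
        have "integrable lborel (\<lambda>y. wave t x y * \<phi> y)"
          by (rule Bochner_Integration.integrable_bound[OF \<phi>(1)])
             (auto simp: norm_mult intro!: borel_measurable_continuous_onI continuous_intros \<phi>(2))
        then show "integrable lborel (\<lambda>y. case (x, y) of (x, y) \<Rightarrow> b x * (wave t x y * \<phi> y))"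
          by simp
      qed
    qed
    also have "\<dots> = (LINT x|lborel. b x * ft t \<phi> x)" by (simp add: ft_def)
    also have "\<dots> = 0" using eq[OF b(1)] \<open>I = 0\<close> by (simp add: \<phi>_def)
    finally have "(LINT y|lborel. (norm (\<phi> y))\<^sup>2) = 0"
      by (simp only: integral_complex_of_real of_real_eq_0_iff)
    moreover have "integrable lborel (\<lambda>y. (norm (\<phi> y))\<^sup>2)"
    proof (rule Bochner_Integration.integrable_bound)
      show "integrable lborel (\<lambda>y. (LINT x|lborel. norm (b x)) * norm (\<phi> y))"
        by (intro integrable_mult_right integrable_norm \<phi>)
      show "AE y in lborel. norm ((norm (\<phi> y))\<^sup>2) \<le> norm ((LINT x|lborel. norm (b x)) * norm (\<phi> y))"
        using ft_bound[OF b(1)]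
        by (intro AE_I2) (auto simp: \<phi>_def power2_eq_square abs_mult intro!: mult_right_mono order_trans[OF _ abs_ge_self])
      show "(\<lambda>y. (norm (\<phi> y))\<^sup>2) \<in> borel_measurable lborel"
        by (auto intro!: borel_measurable_continuous_onI continuous_intros \<phi>(2))
    qed
    ultimately have "AE y in lborel. (norm (\<phi> y))\<^sup>2 = 0"
      by (subst (asm) integral_nonneg_eq_0_iff_AE) auto
    then have "(norm (\<phi> 0))\<^sup>2 = 0"
      by (intro zeroI[of "\<lambda>y. (norm (\<phi> y))\<^sup>2"] continuous_intros \<phi>(2))
    then have "(LINT x|lborel. b x) = 0" by (simp add: \<phi>_def ft_def)
    then have "(LINT x|lborel. \<eta> x) = 0"
      unfolding b_def by (simp only: integral_complex_of_real of_real_eq_0_iff)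
    moreover have "integrable lborel \<eta>"
      using integrable_wave_test[OF b(1), of t 0] by (simp add: b_def complex_of_real_integrable_eq)
    ultimately have "AE x in lborel. \<eta> x = 0"
      by (subst (asm) integral_nonneg_eq_0_iff_AE) (use \<eta>(2) in auto)
    moreover have "continuous_on UNIV \<eta>"
      using continuous_on_Re[OF continuous_test_fun[OF \<eta>(1), of UNIV]] by simp
    ultimately have "\<eta> 0 = 0" by (rule zeroI[rotated])
    then show False using \<eta>(3) by simp
  qed
  with eq b(2) show ?thesis by (intro exI[of _ "I / b 0"]) simp
qed

end

subsection \<open>The ground field inside the complex numbers\<close>

locale field_embedding =
  fixes h :: "'f::real_or_complex \<Rightarrow> complex"
  assumes h_add: "h (x + y) = h x + h y" and h_mult: "h (x * y) = h x * h y"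
    and h_norm: "norm (h x) = norm x" and h_range: "range h = \<real> \<or> range h = UNIV"
begin

lemma h_0 [simp]: "h 0 = 0"
  using h_add[of 0 0] by simp

lemma h_diff: "h (x - y) = h x - h y"
  using h_add[of "x - y" y] by simp

lemma h_eq_iff [simp]: "h x = h y \<longleftrightarrow> x = y"
  using h_norm[of "x - y"] by (auto simp: h_diff)

lemma h_1 [simp]: "h 1 = 1"
proof -
  have "h 1 * h 1 = h 1" using h_mult[of 1 1] by simp
  then show ?thesis using h_eq_iff[of 1 0] by simp
qed

text \<open>Real homogeneity is not an axiom of the embedding. The image of a real number
  \<open>r\<close> is determined by its distances from 0 and 1, both of which \<open>h\<close>
  preserves.\<close>

lemma h_of_real [simp]: "h (of_real r) = of_real r"
proof -
  let ?z = "h (of_real r)"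
  have "h (of_real r - 1) = ?z - 1" by (simp only: h_diff h_1)
  moreover have "norm (of_real r - 1 :: 'f) = \<bar>r - 1\<bar>"
    by (metis norm_of_real of_real_1 of_real_diff)
  ultimately have "norm ?z = \<bar>r\<bar>" "norm (?z - 1) = \<bar>r - 1\<bar>"
    using h_norm[of "of_real r"] h_norm[of "of_real r - 1"] by simp_all
  then have "(Re ?z)\<^sup>2 + (Im ?z)\<^sup>2 = r\<^sup>2" "(Re ?z - 1)\<^sup>2 + (Im ?z)\<^sup>2 = (r - 1)\<^sup>2"
    using cmod_power2[of ?z] cmod_power2[of "?z - 1"] by simp_all
  then have "Re ?z = r" by (simp add: power2_diff)
  moreover from this \<open>(Re ?z)\<^sup>2 + (Im ?z)\<^sup>2 = r\<^sup>2\<close> have "Im ?z = 0" by simp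
  ultimately show ?thesis by (simp add: complex_eq_iff)
qed

lemma h_eq_0_iff [simp]: "h x = 0 \<longleftrightarrow> x = 0"
  using h_eq_iff[of x 0] by simp

lemma h_bounded_linear: "bounded_linear h"
  by (rule bounded_linear_intro[of _ 1])
     (simp_all add: h_add h_norm h_mult scaleR_conv_of_real)

lemma h_divide: "h (x / y) = h x / h y"
  by (cases "y = 0") (simp_all add: field_simps flip: h_mult)

lemma h_power: "h (x ^ n) = h x ^ n"
  by (induction n) (simp_all add: h_mult)

lemma h_exp: "h (exp x) = exp (h x)"
proof -
  have "h (x ^ n /\<^sub>R fact n) = h x ^ n /\<^sub>R fact n" for n
    by (simp add: linear_scale[OF bounded_linear.linear[OF h_bounded_linear]] h_power)
  then show ?thesis
    unfolding exp_def using bounded_linear.suminf[OF h_bounded_linear summable_exp_generic[of x]] by simp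
qed

text \<open>This pulls functions of a complex variable, in particular the logarithm, back to the
  field. It is the real part in one case and the inverse of \<open>h\<close> in the other.\<close>

lemma ex_left_inverse:
  obtains \<pi> :: "complex \<Rightarrow> 'f" where "bounded_linear \<pi>" "\<And>x. \<pi> (h x) = x"
    "\<And>w. w \<in> range h \<Longrightarrow> h (\<pi> w) = w"
proof (rule disjE[OF h_range])
  assume R: "range h = \<real>"
  show thesis
  proof (rule that[of "\<lambda>w. of_real (Re w)"])
    show "bounded_linear (\<lambda>w. of_real (Re w) :: 'f)"
      by (intro bounded_linear_compose[OF bounded_linear_of_real] bounded_linear_Re)
    show inv: "of_real (Re (h x)) = x" for x
    proof -
      have "h x \<in> \<real>" using R by auto
      then have "h (of_real (Re (h x))) = h x" by simp
      then show ?thesis by (simp only: h_eq_iff)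
    qed
    show "h (of_real (Re w)) = w" if "w \<in> range h" for w
      using that R by simp
  qed
next
  assume R: "range h = UNIV"
  have inv: "h (inv h w) = w" for w using R by (simp add: f_inv_into_f)
  show thesis
  proof (rule that[of "inv h"])
    show "bounded_linear (inv h)"
    proof (rule bounded_linear_intro[of _ 1])
      show "inv h (x + y) = inv h x + inv h y" for x y
        by (subst h_eq_iff[symmetric], simp only: h_add inv)
      show "inv h (r *\<^sub>R x) = r *\<^sub>R inv h x" for r x
        by (subst h_eq_iff[symmetric], simp add: linear_scale[OF bounded_linear.linear[OF h_bounded_linear]] inv)
      show "norm (inv h x) \<le> norm x * 1" for x
        using h_norm[of "inv h x"] by (simp add: inv)
    qed
  qed (use inv in \<open>auto simp: inv_f_eq inj_def\<close>)
qed

text \<open>By polarization the norm determines the inner product, and \<open>h\<close> preserves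
  norms.\<close>

lemma inner_eq: "x \<bullet> y = Re (h x * cnj (h y))"
proof -
  have "x \<bullet> y = h x \<bullet> h y"
    by (simp add: dot_norm h_norm flip: h_add)
  then show ?thesis by (simp add: inner_complex_def)
qed

text \<open>The isometry is coordinatewise complex conjugation, transported to \<open>F\<close>.\<close>

lemma ex_dual_isometry:
  obtains D :: "'f ^ 'n \<Rightarrow> 'f ^ 'n" where "symmetric_isometry D"
    "\<And>x y. D y \<bullet> x = Re (h (scalar_product y x))"
proof -
  have "\<exists>q. h q = cnj (h p)" for p
  proof -
    have "cnj (h p) \<in> range h" using h_range Reals_cnj_iff by fastforce
    then show ?thesis by (metis imageE)
  qed
  then obtain c where c: "\<And>p. h (c p) = cnj (h p)" by metis
  have c_norm: "norm (c p) = norm p" for p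
    using h_norm[of "c p"] by (simp add: c h_norm)
  define D where "D = (\<lambda>y::'f^'n. \<chi> i. c (y $ i))"
  have *: "D y \<bullet> x = Re (h (scalar_product y x))" for x y
    by (simp add: inner_vec_def inner_eq D_def c scalar_product_def linear_sum[OF bounded_linear.linear[OF h_bounded_linear]] h_mult)
  have "norm (D y) = norm y" for y
    by (simp add: norm_vec_def D_def c_norm)
  then have "symmetric_isometry D"
    by unfold_locales (auto simp: * scalar_product_commute)
  with * show thesis using that by blast
qed

lemma ex_wirtinger:
  obtains J k1 k2 c0 where "c0 \<noteq> 0" "\<And>q. k1 * of_real (Re (h q)) + k2 * of_real (Re (h (J * q))) = c0 * h q"
    "\<And>q. k1 * h q + k2 * h (J * q) = h q"
    "\<And>l :: 'f \<Rightarrow> complex. bounded_linear l \<Longrightarrow> \<exists>\<sigma>. \<forall>q. k1 * l q + k2 * l (J * q) = \<sigma> * h q"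
proof (rule disjE[OF h_range])
  assume R: "range h = \<real>"
  have re: "of_real (Re (h x)) = h x" for x
    using R of_real_Re[of "h x"] by blast
  \<comment> \<open>Over \<real> the derivative along 1 suffices: the second direction has weight 0,
    \<open>J = 1\<close> is a placeholder, and \<open>c0 = 1\<close>.\<close>
  show thesis
  proof (rule that[of 1 1 0 1])
    show "\<exists>\<sigma>. \<forall>q. 1 * l q + 0 * l (1 * q) = \<sigma> * h q" if l: "bounded_linear l" for l
    proof (intro exI[of _ "l 1"] allI)
      fix q
      have "of_real (Re (h q)) = q" using re[of q] by (simp only: h_of_real[symmetric] h_eq_iff)
      then have "q = Re (h q) *\<^sub>R 1" by (simp add: scaleR_conv_of_real)
      then have "l q = Re (h q) *\<^sub>R l 1" using linear_scale[OF bounded_linear.linear[OF l]] by metis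
      then show "1 * l q + 0 * l (1 * q) = l 1 * h q" by (simp add: scaleR_conv_of_real re)
    qed
  qed (auto simp: re)
next
  assume R: "range h = UNIV"
  then obtain J where J: "h J = \<i>" by (metis UNIV_I imageE)
  have q_eq: "q = Re (h q) *\<^sub>R 1 + Im (h q) *\<^sub>R J" for q
  proof -
    have "h q = h (Re (h q) *\<^sub>R 1 + Im (h q) *\<^sub>R J)"
      by (simp add: h_add scaleR_conv_of_real h_mult J complex_eq_iff)
    then show ?thesis by (simp only: h_eq_iff)
  qed
  have Jq_eq: "J * q = - Im (h q) *\<^sub>R 1 + Re (h q) *\<^sub>R J" for q
    using q_eq[of "J * q"] by (simp add: h_mult J)
  show thesis
  \<comment> \<open>Over \<complex> the value \<open>c0 = 1/2\<close> is the Wirtinger derivative of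
    the real part of the coordinate.\<close>
  proof (rule that[of "1/2" "1/2" "- \<i> / 2" J])
    show "1 / 2 * of_real (Re (h q)) + - \<i> / 2 * of_real (Re (h (J * q))) = 1 / 2 * h q" for q
      by (simp add: h_mult J complex_eq_iff)
    show "1 / 2 * h q + - \<i> / 2 * h (J * q) = h q" for q
      by (simp add: h_mult J)
    show "\<exists>\<sigma>. \<forall>q. 1 / 2 * l q + - \<i> / 2 * l (J * q) = \<sigma> * h q" if l: "bounded_linear l" for l
    proof (intro exI[of _ "(l 1 - \<i> * l J) / 2"] allI)
      fix q
      have lin: "l (a *\<^sub>R 1 + b *\<^sub>R J) = of_real a * l 1 + of_real b * l J" for a b
        by (simp only: linear_add[OF bounded_linear.linear[OF l]] linear_scale[OF bounded_linear.linear[OF l]] scaleR_conv_of_real[where 'a=complex])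
      let ?x = "complex_of_real (Re (h q))" and ?y = "complex_of_real (Im (h q))"
      have "l q = ?x * l 1 + ?y * l J"
        by (subst q_eq[of q]) (rule lin)
      moreover have "l (J * q) = of_real (- Im (h q)) * l 1 + ?x * l J"
        unfolding Jq_eq by (rule lin)
      ultimately have "1 / 2 * l q + - \<i> / 2 * l (J * q) = 1 / 2 * (?x * l 1 + ?y * l J) + - \<i> / 2 * (of_real (- Im (h q)) * l 1 + ?x * l J)"
        by (simp only:)
      also have "\<dots> = (l 1 - \<i> * l J) / 2 * (?x + \<i> * ?y)"
        by (simp add: field_simps)
      also have "?x + \<i> * ?y = h q" by (simp add: complex_eq_iff)
      finally show "1 / 2 * l q + - \<i> / 2 * l (J * q) = (l 1 - \<i> * l J) / 2 * h q" .
    qed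
  qed auto
qed

end

subsection \<open>Multiplicative characters\<close>

text \<open>Averaging gains regularity. For small \<open>a\<close> the integral \<open>c\<close> of
  \<open>g\<close> over \<open>{0..a}\<close> is nonzero because \<open>g\<close> is near 1 there,
  and the functional equation expresses \<open>g r\<close> as a difference of values of the
  antiderivative \<open>F\<close>, divided by \<open>c\<close>. So \<open>g\<close> is
  differentiable and solves a linear differential equation. The antiderivative starts at -2 to lie
  safely below every \<open>r\<close> in use.\<close>

lemma continuous_exponential_law:
  fixes g :: "real \<Rightarrow> complex"
  assumes cont: "continuous_on UNIV g" and add: "\<And>r s. g (r + s) = g r * g s" and one: "g 0 = 1"
  obtains \<alpha> where "\<And>r. g r = exp (of_real r * \<alpha>)"
proof -
  note cont' = continuous_on_subset[OF cont subset_UNIV]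
  note int = integrable_continuous_real[OF cont']
  have "isCont g 0" using cont by (simp add: continuous_on_eq_continuous_at)
  then obtain d where d: "d > 0" "\<And>r. \<bar>r\<bar> < d \<Longrightarrow> norm (g r - 1) < 1 / 2"
    unfolding continuous_at_eps_delta using one by (force simp: dist_norm elim: allE[of _ "1 / 2"])
  define a where "a = min (d / 2) 1"
  have a: "0 < a" "a \<le> 1" "a < d" using d(1) by (auto simp: a_def)
  define c where "c = integral {0..a} g"
  have "c \<noteq> 0"
  proof
    assume "c = 0"
    have "norm (integral {0..a} (\<lambda>u. g u - 1)) \<le> (1 / 2) * (a - 0)"
    proof (rule integral_bound)
      show "continuous_on {0..a} (\<lambda>u. g u - 1)" by (intro continuous_intros cont')
      show "norm (g u - 1) \<le> 1 / 2" if "u \<in> {0..a}" for u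
        using d(2)[of u] that a by auto
    qed (use a in auto)
    moreover have "integral {0..a} (\<lambda>u. g u - 1) = c - of_real a"
      using a by (subst Henstock_Kurzweil_Integration.integral_diff) (auto intro: int simp: c_def scaleR_conv_of_real)
    ultimately show False using \<open>c = 0\<close> a by simp
  qed
  define F where "F = (\<lambda>r. integral {-2..r} g)"
  have F: "(F has_vector_derivative g r) (at r)" if "-2 < r" "r < 4" for r
    using integral_has_vector_derivative[OF cont', of r "-2" 4] that
    by (simp add: F_def at_within_Icc_at)
  have g_eq: "g r = (F (r + a) - F r) / c" if "-1 < r" "r < 1" for r
  proof -
    have "g r * c = integral {0..a} (\<lambda>u. g (u + r))"
      unfolding c_def by (subst integral_mult_right[symmetric]) (simp add: add mult.commute)
    also have "\<dots> = integral {r - r..(r + a) - r} (\<lambda>u. g (u + r))" by simp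
    also have "\<dots> = integral {r..r + a} g" by (rule integral_shift_real_ivl)
    also have "integral {-2..r} g + integral {r..r + a} g = integral {-2..r + a} g"
      by (rule Henstock_Kurzweil_Integration.integral_combine) (use that a int in auto)
    then have "integral {r..r + a} g = F (r + a) - F r" by (simp add: F_def algebra_simps)
    finally show ?thesis using \<open>c \<noteq> 0\<close> by (simp add: field_simps)
  qed
  define \<alpha> where "\<alpha> = (g a - g 0) / c"
  have g0: "(g has_vector_derivative \<alpha>) (at 0)"
  proof (rule has_vector_derivative_transform_within_open[of _ _ _ "{-1<..<1}"])
    have "((\<lambda>r. r + a) has_vector_derivative 1) (at 0)"
      by (auto intro!: derivative_eq_intros)
    from vector_diff_chain_at[OF this, of F "g a"] F[of a] a
    have "((\<lambda>r. F (r + a)) has_vector_derivative g a) (at 0)"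
      by (simp add: o_def)
    from has_vector_derivative_diff[OF this F[of 0]]
    have "((\<lambda>r. F (r + a) - F r) has_vector_derivative (g a - g 0)) (at 0)" by simp
    from has_vector_derivative_mult_left[OF this, of "1 / c"]
    show "((\<lambda>r. (F (r + a) - F r) / c) has_vector_derivative \<alpha>) (at 0)" by (simp add: \<alpha>_def)
  qed (use g_eq in auto)
  have g': "(g has_vector_derivative g r * \<alpha>) (at r)" for r
  proof -
    have "((\<lambda>s. g (s - r)) has_vector_derivative \<alpha>) (at r)"
    proof -
      have "((\<lambda>s. s - r) has_vector_derivative 1) (at r)"
        by (auto intro!: derivative_eq_intros)
      from vector_diff_chain_at[OF this, of g \<alpha>] g0 show ?thesis by (simp add: o_def)
    qed
    from has_vector_derivative_mult_right[OF this, of "g r"]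
    show ?thesis by (simp flip: add)
  qed
  have "((\<lambda>r. g r * exp (- of_real r * \<alpha>)) has_vector_derivative 0) (at r)" for r
  proof -
    have "((\<lambda>r. exp (- of_real r * \<alpha>)) has_vector_derivative - \<alpha> * exp (- of_real r * \<alpha>)) (at r)"
      by (rule has_vector_derivative_real_field[of "\<lambda>z. exp (- z * \<alpha>)"]) (auto intro!: derivative_eq_intros)
    from has_vector_derivative_mult[OF g'[of r] this] show ?thesis by (simp add: algebra_simps)
  qed
  then have "g r * exp (- of_real r * \<alpha>) = g 0 * exp (- of_real 0 * \<alpha>)" for r
    by (intro has_derivative_zero_unique[of UNIV "\<lambda>r. g r * exp (- of_real r * \<alpha>)"])
       (auto simp: has_vector_derivative_def)
  then have "g r = exp (of_real r * \<alpha>)" for r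
    using one by (simp add: exp_minus field_simps)
  then show thesis using that by blast
qed

lemma multiplicative_char_mult:
  "multiplicative_char \<xi> \<Longrightarrow> x \<noteq> 0 \<Longrightarrow> y \<noteq> 0 \<Longrightarrow> \<xi> (x * y) = \<xi> x * \<xi> y"
  unfolding multiplicative_char_def by blast

lemma multiplicative_char_one:
  assumes "multiplicative_char \<xi>" shows "\<xi> 1 = 1"
proof -
  have "\<xi> 1 * \<xi> 1 = \<xi> 1" "\<xi> 1 \<noteq> 0"
    using assms unfolding multiplicative_char_def by (metis mult_1 zero_neq_one)+
  then show ?thesis by simp
qed

text \<open>Along each basis direction the character composed with \<open>exp\<close> is a
  continuous one-parameter exponential; multiplicativity assembles the exponents. The map
  \<open>l\<close> is linear over \<real> but in general not over \<complex>.\<close>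

lemma multiplicative_char_exp:
  fixes \<xi> :: "'f::real_or_complex \<Rightarrow> complex"
  assumes \<xi>: "multiplicative_char \<xi>"
  obtains l where "bounded_linear l" "\<And>u. \<xi> (exp u) = exp (l u)"
proof -
  note mult = multiplicative_char_mult[OF \<xi>]
  have "\<exists>\<alpha>. \<forall>r. \<xi> (exp (r *\<^sub>R b)) = exp (of_real r * \<alpha>)" for b :: 'f
  proof -
    have "continuous_on UNIV (\<lambda>r. \<xi> (exp (r *\<^sub>R b)))"
      using \<xi> unfolding multiplicative_char_def
      by (intro continuous_on_compose2[of "- {0}" \<xi> _ "\<lambda>r. exp (r *\<^sub>R b)"]) (auto intro!: continuous_intros)
    moreover have "\<xi> (exp ((r + s) *\<^sub>R b)) = \<xi> (exp (r *\<^sub>R b)) * \<xi> (exp (s *\<^sub>R b))" for r s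
      by (simp add: scaleR_add_left exp_add mult)
    ultimately obtain \<alpha> where "\<And>r. \<xi> (exp (r *\<^sub>R b)) = exp (of_real r * \<alpha>)"
      by (rule continuous_exponential_law) (auto simp: multiplicative_char_one[OF \<xi>])
    then show ?thesis by blast
  qed
  then obtain \<alpha> where \<alpha>: "\<And>b r. \<xi> (exp (r *\<^sub>R b)) = exp (of_real r * \<alpha> b)" by metis
  have sum: "\<xi> (exp (\<Sum>b\<in>B. (u \<bullet> b) *\<^sub>R b)) = exp (\<Sum>b\<in>B. of_real (u \<bullet> b) * \<alpha> b)" if "finite B" for u B
    using that by (induction B rule: finite_induct) (auto simp: multiplicative_char_one[OF \<xi>] exp_add mult \<alpha>)
  show thesis
  proof (rule that[of "\<lambda>u. \<Sum>b\<in>Basis. of_real (u \<bullet> b) * \<alpha> b"])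
    show "bounded_linear (\<lambda>u::'f. \<Sum>b\<in>Basis. of_real (u \<bullet> b) * \<alpha> b)"
      by (intro bounded_linear_sum bounded_linear_mult_const bounded_linear_compose[OF bounded_linear_of_real]
          bounded_linear_inner_left)
    show "\<xi> (exp u) = exp (\<Sum>b\<in>Basis. of_real (u \<bullet> b) * \<alpha> b)" for u
      using sum[OF finite_Basis, of u] by (simp add: euclidean_representation)
  qed
qed

text \<open>Split \<open>z\<close> into a positive real and an element of norm 1. The character is
  an exact power on the former and bounded on the compact unit sphere.\<close>

lemma multiplicative_char_bound:
  fixes \<xi> :: "'f::real_or_complex \<Rightarrow> complex"
  assumes \<xi>: "multiplicative_char \<xi>"
  shows "\<exists>M \<tau>. \<forall>z. z \<noteq> 0 \<longrightarrow> norm (\<xi> z) \<le> M * norm z powr \<tau>"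
proof -
  obtain l where l: "bounded_linear l" "\<And>u. \<xi> (exp u) = exp (l u)"
    using multiplicative_char_exp[OF \<xi>] by blast
  have "continuous_on (- {0}) \<xi>" using \<xi> by (simp add: multiplicative_char_def)
  then have "continuous_on (sphere 0 1) \<xi>" by (rule continuous_on_subset) auto
  then have "compact (\<xi> ` sphere 0 1)" by (rule compact_continuous_image) simp
  then obtain M where M: "\<And>z. z \<in> sphere 0 1 \<Longrightarrow> norm (\<xi> z) \<le> M"
    by (meson bounded_iff compact_imp_bounded imageI)
  have "norm (\<xi> z) \<le> M * norm z powr Re (l 1)" if z: "z \<noteq> 0" for z
  proof -
    have "exp (ln (norm z) *\<^sub>R 1) * (z / of_real (norm z)) = z"
      using z by (simp add: scaleR_conv_of_real exp_of_real)
    moreover have "\<xi> (exp (ln (norm z) *\<^sub>R 1) * (z / of_real (norm z))) =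
        \<xi> (exp (ln (norm z) *\<^sub>R 1)) * \<xi> (z / of_real (norm z))"
      using z by (intro multiplicative_char_mult[OF \<xi>]) auto
    ultimately have "\<xi> z = exp (l (ln (norm z) *\<^sub>R 1)) * \<xi> (z / of_real (norm z))"
      by (simp only: l(2))
    moreover have "norm (exp (l (ln (norm z) *\<^sub>R 1))) = norm z powr Re (l 1)"
      using z by (simp add: linear_scale[OF bounded_linear.linear[OF l(1)]] powr_def)
    moreover have "norm (\<xi> (z / of_real (norm z))) \<le> M"
      using z by (intro M) (simp add: norm_divide)
    ultimately show ?thesis
      using mult_left_mono[of "norm (\<xi> (z / of_real (norm z)))" M "norm z powr Re (l 1)"]
      by (simp add: norm_mult mult.commute)
  qed
  then show ?thesis by blast
qed

text \<open>Near 1 the character is the exponential of \<open>l\<close> applied to a local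
  logarithm, whose derivative at 1 is the identity; multiplicativity transports the derivative from
  1 to any nonzero \<open>z\<close>. Thus \<open>l (q / z)\<close> is the logarithmic
  derivative.\<close>

lemma (in field_embedding) multiplicative_char_has_derivative:
  fixes \<xi> :: "'f \<Rightarrow> complex"
  assumes \<xi>: "multiplicative_char \<xi>"
  obtains l where "bounded_linear l" "\<And>z. z \<noteq> 0 \<Longrightarrow> (\<xi> has_derivative (\<lambda>q. \<xi> z * l (q / z))) (at z)"
proof -
  obtain l where l: "bounded_linear l" "\<And>u. \<xi> (exp u) = exp (l u)"
    using multiplicative_char_exp[OF \<xi>] by blast
  obtain \<pi> where \<pi>: "bounded_linear \<pi>" "\<And>x. \<pi> (h x) = x" "\<And>w. w \<in> range h \<Longrightarrow> h (\<pi> w) = w"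
    using ex_left_inverse by blast
  define L where "L = (\<lambda>z. \<pi> (Ln (h z)))"
  have exp_L: "exp (L z) = z" if "z \<in> ball 1 1" for z
  proof -
    have z: "norm (1 - h z) < 1" using that h_norm[of "1 - z"] by (simp add: h_diff dist_norm)
    \<comment> \<open>Over \<real> this requires \<open>h z\<close> to be positive, which holds
      because \<open>z\<close> is within distance 1 of 1.\<close>
    have "Ln (h z) \<in> range h"
    proof (rule disjE[OF h_range])
      assume R: "range h = \<real>"
      then have "h z = of_real (Re (h z))" by (metis of_real_Re rangeI)
      moreover from z have "Re (h z) > 0" using complex_Re_le_cmod[of "1 - h z"] by simp
      ultimately have "Ln (h z) = of_real (ln (Re (h z)))" using Ln_of_real by metis
      then show ?thesis using R by auto
    qed auto
    then have "h (exp (L z)) = exp (Ln (h z))" by (simp add: h_exp L_def \<pi>(3))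
    also have "\<dots> = h z" using z by (intro exp_Ln) auto
    finally show ?thesis by simp
  qed
  have "(L has_derivative (\<lambda>q. q)) (at 1)"
  proof -
    have "(Ln has_derivative (*) 1) (at (h 1))"
      using has_field_derivative_Ln[of 1] by (simp add: has_field_derivative_def)
    from has_derivative_compose[OF bounded_linear_imp_has_derivative[OF h_bounded_linear] this]
    have "((\<lambda>z. Ln (h z)) has_derivative h) (at 1)" by simp
    from bounded_linear.has_derivative[OF \<pi>(1) this] show ?thesis
      by (simp add: L_def \<pi>(2))
  qed
  from bounded_linear.has_derivative[OF l(1) this]
  have "((\<lambda>z. exp (l (L z))) has_derivative (\<lambda>q. exp (l (L 1)) * l q)) (at 1)"
    by (rule has_derivative_compose[OF _ DERIV_exp[unfolded has_field_derivative_def]])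
  moreover have "exp (l (L 1)) = 1"
    using exp_L[of 1] multiplicative_char_one[OF \<xi>] by (simp flip: l(2))
  ultimately have "((\<lambda>z. exp (l (L z))) has_derivative l) (at 1)" by simp
  then have one: "(\<xi> has_derivative l) (at 1)"
    by (rule has_derivative_transform_within_open[of _ _ _ _ "ball 1 1"])
       (auto simp del: mem_ball simp: exp_L simp flip: l(2))
  have "(\<xi> has_derivative (\<lambda>q. \<xi> z * l (q / z))) (at z)" if z: "z \<noteq> 0" for z
  proof -
    have "((\<lambda>w. w / z) has_derivative (\<lambda>q. q / z)) (at z)"
      by (intro bounded_linear_imp_has_derivative bounded_linear_divide)
    from has_derivative_compose[OF this, of \<xi> l] one z
    have "((\<lambda>w. \<xi> (w / z)) has_derivative (\<lambda>q. l (q / z))) (at z)" by simp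
    from has_derivative_mult_right[OF this, of "\<xi> z"]
    have "((\<lambda>w. \<xi> z * \<xi> (w / z)) has_derivative (\<lambda>q. \<xi> z * l (q / z))) (at z)" .
    then show ?thesis
    proof (rule has_derivative_transform_within_open[of _ _ _ _ "- {0}"])
      show "\<xi> z * \<xi> (w / z) = \<xi> w" if "w \<in> - {0}" for w
      proof -
        show ?thesis using multiplicative_char_mult[OF \<xi>, of z "w / z"] z that by simp
      qed
    qed (use z in auto)
  qed
  with l(1) show thesis using that by blast
qed

text \<open>The norm is treated as a character so that the general formula yields the logarithmic
  derivative of the twisting factor.\<close>

lemma multiplicative_char_norm: "multiplicative_char (\<lambda>x::'f::real_or_complex. complex_of_real (norm x))"
  unfolding multiplicative_char_def by (auto simp: norm_mult intro!: continuous_intros)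

lemma twist_zero: "x \<noteq> 0 \<Longrightarrow> twist chi 0 x = chi x"
  by (simp add: twist_def)

lemma twist_bound:
  fixes chi :: "'f::real_or_complex \<Rightarrow> complex"
  assumes "\<And>z. z \<noteq> 0 \<Longrightarrow> norm (chi z) \<le> M * norm z powr \<tau>" "z \<noteq> 0"
  shows "norm (twist chi s z) \<le> M * norm z powr (\<tau> + DIM('f) * Re s)"
proof -
  have "norm (complex_of_real (norm z) powr (of_nat DIM('f) * s)) = norm z powr (DIM('f) * Re s)"
    using assms(2) by (simp add: norm_powr_real_powr)
  then show ?thesis
    using mult_right_mono[OF assms(1)[OF assms(2)], of "norm z powr (DIM('f) * Re s)"] assms(2)
    by (simp add: twist_def norm_mult powr_add mult.assoc)
qed

text \<open>The logarithmic derivative is affine in the parameter \<open>s\<close>. This makes the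
  coefficients of the later differential equations entire in \<open>s\<close>, as continuation
  requires.\<close>

lemma (in field_embedding) twist_has_derivative:
  fixes chi :: "'f \<Rightarrow> complex"
  assumes l: "\<And>z. z \<noteq> 0 \<Longrightarrow> (chi has_derivative (\<lambda>q. chi z * l (q / z))) (at z)"
    and n: "\<And>z. z \<noteq> 0 \<Longrightarrow> ((\<lambda>x::'f. complex_of_real (norm x)) has_derivative (\<lambda>q. complex_of_real (norm z) * m (q / z))) (at z)"
    and z: "z \<noteq> 0"
  shows "(twist chi s has_derivative (\<lambda>q. twist chi s z * (l (q / z) + of_nat DIM('f) * s * m (q / z)))) (at z)"
proof -
  let ?w = "of_nat DIM('f) * s"
  let ?N = "complex_of_real (norm z)"
  have "((\<lambda>y. y powr ?w) has_derivative (*) (?w * ?N powr (?w - 1))) (at ?N)"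
    using has_field_derivative_powr[of ?N ?w] z by (simp add: has_field_derivative_def)
  from has_derivative_compose[OF n[OF z] this]
  have "((\<lambda>x. complex_of_real (norm x) powr ?w) has_derivative (\<lambda>q. ?w * ?N powr (?w - 1) * (?N * m (q / z)))) (at z)" .
  moreover have pw: "?N powr (?w - 1) * ?N = ?N powr ?w"
    using z by (simp add: powr_diff)
  have "?w * ?N powr (?w - 1) * (?N * m (q / z)) = (?N powr (?w - 1) * ?N) * (?w * m (q / z))" for q
    by (simp only: mult_ac)
  then have "?w * ?N powr (?w - 1) * (?N * m (q / z)) = ?N powr ?w * (?w * m (q / z))" for q
    by (simp only: pw)
  ultimately have "((\<lambda>x. complex_of_real (norm x) powr ?w) has_derivative (\<lambda>q. ?N powr ?w * (?w * m (q / z)))) (at z)"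
    by simp
  from has_derivative_mult[OF l[OF z] this] show ?thesis
    unfolding twist_def[abs_def] by (rule has_derivative_eq_rhs) (simp add: fun_eq_iff algebra_simps)
qed

subsection \<open>Growth\<close>

text \<open>The bound is relative to a set because the functions of interest are controlled only off
  the zeros of a polynomial; a nonnegative constant lets it survive extension by zero.\<close>

definition poly_growth_on :: "'v::real_normed_vector set \<Rightarrow> ('v \<Rightarrow> 'a::real_normed_vector) \<Rightarrow> bool" where
  "poly_growth_on S f \<longleftrightarrow> (\<exists>C m. C \<ge> 0 \<and> (\<forall>x\<in>S. norm (f x) \<le> C * (1 + norm x) ^ m))"

definition rapid_decay :: "('v::real_normed_vector \<Rightarrow> complex) \<Rightarrow> bool" where
  "rapid_decay f \<longleftrightarrow> (\<forall>N. \<exists>C. \<forall>x. (1 + norm x) ^ N * norm (f x) \<le> C)"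

lemma poly_growth_on_mono:
  assumes "poly_growth_on S g" "\<And>x. x \<in> S \<Longrightarrow> norm (f x) \<le> c * norm (g x)" "c \<ge> 0"
  shows "poly_growth_on S f"
proof -
  obtain C m where C: "C \<ge> 0" "\<And>x. x \<in> S \<Longrightarrow> norm (g x) \<le> C * (1 + norm x) ^ m"
    using assms(1) unfolding poly_growth_on_def by blast
  have "norm (f x) \<le> (c * C) * (1 + norm x) ^ m" if "x \<in> S" for x
    using assms(2)[OF that] mult_left_mono[OF C(2)[OF that] assms(3)] by (simp add: mult.assoc)
  then show ?thesis unfolding poly_growth_on_def using C(1) assms(3) by (meson mult_nonneg_nonneg)
qed

lemma poly_growth_on_const: "poly_growth_on S (\<lambda>x. c)"
  unfolding poly_growth_on_def by (intro exI[of _ "norm c"] exI[of _ 0]) auto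

lemma poly_growth_on_add:
  assumes "poly_growth_on S f" "poly_growth_on S g" shows "poly_growth_on S (\<lambda>x. f x + g x)"
proof -
  obtain C m where C: "C \<ge> 0" "\<And>x. x \<in> S \<Longrightarrow> norm (f x) \<le> C * (1 + norm x) ^ m"
    using assms(1) unfolding poly_growth_on_def by blast
  obtain C' m' where C': "C' \<ge> 0" "\<And>x. x \<in> S \<Longrightarrow> norm (g x) \<le> C' * (1 + norm x) ^ m'"
    using assms(2) unfolding poly_growth_on_def by blast
  have "norm (f x + g x) \<le> (C + C') * (1 + norm x) ^ (m + m')" if "x \<in> S" for x
  proof -
    have "C * (1 + norm x) ^ m \<le> C * (1 + norm x) ^ (m + m')" "C' * (1 + norm x) ^ m' \<le> C' * (1 + norm x) ^ (m + m')"
      using C C' by (auto intro!: mult_left_mono power_increasing)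
    then show ?thesis using norm_triangle_ineq[of "f x" "g x"] C(2)[OF that] C'(2)[OF that]
      unfolding distrib_right by linarith
  qed
  then show ?thesis unfolding poly_growth_on_def using C(1) C'(1) by (meson add_nonneg_nonneg)
qed

lemma poly_growth_on_mult:
  fixes f g :: "'v::real_normed_vector \<Rightarrow> 'a::real_normed_field"
  assumes "poly_growth_on S f" "poly_growth_on S g" shows "poly_growth_on S (\<lambda>x. f x * g x)"
proof -
  obtain C m where C: "C \<ge> 0" "\<And>x. x \<in> S \<Longrightarrow> norm (f x) \<le> C * (1 + norm x) ^ m"
    using assms(1) unfolding poly_growth_on_def by blast
  obtain C' m' where C': "C' \<ge> 0" "\<And>x. x \<in> S \<Longrightarrow> norm (g x) \<le> C' * (1 + norm x) ^ m'"
    using assms(2) unfolding poly_growth_on_def by blast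
  have "norm (f x * g x) \<le> (C * C') * (1 + norm x) ^ (m + m')" if "x \<in> S" for x
    using mult_mono[OF C(2)[OF that] C'(2)[OF that]] C C'
    by (simp add: norm_mult power_add mult_ac)
  then show ?thesis unfolding poly_growth_on_def using C(1) C'(1) by (meson mult_nonneg_nonneg)
qed

lemma poly_growth_on_sum:
  assumes "\<And>i. i \<in> I \<Longrightarrow> poly_growth_on S (f i)" shows "poly_growth_on S (\<lambda>x. \<Sum>i\<in>I. f i x)"
  using assms by (induction I rule: infinite_finite_induct) (auto intro: poly_growth_on_add poly_growth_on_const)

lemma poly_growth_on_prod:
  fixes f :: "'i \<Rightarrow> 'v::real_normed_vector \<Rightarrow> 'a::real_normed_field"
  assumes "\<And>i. i \<in> I \<Longrightarrow> poly_growth_on S (f i)" shows "poly_growth_on S (\<lambda>x. \<Prod>i\<in>I. f i x)"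
  using assms by (induction I rule: infinite_finite_induct) (auto intro: poly_growth_on_mult poly_growth_on_const)

lemma poly_growth_on_polynomial:
  fixes p :: "'f::real_normed_field ^ 'n \<Rightarrow> 'f"
  assumes "polynomial_fun p" shows "poly_growth_on S p"
  using assms
proof induction
  case (coord i)
  have "norm (x $ i) \<le> 1 * (1 + norm x) ^ 1" for x :: "'f^'n"
    using Finite_Cartesian_Product.norm_nth_le[of x i] by simp
  then show ?case unfolding poly_growth_on_def by (intro exI[of _ 1]) auto
qed (auto intro: poly_growth_on_const poly_growth_on_add poly_growth_on_mult)

text \<open>A nonnegative exponent keeps the power bounded near zeros of \<open>f\<close>; this is
  where large real parts of the characters enter.\<close>

lemma poly_growth_on_powr:
  assumes "poly_growth_on S f" "\<rho> \<ge> 0" shows "poly_growth_on S (\<lambda>x. norm (f x) powr \<rho>)"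
proof (rule poly_growth_on_mono)
  let ?n = "nat \<lceil>\<rho>\<rceil>"
  have "poly_growth_on S (\<lambda>x. norm (f x))"
    by (rule poly_growth_on_mono[OF assms(1), of _ 1]) auto
  then have "poly_growth_on S (\<lambda>x. \<Prod>i<?n. 1 + norm (f x))"
    by (intro poly_growth_on_prod poly_growth_on_add poly_growth_on_const)
  then show "poly_growth_on S (\<lambda>x. (1 + norm (f x)) ^ ?n)" by simp
  show "norm (norm (f x) powr \<rho>) \<le> 1 * norm ((1 + norm (f x)) ^ ?n)" for x
  proof -
    have "norm (f x) powr \<rho> \<le> (1 + norm (f x)) powr \<rho>" using assms(2) by (intro powr_mono2) auto
    also have "\<dots> \<le> (1 + norm (f x)) powr real ?n" by (intro powr_mono) (auto simp: real_nat_ceiling_ge)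
    also have "\<dots> = (1 + norm (f x)) ^ ?n" by (intro powr_realpow) (auto intro: add_pos_nonneg)
    finally show ?thesis by simp
  qed
qed simp

lemma rapid_decay_mult:
  assumes "poly_growth_on UNIV g" "rapid_decay f" shows "rapid_decay (\<lambda>x. g x * f x)"
  unfolding rapid_decay_def
proof
  fix N
  obtain C m where C: "C \<ge> 0" "\<And>x. norm (g x) \<le> C * (1 + norm x) ^ m"
    using assms(1) unfolding poly_growth_on_def by blast
  obtain B where B: "\<And>x. (1 + norm x) ^ (N + m) * norm (f x) \<le> B"
    using assms(2) unfolding rapid_decay_def by blast
  have "(1 + norm x) ^ N * norm (g x * f x) \<le> C * B" for x
  proof -
    have "(1 + norm x) ^ N * norm (g x * f x) \<le> (1 + norm x) ^ N * ((C * (1 + norm x) ^ m) * norm (f x))"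
      unfolding norm_mult by (intro mult_left_mono mult_right_mono C) auto
    also have "\<dots> = C * ((1 + norm x) ^ (N + m) * norm (f x))" by (simp add: power_add mult_ac)
    also have "\<dots> \<le> C * B" by (intro mult_left_mono B C)
    finally show ?thesis .
  qed
  then show "\<exists>C. \<forall>x. (1 + norm x) ^ N * norm (g x * f x) \<le> C" by blast
qed

lemma rapid_decay_mono:
  assumes "rapid_decay f" "\<And>x. norm (g x) \<le> norm (f x)" shows "rapid_decay g"
  unfolding rapid_decay_def
proof
  fix N
  obtain B where B: "\<And>x. (1 + norm x) ^ N * norm (f x) \<le> B"
    using assms(1) unfolding rapid_decay_def by blast
  have "(1 + norm x) ^ N * norm (g x) \<le> B" for x
    using mult_left_mono[OF assms(2)[of x], of "(1 + norm x) ^ N"] B[of x] by auto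
  then show "\<exists>C. \<forall>x. (1 + norm x) ^ N * norm (g x) \<le> C" by blast
qed

lemma rapid_decay_add:
  assumes "rapid_decay f" "rapid_decay g" shows "rapid_decay (\<lambda>x. f x + g x)"
  unfolding rapid_decay_def
proof
  fix N
  obtain B where B: "\<And>x. (1 + norm x) ^ N * norm (f x) \<le> B"
    using assms(1) unfolding rapid_decay_def by blast
  obtain B' where B': "\<And>x. (1 + norm x) ^ N * norm (g x) \<le> B'"
    using assms(2) unfolding rapid_decay_def by blast
  have "(1 + norm x) ^ N * norm (f x + g x) \<le> B + B'" for x
    using mult_left_mono[OF norm_triangle_ineq[of "f x" "g x"], of "(1 + norm x) ^ N"] B[of x] B'[of x]
    by (simp add: distrib_left)
  then show "\<exists>C. \<forall>x. (1 + norm x) ^ N * norm (f x + g x) \<le> C" by blast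
qed

lemma rapid_decay_bound:
  fixes f :: "'v::euclidean_space \<Rightarrow> complex"
  assumes "rapid_decay f" shows "\<exists>C. \<forall>x. norm (f x) \<le> C * decay x"
proof -
  obtain C where C: "\<And>x. (1 + norm x) ^ (2 * DIM('v)) * norm (f x) \<le> C"
    using assms unfolding rapid_decay_def by blast
  have "norm (f x) \<le> C * decay x" for x
  proof -
    have "(1 + norm x) ^ (2 * DIM('v)) > 0" by (intro zero_less_power add_pos_nonneg) auto
    then show ?thesis using C[of x] by (simp add: decay_def field_simps)
  qed
  then show ?thesis by blast
qed

lemma integrable_rapid_decay:
  fixes f :: "'v::euclidean_space \<Rightarrow> complex"
  assumes "rapid_decay f" "f \<in> borel_measurable lborel" shows "integrable lborel f"
proof -
  obtain C where C: "\<And>x. norm (f x) \<le> C * decay x" using rapid_decay_bound[OF assms(1)] by blast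
  show ?thesis
  proof (rule Bochner_Integration.integrable_bound)
    show "integrable lborel (\<lambda>x::'v. C * decay x)" by (rule integrable_mult_right) (rule integrable_decay)
    show "AE x in lborel. norm (f x) \<le> norm (C * decay x)"
      by (intro AE_I2 order_trans[OF C]) simp
  qed (rule assms(2))
qed

lemma has_derivative_imp_line:
  assumes "(f has_derivative f') (at x)"
  shows "((\<lambda>t. f (x + t *\<^sub>R v)) has_vector_derivative f' v) (at 0)"
proof -
  have "((\<lambda>t. x + t *\<^sub>R v) has_derivative (\<lambda>t. t *\<^sub>R v)) (at 0)"
    by (auto intro!: derivative_eq_intros)
  then have "((\<lambda>t. f (x + t *\<^sub>R v)) has_derivative (\<lambda>t. f' (t *\<^sub>R v))) (at 0)"
    using has_derivative_compose[of "\<lambda>t. x + t *\<^sub>R v" "\<lambda>t. t *\<^sub>R v" 0 UNIV f f'] assms by simp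
  then show ?thesis
    using linear_scale[OF has_derivative_linear[OF assms]] by (simp add: has_vector_derivative_def)
qed

lemma has_vector_derivative_zero_of_quadratic:
  fixes f :: "real \<Rightarrow> complex"
  assumes "d > 0" "\<And>r. \<bar>r\<bar> < d \<Longrightarrow> norm (f r) \<le> B * r\<^sup>2" "f 0 = 0"
  shows "(f has_vector_derivative 0) (at 0)"
  unfolding has_vector_derivative_def has_derivative_at_alt
proof (intro conjI allI impI)
  fix e :: real assume e: "e > 0"
  define m where "m = min d (e / (\<bar>B\<bar> + 1))"
  have "m > 0" using assms(1) e by (auto simp: m_def)
  moreover have "norm (f y - f 0 - (y - 0) *\<^sub>R 0) \<le> e * norm (y - 0)" if "norm (y - 0) < m" for y
  proof -
    have y: "\<bar>y\<bar> < d" "\<bar>y\<bar> \<le> e / (\<bar>B\<bar> + 1)" using that by (auto simp: m_def)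
    have "norm (f y) \<le> B * y\<^sup>2" by (rule assms(2)[OF y(1)])
    also have "\<dots> \<le> (\<bar>B\<bar> + 1) * \<bar>y\<bar> * \<bar>y\<bar>"
      by (simp add: power2_eq_square mult.assoc mult_right_mono flip: abs_mult)
    also have "\<dots> \<le> e * \<bar>y\<bar>"
      using y(2) by (intro mult_right_mono) (auto simp: field_simps)
    finally show ?thesis using assms(3) by simp
  qed
  ultimately show "\<exists>d>0. \<forall>y. norm (y - 0) < d \<longrightarrow> norm (f y - f 0 - (y - 0) *\<^sub>R 0) \<le> e * norm (y - 0)"
    by blast
qed simp

subsection \<open>The differential equation satisfied by an elementary function\<close>

context field_embedding begin

lemma continuous_on_h [continuous_intros]: "continuous_on S f \<Longrightarrow> continuous_on S (\<lambda>x. h (f x))"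
  by (rule bounded_linear.continuous_on[OF h_bounded_linear])

lemma poly_growth_on_h: "poly_growth_on S p \<Longrightarrow> poly_growth_on S (\<lambda>x. h (p x))"
  by (rule poly_growth_on_mono[of _ _ _ 1]) (auto simp: h_norm)

lemma h_polynomial_has_derivative:
  fixes p :: "'f ^ 'n \<Rightarrow> 'f"
  assumes "polynomial_fun p"
  obtains p' where "\<And>i. polynomial_fun (p' i)"
    "\<And>x. (p has_derivative (\<lambda>v. \<Sum>i\<in>UNIV. p' i x * v $ i)) (at x)"
    "\<And>x. ((\<lambda>x. h (p x)) has_derivative (\<lambda>v. h (\<Sum>i\<in>UNIV. p' i x * v $ i))) (at x)"
proof -
  obtain p' where p': "\<And>i. polynomial_fun (p' i)"
    "\<And>x. (p has_derivative (\<lambda>v. \<Sum>i\<in>UNIV. p' i x * v $ i)) (at x)"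
    using polynomial_fun_has_derivative[OF assms] by blast
  show thesis by (rule that[OF p' bounded_linear.has_derivative[OF h_bounded_linear p'(2)]])
qed

text \<open>Multiplying by the square of a polynomial that vanishes on the singular set makes a bounded
  function differentiable everywhere, so that integration by parts leaves no boundary terms.\<close>

lemma integral_log_derivative:
  fixes G :: "'f ^ 'n \<Rightarrow> complex" and e :: "'f ^ 'n \<Rightarrow> 'f"
  assumes e: "polynomial_fun e"
    and G_cont: "continuous_on {x. e x \<noteq> 0} G"
    and G_growth: "poly_growth_on {x. e x \<noteq> 0} G"
    and G_deriv: "\<And>x. e x \<noteq> 0 \<Longrightarrow> (G has_derivative (\<lambda>w. G x * L x w)) (at x)"
    and L_growth: "poly_growth_on {x. e x \<noteq> 0} (\<lambda>x. L x v * h ((e x)\<^sup>2))"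
    and \<phi>: "\<And>x. \<phi> differentiable (at x)" "rapid_decay \<phi>" "rapid_decay (dir_deriv v \<phi>)"
  defines "F \<equiv> \<lambda>x. if e x = 0 then 0 else
      G x * (L x v * h ((e x)\<^sup>2) * \<phi> x + dir_deriv v (\<lambda>x. h ((e x)\<^sup>2) * \<phi> x) x)"
  shows "(LINT x|lborel. F x) = 0" "integrable lborel F"
proof -
  define S where "S = {x. e x \<noteq> 0}"
  have S: "open S" unfolding S_def by (rule open_nonzero_polynomial[OF e])
  have e2: "polynomial_fun (\<lambda>x. (e x)\<^sup>2)" by (intro polynomial_fun_power e)
  obtain p' where p': "\<And>i. polynomial_fun (p' i)"
    "\<And>x. ((\<lambda>x. h ((e x)\<^sup>2)) has_derivative (\<lambda>v. h (\<Sum>i\<in>UNIV. p' i x * v $ i))) (at x)"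
    by (rule h_polynomial_has_derivative[OF e2]) (rule that)
  let ?dp = "\<lambda>x. h (\<Sum>i\<in>UNIV. p' i x * v $ i)"
  have e\<phi>: "((\<lambda>x. h ((e x)\<^sup>2) * \<phi> x) has_derivative
      (\<lambda>w. h ((e x)\<^sup>2) * dir_deriv w \<phi> x + h (\<Sum>i\<in>UNIV. p' i x * w $ i) * \<phi> x)) (at x)" for x
    by (rule has_derivative_mult[OF p'(2) has_derivative_dir_deriv[OF \<phi>(1)]])
  define \<psi> where "\<psi> = dir_deriv v (\<lambda>x. h ((e x)\<^sup>2) * \<phi> x)"
  have \<psi>_eq: "\<psi> = (\<lambda>x. h ((e x)\<^sup>2) * dir_deriv v \<phi> x + ?dp x * \<phi> x)"
    unfolding \<psi>_def by (rule ext) (rule dir_deriv_eqI[OF e\<phi>])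
  have growth: "poly_growth_on T (\<lambda>x. h ((e x)\<^sup>2))" "poly_growth_on T ?dp" for T
    by (intro poly_growth_on_h poly_growth_on_polynomial e2 polynomial_fun_intros p'(1))+
  have \<psi>: "rapid_decay \<psi>"
    unfolding \<psi>_eq by (intro rapid_decay_add rapid_decay_mult growth \<phi>)
  \<comment> \<open>The extension by zero whose derivative along \<open>v\<close> is
    \<open>F\<close> at every point, including the zeros of \<open>e\<close>.\<close>
  define W where "W = (\<lambda>x. if e x = 0 then 0 else G x * (h ((e x)\<^sup>2) * \<phi> x))"
  let ?ext = "\<lambda>g x. if e x = 0 then 0 else g x :: complex"
  have ext_growth: "poly_growth_on UNIV (?ext g)" if "poly_growth_on S g" for g
    using that unfolding poly_growth_on_def S_def by (auto; metis mult_nonneg_nonneg norm_zero zero_le_power add_nonneg_nonneg norm_ge_zero zero_le_one)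
  have W_decay: "rapid_decay W"
    by (rule rapid_decay_mono[OF rapid_decay_mult[OF poly_growth_on_mult[OF ext_growth growth(1)] \<phi>(2)], of G])
       (use G_growth in \<open>auto simp: W_def S_def norm_mult\<close>)
  have F_eq: "F = (\<lambda>x. ?ext (\<lambda>x. G x * (L x v * h ((e x)\<^sup>2))) x * \<phi> x + ?ext G x * \<psi> x)"
    by (auto simp: F_def \<psi>_def algebra_simps)
  have F_decay: "rapid_decay F"
    unfolding F_eq
    by (intro rapid_decay_add rapid_decay_mult[OF ext_growth[of "\<lambda>x. G x * (L x v * h ((e x)\<^sup>2))"] \<phi>(2)]
        rapid_decay_mult[OF ext_growth[of G] \<psi>])
       (use G_growth poly_growth_on_mult[OF G_growth L_growth] in \<open>simp_all add: S_def\<close>)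
  have cont_\<phi>: "continuous_on T \<phi>" for T
    using \<phi>(1) differentiable_imp_continuous_within continuous_at_imp_continuous_on by blast
  have W_meas: "W \<in> borel_measurable lborel"
  proof -
    have "continuous_on S (\<lambda>x. G x * (h ((e x)\<^sup>2) * \<phi> x))"
      using G_cont by (intro continuous_intros cont_\<phi> continuous_polynomial_fun[OF e]) (simp add: S_def)
    then have "(\<lambda>x. indicator S x *\<^sub>R (G x * (h ((e x)\<^sup>2) * \<phi> x))) \<in> borel_measurable borel"
      by (intro borel_measurable_continuous_on_indicator) (use S in auto)
    moreover have "(\<lambda>x. indicator S x *\<^sub>R (G x * (h ((e x)\<^sup>2) * \<phi> x))) = W"
      by (auto simp: fun_eq_iff W_def S_def indicator_def)
    ultimately show ?thesis by simp
  qed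
  have W: "integrable lborel W" by (rule integrable_rapid_decay[OF W_decay W_meas])
  obtain C where C: "\<And>x. norm (F x) \<le> C * decay x" using rapid_decay_bound[OF F_decay] by blast
  have der: "((\<lambda>r. W (x + r *\<^sub>R v)) has_vector_derivative F x) (at 0)" for x
  proof (cases "e x = 0")
    case False
    have "(W has_derivative (\<lambda>w. G x * (h ((e x)\<^sup>2) * dir_deriv w \<phi> x + h (\<Sum>i\<in>UNIV. p' i x * w $ i) * \<phi> x)
        + G x * L x w * (h ((e x)\<^sup>2) * \<phi> x))) (at x)"
      by (rule has_derivative_transform_within_open[OF has_derivative_mult[OF G_deriv[OF False] e\<phi>] S])
         (use False in \<open>auto simp: W_def S_def\<close>)
    note line = has_derivative_imp_line[OF this, of v]
    have "F x = G x * (L x v * h ((e x)\<^sup>2) * \<phi> x + \<psi> x)"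
      using False by (simp add: F_def \<psi>_def)
    with line show ?thesis by (simp add: \<psi>_eq algebra_simps)
  next
    case True
    \<comment> \<open>At a zero of \<open>e\<close>: since the product of \<open>G\<close> and
      \<phi> is bounded, \<open>W\<close> is at most a constant times the square of
      \<open>norm (e x)\<close>, and \<open>e\<close> is of first order in \<open>r\<close> along
      the line. So \<open>W\<close> is of second order and its derivative is 0, the value given to
      \<open>F\<close>.\<close>
    have "rapid_decay (\<lambda>x. ?ext G x * \<phi> x)"
      by (intro rapid_decay_mult ext_growth \<phi>) (use G_growth in \<open>simp add: S_def\<close>)
    then obtain B where "\<And>x. (1 + norm x) ^ 0 * norm (?ext G x * \<phi> x) \<le> B"
      unfolding rapid_decay_def by blast
    then have B: "norm (?ext G x * \<phi> x) \<le> B" for x by simp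
    have W_le: "norm (W x) \<le> B * (norm (e x))\<^sup>2" for x
      using mult_right_mono[OF B[of x], of "(norm (e x))\<^sup>2"]
      by (auto simp: W_def norm_mult h_norm norm_power mult_ac)
    obtain e' where "(e has_derivative e') (at x)" using polynomial_fun_has_derivative[OF e] by blast
    from has_derivative_imp_line[OF this, of v]
    have "((\<lambda>r. e (x + r *\<^sub>R v)) has_vector_derivative e' v) (at 0)" .
    then obtain d where d: "d > 0" "\<And>r. norm (r - 0) < d \<Longrightarrow>
        norm (e (x + r *\<^sub>R v) - e (x + 0 *\<^sub>R v) - (r - 0) *\<^sub>R e' v) \<le> 1 * norm (r - 0)"
      unfolding has_vector_derivative_def has_derivative_at_alt by (metis zero_less_one)
    have "((\<lambda>r. W (x + r *\<^sub>R v)) has_vector_derivative 0) (at 0)"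
    proof (rule has_vector_derivative_zero_of_quadratic[OF d(1)])
      fix r :: real assume r: "\<bar>r\<bar> < d"
      have "norm (e (x + r *\<^sub>R v)) \<le> (1 + norm (e' v)) * \<bar>r\<bar>"
        using d(2)[of r] r True norm_triangle_sub[of "e (x + r *\<^sub>R v)" "r *\<^sub>R e' v"] by (simp add: algebra_simps)
      then have "(norm (e (x + r *\<^sub>R v)))\<^sup>2 \<le> ((1 + norm (e' v)) * \<bar>r\<bar>)\<^sup>2" by (intro power_mono) auto
      moreover have "B \<ge> 0" using order_trans[OF norm_ge_zero B] .
      ultimately show "norm (W (x + r *\<^sub>R v)) \<le> (B * (1 + norm (e' v))\<^sup>2) * r\<^sup>2"
        using W_le[of "x + r *\<^sub>R v"] mult_left_mono[of "(norm (e (x + r *\<^sub>R v)))\<^sup>2" "((1 + norm (e' v)) * \<bar>r\<bar>)\<^sup>2" B]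
        by (simp add: power_mult_distrib mult.assoc)
    qed (use True in \<open>simp add: W_def\<close>)
    then show ?thesis using True by (simp add: F_def)
  qed
  show "(LINT x|lborel. F x) = 0" by (rule integral_dir_deriv_eq_zero(2)[OF W der C])
  show "integrable lborel F"
    by (rule integrable_rapid_decay[OF F_decay integral_dir_deriv_eq_zero(1)[OF W der C]])
qed

end

text \<open>
  The constants \<open>J\<close>, \<open>k1\<close>, \<open>k2\<close> make \<open>k1 \<partial>\<^sub>1 + k2 \<partial>\<^sub>J\<close> the derivative over \<open>\<real>\<close>, and the Wirtinger derivative over
  \<open>\<complex>\<close>, where \<open>J = \<i>\<close>, \<open>k1 = 1/2\<close>, \<open>k2 = -\<i>/2\<close>. Applied to a real linear form it yields a multiple of \<open>h\<close>,
  which keeps all coefficients below polynomial in the holomorphic coordinates.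
\<close>

locale fourier_pairing = field_embedding h + symmetric_isometry D
  for h :: "'f::real_or_complex \<Rightarrow> complex" and D :: "'f ^ 'n \<Rightarrow> 'f ^ 'n" +
  fixes J :: 'f and k1 k2 c0 :: complex
  assumes D_eq: "D y \<bullet> x = Re (h (scalar_product y x))" and c0: "c0 \<noteq> 0"
    and wirtinger_Re: "k1 * of_real (Re (h q)) + k2 * of_real (Re (h (J * q))) = c0 * h q"
    and wirtinger_h: "k1 * h q + k2 * h (J * q) = h q"
    and wirtinger_linear: "bounded_linear l \<Longrightarrow> \<exists>\<sigma>. \<forall>q. k1 * l q + k2 * l (J * q) = \<sigma> * h q"
begin

definition chr :: "real \<Rightarrow> 'f \<Rightarrow> complex" where
  "chr t z = exp (\<i> * of_real (t * Re (h z)))"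

definition wirt :: "'n \<Rightarrow> ('f ^ 'n \<Rightarrow> complex) \<Rightarrow> 'f ^ 'n \<Rightarrow> complex" where
  "wirt i f x = k1 * dir_deriv (axis i 1) f x + k2 * dir_deriv (axis i J) f x"

lemma norm_chr [simp]: "norm (chr t z) = 1"
  by (simp add: chr_def)

lemma chr_add: "chr t (x + y) = chr t x * chr t y"
  by (simp add: chr_def h_add algebra_simps flip: exp_add)

lemma chr_minus: "chr t (- x) * chr t x = 1"
  using chr_add[of t "- x" x] by (simp add: chr_def)

lemma wave_eq_chr: "wave t y x = chr t (scalar_product y x)"
  by (simp add: wave_def chr_def D_eq)

lemma nontrivial_chr:
  assumes "t \<noteq> 0" shows "nontrivial_unitary_additive_char (chr t)"
proof -
  have "chr t (of_real (pi / t)) = exp (\<i> * of_real pi)"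
    using assms unfolding chr_def h_of_real by simp
  then have "chr t (of_real (pi / t)) \<noteq> 1" by (simp add: exp_pi_i')
  moreover have "continuous_on UNIV (chr t)"
    unfolding chr_def[abs_def] by (intro continuous_intros)
  ultimately show ?thesis
    unfolding nontrivial_unitary_additive_char_def using chr_add by auto
qed

lemma chr_has_derivative: "(chr t has_derivative (\<lambda>w. \<i> * of_real (t * Re (h w)) * chr t z)) (at z)"
proof -
  have "bounded_linear (\<lambda>w. \<i> * complex_of_real (t * Re (h w)))"
    by (intro bounded_linear_const_mult bounded_linear_compose[OF bounded_linear_of_real]
        bounded_linear_compose[OF bounded_linear_Re] h_bounded_linear)
  from has_derivative_compose[OF bounded_linear_imp_has_derivative[OF this] DERIV_exp[unfolded has_field_derivative_def]]
  show ?thesis unfolding chr_def[abs_def] by (simp add: mult.commute)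
qed

lemma has_derivative_prod_log:
  fixes f :: "'i \<Rightarrow> 'v::real_normed_vector \<Rightarrow> complex"
  assumes "finite I" "\<And>i. i \<in> I \<Longrightarrow> (f i has_derivative (\<lambda>w. f i x * L i w)) (at x)"
  shows "((\<lambda>x. \<Prod>i\<in>I. f i x) has_derivative (\<lambda>w. (\<Prod>i\<in>I. f i x) * (\<Sum>i\<in>I. L i w))) (at x)"
  using assms
proof (induction I rule: finite_induct)
  case (insert i I)
  then have "((\<lambda>x. f i x * (\<Prod>i\<in>I. f i x)) has_derivative
      (\<lambda>w. f i x * ((\<Prod>i\<in>I. f i x) * (\<Sum>i\<in>I. L i w)) + f i x * L i w * (\<Prod>i\<in>I. f i x))) (at x)"
    by (intro has_derivative_mult) auto
  then show ?case using insert by (simp add: algebra_simps)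
qed simp

text \<open>The integrand is \<open>wirt i\<close> applied to the product of \<open>G_fun\<close>,
  \<open>h ((e x)\<^sup>2)\<close> and \<phi>, a combination of two directional derivatives whose
  integrals vanish. The polynomials \<open>A i\<close> and \<open>R i j\<close> come from the
  logarithmic derivatives of the phase and of the characters, multiplied by the square of
  \<open>e\<close>. They and the constants do not depend on \<open>s\<close>, \<open>t\<close> or
  \<phi>, so the equation keeps its order as \<open>t\<close> grows.\<close>

lemma elementary_function_annihilated:
  fixes as bs Qs :: "'f ^ 'n \<Rightarrow> 'f" and Ps :: "'l::finite \<Rightarrow> 'f ^ 'n \<Rightarrow> 'f" and chis :: "'l \<Rightarrow> 'f \<Rightarrow> complex"
  assumes as: "polynomial_fun as" and bs: "nonzero_polynomial bs" and Qs: "\<forall>x. bs x \<noteq> 0 \<longrightarrow> Qs x = as x / bs x"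
    and Ps: "\<forall>j. nonzero_polynomial (Ps j)" and chis: "\<forall>j. multiplicative_char (chis j)"
    and e_def: "e = (\<lambda>x. bs x * (\<Prod>j\<in>UNIV. Ps j x))"
  shows "\<exists>A R \<sigma> \<sigma>' c. (\<forall>i. polynomial_fun (A i)) \<and> (\<forall>i j. polynomial_fun (R i j)) \<and>
    (\<forall>i x. e x \<noteq> 0 \<longrightarrow> A i x = (e x)\<^sup>2 * partial_deriv i Qs x) \<and>
    (\<forall>i (s :: complex ^ 'l) t \<phi>. (\<forall>j. Re (s $ j) > c) \<longrightarrow> (\<forall>x. \<phi> differentiable (at x)) \<longrightarrow>
      rapid_decay \<phi> \<longrightarrow> (\<forall>v. rapid_decay (dir_deriv v \<phi>)) \<longrightarrow>
      (LINT x|lebesgue. G_fun Ps Qs (\<lambda>j. twist (chis j) (s $ j)) (chr t) x *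
        (wirt i (\<lambda>x. h ((e x)\<^sup>2) * \<phi> x) x + \<i> * of_real t * c0 * (h (A i x) * \<phi> x)
          + (\<Sum>j\<in>UNIV. (\<sigma> j + s $ j * \<sigma>') * (h (R i j x) * \<phi> x)))) = 0)"
proof -
  note Qs = Qs[rule_format] and Ps = Ps[rule_format] and chis = chis[rule_format]
  have e: "nonzero_polynomial e"
    unfolding e_def by (intro nonzero_polynomial_mult nonzero_polynomial_prod bs Ps)
  note e_poly = nonzero_polynomialD[OF e]
  obtain n where n: "\<And>i. polynomial_fun (n i)"
    "\<And>x. bs x \<noteq> 0 \<Longrightarrow> ((\<lambda>x. as x / bs x) has_derivative scalar_product (\<chi> i. n i x / (bs x)\<^sup>2)) (at x)"
    by (rule quotient_has_derivative[OF as nonzero_polynomialD[OF bs], of "\<lambda>x. as x / bs x"]) auto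
  have partial: "partial_deriv i Qs x = n i x / (bs x)\<^sup>2" if "bs x \<noteq> 0" for i x
  proof -
    have "(Qs has_derivative scalar_product (\<chi> i. n i x / (bs x)\<^sup>2)) (at x)"
      by (rule has_derivative_transform_within_open[OF n(2) open_nonzero_polynomial[OF nonzero_polynomialD[OF bs]]])
         (use that Qs in auto)
    from partial_deriv_eqI[OF this] show ?thesis by simp
  qed
  have "\<forall>j. \<exists>p'. (\<forall>i. polynomial_fun (p' i)) \<and> (\<forall>x. (Ps j has_derivative (\<lambda>v. \<Sum>i\<in>UNIV. p' i x * v $ i)) (at x))"
    using polynomial_fun_has_derivative[OF nonzero_polynomialD[OF Ps]] by blast
  then obtain P' where P': "\<And>j i. polynomial_fun (P' j i)"
    "\<And>j x. (Ps j has_derivative (\<lambda>v. \<Sum>i\<in>UNIV. P' j i x * v $ i)) (at x)"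
    by metis
  have "\<forall>j. \<exists>l. bounded_linear l \<and> (\<forall>z. z \<noteq> 0 \<longrightarrow> (chis j has_derivative (\<lambda>q. chis j z * l (q / z))) (at z))"
    using multiplicative_char_has_derivative[OF chis] by metis
  then obtain l where l: "\<And>j. bounded_linear (l j)"
    "\<And>j z. z \<noteq> 0 \<Longrightarrow> (chis j has_derivative (\<lambda>q. chis j z * l j (q / z))) (at z)"
    by metis
  obtain m :: "'f \<Rightarrow> complex" where m: "bounded_linear m"
    "\<And>z. z \<noteq> 0 \<Longrightarrow> ((\<lambda>x::'f. complex_of_real (norm x)) has_derivative (\<lambda>q. complex_of_real (norm z) * m (q / z))) (at z)"
    using multiplicative_char_has_derivative[OF multiplicative_char_norm] by blast
  have "\<forall>j. \<exists>M \<tau>. \<forall>z. z \<noteq> 0 \<longrightarrow> norm (chis j z) \<le> M * norm z powr \<tau>"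
    using multiplicative_char_bound[OF chis] by blast
  then obtain M \<tau> where M: "\<And>j z. z \<noteq> 0 \<Longrightarrow> norm (chis j z) \<le> M j * norm z powr \<tau> j"
    by metis
  have "\<forall>j. \<exists>\<sigma>. \<forall>q. k1 * l j q + k2 * l j (J * q) = \<sigma> * h q"
    using wirtinger_linear[OF l(1)] by blast
  then obtain \<sigma> where \<sigma>: "\<And>j q. k1 * l j q + k2 * l j (J * q) = \<sigma> j * h q" by metis
  obtain \<sigma>m where \<sigma>m: "\<And>q. k1 * m q + k2 * m (J * q) = \<sigma>m * h q"
    using wirtinger_linear[OF m(1)] by blast
  define \<sigma>' where "\<sigma>' = of_nat DIM('f) * \<sigma>m"
  \<comment> \<open>This is at least every \<open>\<bar>\<tau> j\<bar>\<close>; as the real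
    dimension of the field is at least 1, \<open>Re (s $ j) > c\<close> makes each exponent
    \<open>\<tau> j + DIM('f) * Re (s $ j)\<close> nonnegative.\<close>
  define c where "c = (\<Sum>j\<in>UNIV. \<bar>\<tau> j\<bar>)"
  define A where "A = (\<lambda>i x. n i x * (\<Prod>j\<in>UNIV. Ps j x)\<^sup>2)"
  \<comment> \<open>A logarithmic derivative of \<open>Ps j\<close> has \<open>Ps j\<close> once in
    the denominator, while the square of \<open>e\<close> contains it twice; one factor is left
    over.\<close>
  define R where "R = (\<lambda>i j x. (bs x)\<^sup>2 * P' j i x * Ps j x * (\<Prod>k\<in>UNIV - {j}. Ps k x)\<^sup>2)"
  have A_poly: "polynomial_fun (A i)" and R_poly: "polynomial_fun (R i j)" for i j
    unfolding A_def R_def by (intro polynomial_fun_intros n P' nonzero_polynomialD bs Ps)+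
  have A_eq: "A i x = (e x)\<^sup>2 * (n i x / (bs x)\<^sup>2)" if "bs x \<noteq> 0" for i x
    using that by (simp add: A_def e_def power_mult_distrib)
  have R_eq: "R i j x = (e x)\<^sup>2 * (P' j i x / Ps j x)" if "e x \<noteq> 0" for i j x
  proof -
    have "(\<Prod>k\<in>UNIV. Ps k x) = Ps j x * (\<Prod>k\<in>UNIV - {j}. Ps k x)"
      by (rule prod.remove) auto
    moreover from this that have "Ps j x \<noteq> 0" by (auto simp: e_def)
    ultimately show ?thesis by (simp add: R_def e_def power_mult_distrib power2_eq_square)
  qed
  have e_nz: "bs x \<noteq> 0" "Ps j x \<noteq> 0" if "e x \<noteq> 0" for x j
    using that by (auto simp: e_def)
  have main: "(LINT x|lebesgue. G_fun Ps Qs (\<lambda>j. twist (chis j) (s $ j)) (chr t) x *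
        (wirt i (\<lambda>x. h ((e x)\<^sup>2) * \<phi> x) x + \<i> * of_real t * c0 * (h (A i x) * \<phi> x)
          + (\<Sum>j\<in>UNIV. (\<sigma> j + s $ j * \<sigma>') * (h (R i j x) * \<phi> x)))) = 0"
    if s: "\<And>j. Re (s $ j) > c" and \<phi>: "\<And>x. \<phi> differentiable (at x)" "rapid_decay \<phi>" "\<And>v. rapid_decay (dir_deriv v \<phi>)"
    for i t \<phi> and s :: "complex ^ 'l"
  proof -
    define G where "G = (\<lambda>x. chr t (as x / bs x) * (\<Prod>j\<in>UNIV. twist (chis j) (s $ j) (Ps j x)))"
    define u where "u = (\<lambda>j x (w :: 'f ^ 'n). (\<Sum>i\<in>UNIV. P' j i x * w $ i) / Ps j x)"
    define z where "z = (\<lambda>x. scalar_product (\<chi> i. n i x / (bs x)\<^sup>2))"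
    define L where "L = (\<lambda>x w. \<i> * of_real (t * Re (h (z x w))) + (\<Sum>j\<in>UNIV. l j (u j x w) + of_nat DIM('f) * s $ j * m (u j x w)))"
    have G_deriv: "(G has_derivative (\<lambda>w. G x * L x w)) (at x)" if x: "e x \<noteq> 0" for x
    proof -
      have 1: "((\<lambda>x. chr t (as x / bs x)) has_derivative (\<lambda>w. \<i> * of_real (t * Re (h (z x w))) * chr t (as x / bs x))) (at x)"
        unfolding z_def by (rule has_derivative_compose[OF n(2)[OF e_nz(1)[OF x]] chr_has_derivative])
      have 2: "((\<lambda>x. twist (chis j) (s $ j) (Ps j x)) has_derivative
          (\<lambda>w. twist (chis j) (s $ j) (Ps j x) * (l j (u j x w) + of_nat DIM('f) * s $ j * m (u j x w)))) (at x)" for j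
        unfolding u_def by (rule has_derivative_compose[OF P'(2) twist_has_derivative[OF l(2) m(2) e_nz(2)[OF x]]])
      show ?thesis
        unfolding G_def L_def
        by (rule has_derivative_eq_rhs[OF has_derivative_mult[OF 1 has_derivative_prod_log[OF finite 2]]])
           (simp add: fun_eq_iff algebra_simps)
    qed
    have G_cont: "continuous_on {x. e x \<noteq> 0} G"
      using G_deriv by (intro continuous_at_imp_continuous_on) (auto intro: has_derivative_continuous)
    have G_growth: "poly_growth_on {x. e x \<noteq> 0} G"
    proof (rule poly_growth_on_mono)
      show "poly_growth_on {x. e x \<noteq> 0} (\<lambda>x. \<Prod>j\<in>UNIV. M j * norm (Ps j x) powr (\<tau> j + DIM('f) * Re (s $ j)))"
      proof (intro poly_growth_on_prod poly_growth_on_mult poly_growth_on_const poly_growth_on_powr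
          poly_growth_on_polynomial nonzero_polynomialD Ps)
        fix j
        have "\<bar>\<tau> j\<bar> \<le> c" unfolding c_def by (rule member_le_sum) auto
        then have "Re (s $ j) > \<bar>\<tau> j\<bar>" using s[of j] by linarith
        moreover have "1 * Re (s $ j) \<le> DIM('f) * Re (s $ j)"
          using DIM_positive[where 'a='f] calculation by (intro mult_right_mono) (auto simp: Suc_le_eq)
        ultimately show "0 \<le> \<tau> j + DIM('f) * Re (s $ j)" by linarith
      qed
      fix x assume x: "x \<in> {x. e x \<noteq> 0}"
      have "norm (G x) = (\<Prod>j\<in>UNIV. norm (twist (chis j) (s $ j) (Ps j x)))"
        by (simp add: G_def norm_mult prod_norm)
      also have "\<dots> \<le> (\<Prod>j\<in>UNIV. M j * norm (Ps j x) powr (\<tau> j + DIM('f) * Re (s $ j)))"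
        using x by (intro prod_mono conjI twist_bound M e_nz(2)) auto
      finally show "norm (G x) \<le> 1 * norm (\<Prod>j\<in>UNIV. M j * norm (Ps j x) powr (\<tau> j + DIM('f) * Re (s $ j)))"
        by simp
    qed simp
    have z_axis: "z x (axis i q) = q * (n i x / (bs x)\<^sup>2)" for x i q
      by (simp add: z_def scalar_product_axis)
    have u_axis: "u j x (axis i q) = q * (P' j i x / Ps j x)" for j x i q
      by (simp add: u_def axis_def if_distrib cong: if_cong)
    have L_growth: "poly_growth_on {x. e x \<noteq> 0} (\<lambda>x. L x (axis i q) * h ((e x)\<^sup>2))" for q
    proof -
      have "poly_growth_on {x. e x \<noteq> 0} (\<lambda>x. \<i> * of_real (t * Re (h (z x (axis i q)))) * h ((e x)\<^sup>2))"
      proof (rule poly_growth_on_mono[OF poly_growth_on_polynomial[OF A_poly[of i]]])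
        fix x assume "x \<in> {x. e x \<noteq> 0}"
        then have "A i x = (e x)\<^sup>2 * (n i x / (bs x)\<^sup>2)" using A_eq e_nz(1) by simp
        moreover have "\<bar>Re (h (z x (axis i q)))\<bar> * norm ((e x)\<^sup>2) \<le> norm (z x (axis i q)) * norm ((e x)\<^sup>2)"
          using abs_Re_le_cmod[of "h (z x (axis i q))"] by (intro mult_right_mono) (auto simp: h_norm)
        moreover from calculation(1) have "norm (z x (axis i q)) * norm ((e x)\<^sup>2) = norm q * norm (A i x)"
          by (simp add: z_axis norm_mult norm_divide mult_ac)
        ultimately have "\<bar>Re (h (z x (axis i q)))\<bar> * norm ((e x)\<^sup>2) \<le> norm q * norm (A i x)"
          by simp
        from mult_left_mono[OF this, of "\<bar>t\<bar>"]
        show "norm (\<i> * of_real (t * Re (h (z x (axis i q)))) * h ((e x)\<^sup>2)) \<le> (\<bar>t\<bar> * norm q) * norm (A i x)"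
          by (simp add: norm_mult h_norm abs_mult mult_ac del: of_real_mult)
      qed simp
      moreover have "poly_growth_on {x. e x \<noteq> 0} (\<lambda>x. g (u j x (axis i q)) * h ((e x)\<^sup>2))"
        if g: "bounded_linear g" for g :: "'f \<Rightarrow> complex" and j
      proof -
        obtain B where B: "B > 0" "\<And>y. norm (g y) \<le> norm y * B"
          using bounded_linear.pos_bounded[OF g] by blast
        show ?thesis
        proof (rule poly_growth_on_mono[OF poly_growth_on_polynomial[OF R_poly[of i j]]])
          fix x assume "x \<in> {x. e x \<noteq> 0}"
          then have "R i j x = (e x)\<^sup>2 * (P' j i x / Ps j x)" using R_eq by simp
          then have "norm (u j x (axis i q)) * norm ((e x)\<^sup>2) = norm q * norm (R i j x)"
            by (simp add: u_axis norm_mult norm_divide mult_ac)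
          then show "norm (g (u j x (axis i q)) * h ((e x)\<^sup>2)) \<le> (B * norm q) * norm (R i j x)"
            using mult_right_mono[OF B(2)[of "u j x (axis i q)"], of "norm ((e x)\<^sup>2)"]
            by (simp add: norm_mult h_norm mult_ac)
        qed (use B in simp)
      qed
      ultimately have "poly_growth_on {x. e x \<noteq> 0} (\<lambda>x. \<i> * of_real (t * Re (h (z x (axis i q)))) * h ((e x)\<^sup>2)
          + (\<Sum>j\<in>UNIV. l j (u j x (axis i q)) * h ((e x)\<^sup>2) + of_nat DIM('f) * s $ j * (m (u j x (axis i q)) * h ((e x)\<^sup>2))))"
        using l(1) m(1)
        by (intro poly_growth_on_add poly_growth_on_sum poly_growth_on_mult[OF poly_growth_on_const]) auto
      then show ?thesis
        by (simp add: L_def distrib_right sum_distrib_right mult.assoc)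
    qed
    define F where "F = (\<lambda>q x. if e x = 0 then 0 else
      G x * (L x (axis i q) * h ((e x)\<^sup>2) * \<phi> x + dir_deriv (axis i q) (\<lambda>x. h ((e x)\<^sup>2) * \<phi> x) x))"
    have F: "(LINT x|lborel. F q x) = 0" "integrable lborel (F q)" for q
      unfolding F_def
      by (rule integral_log_derivative[OF e_poly G_cont G_growth G_deriv L_growth \<phi>]; assumption)+
    have FF: "k1 * F 1 x + k2 * F J x = G_fun Ps Qs (\<lambda>j. twist (chis j) (s $ j)) (chr t) x *
        (wirt i (\<lambda>x. h ((e x)\<^sup>2) * \<phi> x) x + \<i> * of_real t * c0 * (h (A i x) * \<phi> x)
          + (\<Sum>j\<in>UNIV. (\<sigma> j + s $ j * \<sigma>') * (h (R i j x) * \<phi> x)))" if x: "e x \<noteq> 0" for x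
    proof -
      let ?z = "n i x / (bs x)\<^sup>2" and ?u = "\<lambda>j. P' j i x / Ps j x"
      have G_eq: "G_fun Ps Qs (\<lambda>j. twist (chis j) (s $ j)) (chr t) x = G x"
        using Qs[OF e_nz(1)[OF x]] by (simp add: G_fun_def G_def)
      have "k1 * L x (axis i 1) + k2 * L x (axis i J) =
          \<i> * of_real t * (k1 * of_real (Re (h ?z)) + k2 * of_real (Re (h (J * ?z)))) +
          (\<Sum>j\<in>UNIV. (k1 * l j (?u j) + k2 * l j (J * ?u j)) + of_nat DIM('f) * s $ j * (k1 * m (?u j) + k2 * m (J * ?u j)))"
        by (simp add: L_def z_axis u_axis algebra_simps sum_distrib_left sum.distrib)
      also have "\<dots> = \<i> * of_real t * c0 * h ?z + (\<Sum>j\<in>UNIV. (\<sigma> j + s $ j * \<sigma>') * h (?u j))"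
        unfolding wirtinger_Re \<sigma> \<sigma>m \<sigma>'_def by (simp add: algebra_simps)
      finally have LL: "k1 * L x (axis i 1) + k2 * L x (axis i J) =
          \<i> * of_real t * c0 * h ?z + (\<Sum>j\<in>UNIV. (\<sigma> j + s $ j * \<sigma>') * h (?u j))" .
      have "k1 * F 1 x + k2 * F J x = G x * ((k1 * L x (axis i 1) + k2 * L x (axis i J)) * h ((e x)\<^sup>2) * \<phi> x
          + wirt i (\<lambda>x. h ((e x)\<^sup>2) * \<phi> x) x)"
        using x by (simp add: F_def wirt_def algebra_simps)
      also have "(k1 * L x (axis i 1) + k2 * L x (axis i J)) * h ((e x)\<^sup>2) * \<phi> x =
          \<i> * of_real t * c0 * (h ((e x)\<^sup>2 * ?z) * \<phi> x) + (\<Sum>j\<in>UNIV. (\<sigma> j + s $ j * \<sigma>') * (h ((e x)\<^sup>2 * ?u j) * \<phi> x))"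
        unfolding LL h_mult by (simp add: algebra_simps sum_distrib_left sum_distrib_right sum.distrib)
      finally show ?thesis
        using A_eq[OF e_nz(1)[OF x], of i] R_eq[OF x, of i] by (simp add: G_eq algebra_simps)
    qed
    \<comment> \<open>The total functions carry arbitrary values where \<open>e\<close> vanishes,
      while the functions \<open>F\<close> are 0 there; the zero set is negligible, so the integrals
      agree.\<close>
    have "(LINT x|lebesgue. G_fun Ps Qs (\<lambda>j. twist (chis j) (s $ j)) (chr t) x *
        (wirt i (\<lambda>x. h ((e x)\<^sup>2) * \<phi> x) x + \<i> * of_real t * c0 * (h (A i x) * \<phi> x)
          + (\<Sum>j\<in>UNIV. (\<sigma> j + s $ j * \<sigma>') * (h (R i j x) * \<phi> x)))) = (LINT x|lborel. k1 * F 1 x + k2 * F J x)"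
      by (rule integral_lebesgue_spike[OF _ negligible_zeros_polynomial[OF e]])
         (use F(2) FF in \<open>auto intro!: borel_measurable_add borel_measurable_times\<close>)
    also have "\<dots> = 0" using F by simp
    finally show ?thesis .
  qed
  show ?thesis
  proof (rule exI[of _ A], rule exI[of _ R], rule exI[of _ \<sigma>], rule exI[of _ \<sigma>'], rule exI[of _ c], intro conjI allI impI)
    show "A i x = (e x)\<^sup>2 * partial_deriv i Qs x" if "e x \<noteq> 0" for i x
      using A_eq partial e_nz(1)[OF that] by simp
  qed (simp add: A_poly, simp add: R_poly, rule main, simp_all)
qed

end

subsection \<open>The distributions on test functions\<close>

text \<open>Linearity is assumed on Schwartz functions, so each partial sum must be recognised as
  the transform of a test function.\<close>

lemma tempered_distribution_sum_ft:
  assumes T: "tempered_distribution T" and D: "symmetric_isometry D" and t: "t \<noteq> 0" and I: "finite I"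
    and f: "\<And>i. i \<in> I \<Longrightarrow> test_fun_on UNIV (f i)"
  shows "T (\<lambda>x. \<Sum>i\<in>I. c i * symmetric_isometry.ft D t (f i) x) = (\<Sum>i\<in>I. c i * T (symmetric_isometry.ft D t (f i)))"
proof -
  interpret symmetric_isometry D by (rule D)
  have add: "\<And>f g. f \<in> schwartz \<Longrightarrow> g \<in> schwartz \<Longrightarrow> T (\<lambda>x. f x + g x) = T f + T g"
    and scale: "\<And>f c. f \<in> schwartz \<Longrightarrow> T (\<lambda>x. c * f x) = c * T f"
    using T unfolding tempered_distribution_def by blast+
  show ?thesis
    using I f
  proof (induction I rule: finite_induct)
    case empty
    show ?case using scale[OF test_fun_schwartz[OF test_fun_on_zero[of UNIV]], of 0] by simp
  next
    case (insert i I)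
    have "ft t (\<lambda>x. c i * f i x) \<in> schwartz" "ft t (\<lambda>x. \<Sum>j\<in>I. c j * f j x) \<in> schwartz"
      using insert by (auto intro!: ft_schwartz[OF t] test_fun_on_cmult test_fun_on_sum)
    moreover have "ft t (\<lambda>x. \<Sum>j\<in>I. c j * f j x) = (\<lambda>x. \<Sum>j\<in>I. c j * ft t (f j) x)"
    proof
      fix x
      have "test_fun_on UNIV (\<lambda>x. c j * f j x)" if "j \<in> I" for j
        using insert(4)[of j] that by (intro test_fun_on_cmult) auto
      from ft_sum[OF this] show "ft t (\<lambda>x. \<Sum>j\<in>I. c j * f j x) x = (\<Sum>j\<in>I. c j * ft t (f j) x)"
        by (simp add: ft_cmult)
    qed
    moreover have "ft t (\<lambda>x. c i * f i x) = (\<lambda>x. c i * ft t (f i) x)" by (auto simp: ft_cmult)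
    ultimately have "T (\<lambda>x. c i * ft t (f i) x + (\<Sum>j\<in>I. c j * ft t (f j) x)) =
        T (\<lambda>x. c i * ft t (f i) x) + T (\<lambda>x. \<Sum>j\<in>I. c j * ft t (f j) x)"
      using add[of "ft t (\<lambda>x. c i * f i x)" "ft t (\<lambda>x. \<Sum>j\<in>I. c j * f j x)"] by simp
    also have "T (\<lambda>x. c i * ft t (f i) x) = c i * T (ft t (f i))"
      using insert by (intro scale ft_schwartz[OF t]) auto
    finally show ?case using insert by simp
  qed
qed

lemma continuous_on_Times_test_fun:
  fixes g :: "complex \<Rightarrow> 'v::euclidean_space \<Rightarrow> complex"
  assumes S: "open S" and g: "continuous_on (UNIV \<times> S) (\<lambda>(z, x). g z x)" and f: "test_fun_on S f"
  shows "continuous_on UNIV (\<lambda>(z, x). g z x * f x)"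
proof -
  obtain K where K: "compact K" "K \<subseteq> S" "\<And>x. x \<notin> K \<Longrightarrow> f x = 0"
    using f unfolding test_fun_on_def by blast
  have cont_f: "continuous_on T (\<lambda>p. f (snd p))" for T :: "(complex \<times> 'v) set"
    by (rule continuous_on_compose2[OF continuous_test_fun[OF f, of UNIV]]) (auto intro: continuous_intros)
  have "continuous_on (UNIV \<times> S \<union> UNIV \<times> (- K)) (\<lambda>p. g (fst p) (snd p) * f (snd p))"
  proof (rule continuous_on_open_Un)
    show "continuous_on (UNIV \<times> S) (\<lambda>p. g (fst p) (snd p) * f (snd p))"
      using g by (intro continuous_intros cont_f) (simp add: case_prod_unfold)
    show "continuous_on (UNIV \<times> (- K)) (\<lambda>p. g (fst p) (snd p) * f (snd p))"
      by (subst continuous_on_cong[OF refl, of _ _ "\<lambda>x. 0"]) (use K in auto)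
  qed (use S K in \<open>auto intro: open_Times compact_imp_closed\<close>)
  moreover have "UNIV \<times> S \<union> UNIV \<times> (- K) = (UNIV :: (complex \<times> 'v) set)" using K by auto
  ultimately show ?thesis by (simp add: case_prod_unfold)
qed

text \<open>On \<open>S\<close> no \<open>P j\<close> vanishes, so moving the parameter along a line
  multiplies the integrand by \<open>exp (z * \<Lambda> x)\<close> with \<Lambda> continuous there.
  With compact support the integral can be differentiated in \<open>z\<close> for every value of
  \<open>s\<close>.\<close>

lemma line_holomorphic_integral_twist:
  fixes P :: "'k::finite \<Rightarrow> 'f::real_or_complex ^ 'n \<Rightarrow> 'f"
  assumes S: "open S" and \<psi>: "continuous_on S (\<lambda>x. \<psi> (Q x))" and P: "\<And>j. continuous_on S (P j)"
    and nz: "\<And>j x. x \<in> S \<Longrightarrow> P j x \<noteq> 0" and chi: "\<And>j. multiplicative_char (chi j)" and f: "test_fun_on S f"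
  shows "line_holomorphic (\<lambda>s. LINT x|lebesgue. G_fun P Q (\<lambda>j. twist (chi j) (s $ j)) \<psi> x * f x) UNIV"
  unfolding line_holomorphic_def
proof (intro ballI allI)
  fix s v :: "complex ^ 'k"
  obtain a where a: "\<And>x. x \<notin> cbox (-a) a \<Longrightarrow> f x = 0" using test_fun_on_cbox[OF f] by blast
  define \<Lambda> where "\<Lambda> = (\<lambda>x. \<Sum>j\<in>UNIV. of_nat DIM('f) * v $ j * complex_of_real (ln (norm (P j x))))"
  define g where "g = (\<lambda>x. G_fun P Q (\<lambda>j. twist (chi j) (s $ j)) \<psi> x)"
  have \<Lambda>: "continuous_on S \<Lambda>"
    unfolding \<Lambda>_def using nz by (intro continuous_intros P) auto
  have g: "continuous_on S g"
  proof -
    have "continuous_on S (\<lambda>x. chi j (P j x))" for j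
      using chi[of j] nz by (intro continuous_on_compose2[OF _ P[of j], of "- {0}"]) (auto simp: multiplicative_char_def)
    moreover have "continuous_on S (\<lambda>x. complex_of_real (norm (P j x)) powr w)" for j w
    proof (rule continuous_on_cong[THEN iffD1])
      show "continuous_on S (\<lambda>x. exp (w * complex_of_real (ln (norm (P j x)))))"
        using nz by (intro continuous_intros P) auto
      show "exp (w * complex_of_real (ln (norm (P j x)))) = complex_of_real (norm (P j x)) powr w" if "x \<in> S" for x
        using nz[OF that] by (simp add: powr_def Ln_of_real)
    qed simp
    ultimately show ?thesis
      unfolding g_def G_fun_def twist_def by (intro continuous_on_mult continuous_on_prod \<psi>)
  qed
  have eq: "G_fun P Q (\<lambda>j. twist (chi j) ((s + z *s v) $ j)) \<psi> x * f x = g x * exp (z * \<Lambda> x) * f x" for z x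
  proof (cases "x \<in> S")
    case True
    have "twist (chi j) ((s + z *s v) $ j) (P j x) =
        twist (chi j) (s $ j) (P j x) * exp (z * (of_nat DIM('f) * v $ j * complex_of_real (ln (norm (P j x)))))" for j
      using nz[OF True, of j]
      by (simp add: twist_def powr_def Ln_of_real algebra_simps flip: exp_add)
    then have "(\<Prod>j\<in>UNIV. twist (chi j) ((s + z *s v) $ j) (P j x)) =
        (\<Prod>j\<in>UNIV. twist (chi j) (s $ j) (P j x)) * exp (z * \<Lambda> x)"
      unfolding \<Lambda>_def sum_distrib_left by (simp add: prod.distrib exp_sum)
    then show ?thesis by (simp add: G_fun_def g_def)
  next
    case False
    then show ?thesis using f unfolding test_fun_on_def by (metis mult_zero_right subsetD)
  qed
  have cont: "continuous_on (UNIV \<times> S) (\<lambda>(z, x). g x * exp (z * \<Lambda> x))" "continuous_on (UNIV \<times> S) (\<lambda>(z, x). g x * \<Lambda> x * exp (z * \<Lambda> x))"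
    unfolding case_prod_unfold
    by (intro continuous_intros continuous_on_compose2[OF g] continuous_on_compose2[OF \<Lambda>]; auto)+
  note cont' = continuous_on_Times_test_fun[OF S cont(1) f] continuous_on_Times_test_fun[OF S cont(2) f]
  have cont_x: "continuous_on T (\<lambda>x. g x * exp (z * \<Lambda> x) * f x)" for z T
    using continuous_on_compose2[OF cont'(1), of T "\<lambda>x. (z, x)"] by (auto intro!: continuous_intros simp: continuous_on_Pair)
  have int: "(LINT x|lebesgue. g x * exp (z * \<Lambda> x) * f x) = integral (cbox (-a) a) (\<lambda>x. g x * exp (z * \<Lambda> x) * f x)" for z
  proof -
    have "(LINT x|lebesgue. g x * exp (z * \<Lambda> x) * f x) = (LINT x|lborel. g x * exp (z * \<Lambda> x) * f x)"
      using borel_measurable_continuous_onI[OF cont_x[of UNIV z]] by (intro integral_completion) simp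
    also have "\<dots> = integral (cbox (-a) a) (\<lambda>x. g x * exp (z * \<Lambda> x) * f x)"
      by (rule integral_eq_integral_cbox[OF cont_x]) (simp add: a)
    finally show ?thesis .
  qed
  have "((\<lambda>z. integral (cbox (-a) a) (\<lambda>x. g x * exp (z * \<Lambda> x) * f x)) has_field_derivative
      integral (cbox (-a) a) (\<lambda>x. g x * \<Lambda> x * exp (0 * \<Lambda> x) * f x)) (at 0 within UNIV)"
  proof (rule leibniz_rule_field_derivative)
    show "((\<lambda>z. g x * exp (z * \<Lambda> x) * f x) has_field_derivative g x * \<Lambda> x * exp (z * \<Lambda> x) * f x) (at z within UNIV)" for z x
      by (auto intro!: derivative_eq_intros)
    show "(\<lambda>x. g x * exp (z * \<Lambda> x) * f x) integrable_on cbox (-a) a" for z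
      by (rule integrable_continuous[OF cont_x])
    show "continuous_on (UNIV \<times> cbox (-a) a) (\<lambda>(z, x). g x * \<Lambda> x * exp (z * \<Lambda> x) * f x)"
      by (rule continuous_on_subset[OF cont'(2)]) simp
  qed auto
  then show "(\<lambda>z. LINT x|lebesgue. G_fun P Q (\<lambda>j. twist (chi j) ((s + z *s v) $ j)) \<psi> x * f x) field_differentiable (at 0)"
    unfolding eq int field_differentiable_def by auto
qed

text \<open>Off the zeros of the \<open>P j\<close> the continued distribution is still given by the
  function: on a test function supported there both sides are holomorphic in the parameter, and they
  agree when all real parts are large.\<close>

lemma G_distribution_test_fun:
  fixes P :: "'k::finite \<Rightarrow> 'f::real_or_complex ^ 'n \<Rightarrow> 'f"
  assumes T: "G_distribution P Q chi \<psi> T0"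
    and S: "open S" and \<psi>: "continuous_on S (\<lambda>x. \<psi> (Q x))" and P: "\<And>j. continuous_on S (P j)"
    and nz: "\<And>j x. x \<in> S \<Longrightarrow> P j x \<noteq> 0" and chi: "\<And>j. multiplicative_char (chi j)" and f: "test_fun_on S f"
  shows "T0 f = (LINT x|lebesgue. G_fun P Q chi \<psi> x * f x)"
proof -
  obtain U T c where T: "meromorphic_family U T" and c: "\<And>(s :: complex ^ 'k) f. s \<in> U \<Longrightarrow> (\<And>j. Re (s $ j) > c) \<Longrightarrow> f \<in> schwartz \<Longrightarrow>
      T s f = distribution_of (G_fun P Q (\<lambda>j. twist (chi j) (s $ j)) \<psi>) f"
    and U: "0 \<in> U" and T0: "\<And>f. f \<in> schwartz \<Longrightarrow> T0 f = T 0 f"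
    using T unfolding G_distribution_def by blast
  define E where "E = (\<lambda>s :: complex ^ 'k. LINT x|lebesgue. G_fun P Q (\<lambda>j. twist (chi j) (s $ j)) \<psi> x * f x)"
  note fs = test_fun_schwartz[OF f]
  have "(\<Sum>i\<in>{()}. 1 * T 0 f) = E 0"
  proof (rule meromorphic_family_identity[OF T _ _ _ _ U, of "{()}" "\<lambda>_. f" "\<lambda>_ _. 1" E c])
    show "line_holomorphic E UNIV"
      unfolding E_def by (rule line_holomorphic_integral_twist[OF S \<psi> P nz chi f])
    show "(\<Sum>i\<in>{()}. 1 * T s f) = E s" if "s \<in> U" "\<And>j. Re (s $ j) > c" for s :: "complex ^ 'k"
      using c[OF that fs] by (simp add: E_def distribution_of_def)
  qed (auto intro: fs line_holomorphic_const)
  also have "E 0 = (LINT x|lebesgue. G_fun P Q chi \<psi> x * f x)"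
    unfolding E_def
  proof (rule arg_cong[where f="integral\<^sup>L lebesgue"], rule ext)
    fix x
    show "G_fun P Q (\<lambda>j. twist (chi j) ((0 :: complex ^ 'k) $ j)) \<psi> x * f x = G_fun P Q chi \<psi> x * f x"
    proof (cases "x \<in> S")
      case True
      then show ?thesis using nz by (simp add: G_fun_def twist_zero)
    next
      case False
      then show ?thesis using f unfolding test_fun_on_def by (metis mult_zero_right subsetD)
    qed
  qed
  finally show ?thesis using T0[OF fs] by simp
qed

subsection \<open>Functions polynomial in \<open>1 / t\<close>\<close>

text \<open>The last argument is the coefficient of order zero in \<open>1 / t\<close>, recorded
  because it alone survives in the limit. The expansion is finite and exact, which makes the class
  stable under differentiation without remainder estimates.\<close>

inductive asymptotic_family :: "'v::euclidean_space set \<Rightarrow> (real \<Rightarrow> 'v \<Rightarrow> complex) \<Rightarrow> ('v \<Rightarrow> complex) \<Rightarrow> bool" for S where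
  const: "test_fun_on S a \<Longrightarrow> asymptotic_family S (\<lambda>t. a) a"
| step: "asymptotic_family S A b \<Longrightarrow> test_fun_on S a \<Longrightarrow> asymptotic_family S (\<lambda>t x. a x + A t x / of_real t) a"

lemma asymptotic_family_test_fun:
  "asymptotic_family S A a \<Longrightarrow> test_fun_on S a \<and> (\<forall>t. test_fun_on S (A t))"
proof (induction rule: asymptotic_family.induct)
  case (step A b a)
  then have "test_fun_on S (\<lambda>x. a x + (1 / of_real t) * A t x)" for t
    by (intro test_fun_on_add test_fun_on_cmult) auto
  then show ?case using step by simp
qed auto

lemma asymptotic_family_add:
  assumes "asymptotic_family S A a" "asymptotic_family S B b"
  shows "asymptotic_family S (\<lambda>t x. A t x + B t x) (\<lambda>x. a x + b x)"
  using assms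
proof (induction arbitrary: B b rule: asymptotic_family.induct)
  case (const a)
  from const(2,1) show ?case
  proof (induction rule: asymptotic_family.induct)
    case (step B b' b)
    have "asymptotic_family S (\<lambda>t x. (a x + b x) + B t x / of_real t) (\<lambda>x. a x + b x)"
      by (rule asymptotic_family.step[OF step.hyps(1) test_fun_on_add[OF step.prems step.hyps(2)]])
    then show ?case by (simp add: add.assoc)
  qed (auto intro: asymptotic_family.const test_fun_on_add)
next
  case (step A a' a)
  note IH = step.IH and hyps = step.hyps
  from step.prems show ?case
  proof (cases rule: asymptotic_family.cases)
    case const
    have "asymptotic_family S (\<lambda>t x. (a x + b x) + A t x / of_real t) (\<lambda>x. a x + b x)"
      by (rule asymptotic_family.step[OF hyps(1) test_fun_on_add[OF hyps(2) \<open>test_fun_on S b\<close>]])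
    then show ?thesis using const by (simp add: add.assoc add.commute[of "b _"])
  next
    case (step B' b')
    have "asymptotic_family S (\<lambda>t x. (a x + b x) + (A t x + B' t x) / of_real t) (\<lambda>x. a x + b x)"
      by (rule asymptotic_family.step[OF IH[OF step(2)] test_fun_on_add[OF hyps(2) \<open>test_fun_on S b\<close>]])
    then show ?thesis using step by (simp add: add_divide_distrib algebra_simps)
  qed
qed

lemma asymptotic_family_mult:
  assumes "open S" "smooth_on S u" "asymptotic_family S A a"
  shows "asymptotic_family S (\<lambda>t x. u x * A t x) (\<lambda>x. u x * a x)"
  using assms(3)
proof (induction rule: asymptotic_family.induct)
  case (step A b a)
  have "asymptotic_family S (\<lambda>t x. u x * a x + (u x * A t x) / of_real t) (\<lambda>x. u x * a x)"
    by (rule asymptotic_family.step[OF step.IH test_fun_on_mult[OF assms(1,2) step.hyps(2)]])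
  then show ?case by (simp add: algebra_simps)
qed (intro asymptotic_family.const test_fun_on_mult assms)

lemma asymptotic_family_shift:
  assumes "asymptotic_family S A a" "asymptotic_family S B b"
  shows "asymptotic_family S (\<lambda>t x. A t x + B t x / of_real t) a"
  using asymptotic_family_add[OF assms(1) asymptotic_family.step[OF assms(2) test_fun_on_zero]] by simp

lemma asymptotic_family_sum:
  assumes "\<And>i. i \<in> I \<Longrightarrow> asymptotic_family S (A i) (a i)"
  shows "asymptotic_family S (\<lambda>t x. \<Sum>i\<in>I. A i t x) (\<lambda>x. \<Sum>i\<in>I. a i x)"
  using assms
proof (induction I rule: infinite_finite_induct)
  case (insert i I)
  then show ?case by (simp add: asymptotic_family_add)
qed (auto intro!: asymptotic_family.const test_fun_on_zero)

lemma asymptotic_family_limit: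
  assumes S: "open S" and g: "continuous_on S g" and A: "asymptotic_family S A a"
  shows "((\<lambda>t. LINT x|lborel. g x * A t x) \<longlongrightarrow> (LINT x|lborel. g x * a x)) at_top"
  using A
proof (induction rule: asymptotic_family.induct)
  case (step A b a)
  have int: "integrable lborel (\<lambda>x. g x * A t x)" "integrable lborel (\<lambda>x. g x * a x)" for t
    using asymptotic_family_test_fun[OF step(1)] step(2) by (auto intro!: integrable_mult_test_fun[OF S g])
  have "(LINT x|lborel. g x * (a x + A t x / of_real t)) =
      (LINT x|lborel. g x * a x) + (LINT x|lborel. g x * A t x) * of_real (inverse t)" for t
    using int by (simp add: distrib_left divide_inverse mult.assoc[symmetric])
  moreover have "((\<lambda>t. (LINT x|lborel. g x * a x) + (LINT x|lborel. g x * A t x) * of_real (inverse t)) \<longlongrightarrow>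
      (LINT x|lborel. g x * a x) + (LINT x|lborel. g x * b x) * of_real 0) at_top"
    by (intro tendsto_intros step tendsto_of_real tendsto_inverse_0_at_top filterlim_ident)
  ultimately show ?case by simp
qed simp

subsection \<open>The key identity\<close>

context field_embedding begin

lemma smooth_on_h_polynomial:
  fixes p :: "'f ^ 'n \<Rightarrow> 'f"
  assumes S: "open S" and p: "polynomial_fun p" shows "smooth_on S (\<lambda>x. h (p x))"
  using p
proof induction
  case (coord i)
  show ?case
    by (rule smooth_on_linear) (rule bounded_linear_compose[OF h_bounded_linear bounded_linear_vec_nth])
qed (simp_all add: h_add h_mult smooth_on_const smooth_on_add[OF S] smooth_on_mult[OF S])

lemma smooth_on_h_quotient:
  fixes a b :: "'f ^ 'n \<Rightarrow> 'f"
  assumes S: "open S" and a: "polynomial_fun a" and b: "polynomial_fun b"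
    and Q: "\<And>x. x \<in> S \<Longrightarrow> b x \<noteq> 0 \<and> Q x = a x / b x"
  shows "smooth_on S (\<lambda>x. h (Q x))"
proof (rule smooth_on_cong[OF S])
  show "smooth_on S (\<lambda>x. h (a x) * inverse (h (b x)))"
    using Q by (intro smooth_on_mult[OF S] smooth_on_inverse[OF S] smooth_on_h_polynomial[OF S] a b) auto
  show "h (Q x) = h (a x) * inverse (h (b x))" if "x \<in> S" for x
    using Q[OF that] by (simp add: h_divide) (simp add: divide_inverse)
qed

end

context fourier_pairing begin

lemma smooth_on_chr:
  assumes S: "open S" and Q: "smooth_on S (\<lambda>x. h (Q x))" shows "smooth_on S (\<lambda>x. chr t (Q x))"
  unfolding chr_def
proof (rule smooth_on_exp[OF S])
  have "bounded_linear (\<lambda>w. \<i> * complex_of_real (t * Re w))"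
    by (intro bounded_linear_const_mult bounded_linear_compose[OF bounded_linear_of_real] bounded_linear_Re)
  from smooth_on_compose_linear[OF S Q this] show "smooth_on S (\<lambda>x. \<i> * complex_of_real (t * Re (h (Q x))))" .
qed

section \<open>Coordinates and Wirtinger operators under the Fourier transform\<close>

lemma fourier_chr:
  assumes "continuous_on UNIV f" shows "fourier (chr t) f = ft t f"
proof
  fix y
  have "(\<lambda>x. wave t y x * f x) \<in> borel_measurable borel"
    by (intro borel_measurable_continuous_onI continuous_intros assms)
  then show "fourier (chr t) f y = ft t f y"
    unfolding fourier_def ft_def wave_eq_chr[symmetric] by (intro integral_completion) simp
qed

lemma test_fun_on_wirt: "test_fun_on S f \<Longrightarrow> test_fun_on S (wirt i f)"
  unfolding wirt_def[abs_def] by (intro test_fun_on_add test_fun_on_cmult test_fun_on_dir_deriv)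

text \<open>The two real directional derivatives contribute the real parts of
  \<open>h (y $ i)\<close> and \<open>h (J * y $ i)\<close>. Their combination with weights
  \<open>k1\<close> and \<open>k2\<close> is \<open>c0 * h (y $ i)\<close>, so the operator
  corresponds to the coordinate itself and not to its conjugate.\<close>

lemma mult_ft:
  assumes t: "t \<noteq> 0" and f: "test_fun_on UNIV f"
  shows "h (y $ i) * ft (-t) f y = ft (-t) (\<lambda>x. 1 / (\<i> * of_real t * c0) * wirt i f x) y"
proof -
  have D_axis: "D y \<bullet> axis i q = Re (h (q * y $ i))" for q
    by (simp add: D_eq scalar_product_axis mult.commute)
  have "ft (-t) (wirt i f) y = k1 * ft (-t) (dir_deriv (axis i 1) f) y + k2 * ft (-t) (dir_deriv (axis i J) f) y"
    unfolding wirt_def[abs_def]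
    by (subst ft_add[of UNIV]) (auto simp: ft_cmult intro!: test_fun_on_cmult test_fun_on_dir_deriv f)
  also have "\<dots> = \<i> * of_real t * (k1 * of_real (Re (h (y $ i))) + k2 * of_real (Re (h (J * y $ i)))) * ft (-t) f y"
    by (simp add: ft_dir_deriv_fun[OF f] D_axis algebra_simps)
  finally have "ft (-t) (wirt i f) y = \<i> * of_real t * c0 * (h (y $ i) * ft (-t) f y)"
    by (simp add: wirtinger_Re mult.assoc)
  then show ?thesis unfolding ft_cmult using t c0 by simp
qed

lemma wirt_ft:
  assumes f: "test_fun_on UNIV f"
  shows "wirt i (ft (-t) f) y = ft (-t) (\<lambda>x. - (\<i> * of_real t * c0) * (h (x $ i) * f x)) y"
proof -
  have D_axis: "D (axis i q) \<bullet> x = Re (h (q * x $ i))" for q x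
    by (simp add: D_eq scalar_product_axis)
  define g where "g = (\<lambda>q x. \<i> * of_real (- t * (D (axis i q) \<bullet> x)) * f x)"
  have g: "test_fun_on UNIV (g q)" for q
    unfolding g_def by (rule test_fun_on_inner_mult[OF f open_UNIV])
  have dir: "dir_deriv (axis i q) (ft (-t) f) y = ft (-t) (g q) y" for q
    unfolding dir_deriv_ft[OF f] g_def ..
  have "wirt i (ft (-t) f) y = ft (-t) (\<lambda>x. k1 * g 1 x + k2 * g J x) y"
    unfolding wirt_def dir
    by (subst ft_add[OF test_fun_on_cmult[OF g] test_fun_on_cmult[OF g]]) (simp add: ft_cmult)
  also have "(\<lambda>x. k1 * g 1 x + k2 * g J x) =
      (\<lambda>x. - (\<i> * of_real t * (k1 * of_real (Re (h (x $ i))) + k2 * of_real (Re (h (J * x $ i))))) * f x)"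
    by (simp add: fun_eq_iff g_def D_axis algebra_simps)
  finally show ?thesis by (simp add: wirtinger_Re mult.assoc)
qed

lemma wirt_eqI:
  assumes "(f has_derivative f') (at x)" shows "wirt i f x = k1 * f' (axis i 1) + k2 * f' (axis i J)"
  by (simp add: wirt_def dir_deriv_eqI[OF assms])

lemma wirt_test_fun_outside:
  assumes "test_fun_on S f" "x \<notin> S" shows "wirt i f x = 0"
  using test_fun_on_wirt[OF assms(1), of i] assms(2) unfolding test_fun_on_def by blast

lemma asymptotic_family_wirt:
  assumes "asymptotic_family S A a" shows "asymptotic_family S (\<lambda>t. wirt i (A t)) (wirt i a)"
  using assms
proof (induction rule: asymptotic_family.induct)
  case (step A b a)
  have "wirt i (\<lambda>x. a x + A t x / of_real t) x = wirt i a x + wirt i (A t) x / of_real t" for t x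
  proof -
    have "(a has_derivative (\<lambda>v. dir_deriv v a x)) (at x)" "(A t has_derivative (\<lambda>v. dir_deriv v (A t) x)) (at x)"
      using step(2) asymptotic_family_test_fun[OF step(1)]
      by (auto intro!: smooth_on_has_derivative[of UNIV] test_fun_on_smooth)
    then have "((\<lambda>x. a x + A t x / of_real t) has_derivative (\<lambda>v. dir_deriv v a x + dir_deriv v (A t) x / of_real t)) (at x)"
      unfolding divide_inverse by (intro has_derivative_add has_derivative_mult_left)
    from wirt_eqI[OF this] show ?thesis by (simp add: wirt_def algebra_simps add_divide_distrib)
  qed
  then show ?case
    using asymptotic_family.step[OF step.IH test_fun_on_wirt[OF step(2)]] by simp
qed (intro asymptotic_family.const test_fun_on_wirt)

lemma wirt_chr_mult:
  fixes q :: "'f ^ 'n \<Rightarrow> 'f ^ 'n"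
  assumes S: "open S" and f: "test_fun_on S f"
    and Q: "\<And>x. x \<in> S \<Longrightarrow> (Q has_derivative scalar_product (q x)) (at x)"
    and smooth: "smooth_on S (\<lambda>x. h (Q x))"
  shows "wirt i (\<lambda>x. chr t (Q x) * f x) x = chr t (Q x) * (\<i> * of_real t * c0 * h (q x $ i) * f x + wirt i f x)"
proof (cases "x \<in> S")
  case True
  have "((\<lambda>x. chr t (Q x)) has_derivative (\<lambda>v. \<i> * of_real (t * Re (h (scalar_product (q x) v))) * chr t (Q x))) (at x)"
    by (rule has_derivative_compose[OF Q[OF True] chr_has_derivative])
  moreover have "(f has_derivative (\<lambda>v. dir_deriv v f x)) (at x)"
    by (rule smooth_on_has_derivative[OF test_fun_on_smooth[OF f], of _ UNIV]) simp
  ultimately have "((\<lambda>x. chr t (Q x) * f x) has_derivative (\<lambda>v. chr t (Q x) * dir_deriv v f x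
      + \<i> * of_real (t * Re (h (scalar_product (q x) v))) * chr t (Q x) * f x)) (at x)"
    by (rule has_derivative_mult)
  from wirt_eqI[OF this, of i]
  have "wirt i (\<lambda>x. chr t (Q x) * f x) x = chr t (Q x) * (\<i> * of_real t *
      (k1 * of_real (Re (h (q x $ i))) + k2 * of_real (Re (h (J * q x $ i)))) * f x + wirt i f x)"
    by (simp add: scalar_product_axis wirt_def algebra_simps)
  then show ?thesis by (simp add: wirtinger_Re mult.assoc)
next
  case False
  have "test_fun_on S (\<lambda>x. chr t (Q x) * f x)"
    by (intro test_fun_on_mult S f smooth_on_chr smooth)
  moreover have "f x = 0" using f False unfolding test_fun_on_def by blast
  ultimately show ?thesis using wirt_test_fun_outside[OF _ False] f by simp
qed

text \<open>The operator of multiplication by a polynomial \<open>p\<close> on the Fourier side acts on the oscillating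
  functions \<open>chr t \<circ> Q\<close> times a test function, to leading order in \<open>t\<close>, as multiplication by \<open>p \<circ> Q'\<close>.\<close>

lemma polynomial_mult_ft:
  fixes q :: "'f ^ 'n \<Rightarrow> 'f ^ 'n"
  assumes S: "open S" and p: "polynomial_fun p"
    and Q: "\<And>x. x \<in> S \<Longrightarrow> (Q has_derivative scalar_product (q x)) (at x)"
    and smooth: "smooth_on S (\<lambda>x. h (Q x))" "\<And>i. smooth_on S (\<lambda>x. h (q x $ i))"
    and A: "asymptotic_family S A a"
  shows "\<exists>B. asymptotic_family S B (\<lambda>x. h (p (q x)) * a x) \<and>
    (\<forall>t>0. \<forall>y. h (p y) * ft (-t) (\<lambda>x. chr t (Q x) * A t x) y = ft (-t) (\<lambda>x. chr t (Q x) * B t x) y)"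
  using p A
proof (induction arbitrary: A a)
  case (const c)
  show ?case
  proof (intro exI[of _ "\<lambda>t x. h c * A t x"] conjI allI impI)
    show "asymptotic_family S (\<lambda>t x. h c * A t x) (\<lambda>x. h c * a x)"
      by (rule asymptotic_family_mult[OF S smooth_on_const const])
    show "h c * ft (-t) (\<lambda>x. chr t (Q x) * A t x) y = ft (-t) (\<lambda>x. chr t (Q x) * (h c * A t x)) y" for t y
      by (simp add: mult.left_commute[of _ "h c"] ft_cmult)
  qed
next
  case (coord i)
  \<comment> \<open>The division by \<open>\<i> * of_real t * c0\<close> in the transform rule
    exactly cancels the factor brought down by differentiating the phase; the derivative of the
    amplitude keeps a factor \<open>1 / t\<close>.\<close>
  define B where "B = (\<lambda>t x. h (q x $ i) * A t x + (1 / (\<i> * c0) * wirt i (A t) x) / of_real t)"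
  have "asymptotic_family S B (\<lambda>x. h (q x $ i) * a x)"
    unfolding B_def
    by (rule asymptotic_family_shift[OF asymptotic_family_mult[OF S smooth(2) coord]
        asymptotic_family_mult[OF S smooth_on_const asymptotic_family_wirt[OF coord]]])
  moreover have "h (y $ i) * ft (-t) (\<lambda>x. chr t (Q x) * A t x) y = ft (-t) (\<lambda>x. chr t (Q x) * B t x) y" if t: "t > 0" for t y
  proof -
    have A_test: "test_fun_on S (A t)" using asymptotic_family_test_fun[OF coord] by blast
    then have "test_fun_on UNIV (\<lambda>x. chr t (Q x) * A t x)"
      by (intro test_fun_on_mono[OF test_fun_on_mult[OF S smooth_on_chr[OF S smooth(1)]]]) auto
    then have "h (y $ i) * ft (-t) (\<lambda>x. chr t (Q x) * A t x) y =
        ft (-t) (\<lambda>x. 1 / (\<i> * of_real t * c0) * wirt i (\<lambda>x. chr t (Q x) * A t x) x) y"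
      using t by (intro mult_ft) auto
    moreover have "1 / (\<i> * of_real t * c0) * wirt i (\<lambda>x. chr t (Q x) * A t x) x = chr t (Q x) * B t x" for x
    proof -
      have "wirt i (\<lambda>x. chr t (Q x) * A t x) x =
          chr t (Q x) * (\<i> * of_real t * c0 * h (q x $ i) * A t x + wirt i (A t) x)"
        by (rule wirt_chr_mult[OF S A_test _ smooth(1)]) (rule Q)
      then show ?thesis unfolding B_def using t c0 by (simp add: field_simps)
    qed
    ultimately show ?thesis by simp
  qed
  ultimately show ?case by blast
next
  case (add p1 p2)
  obtain B where B: "asymptotic_family S B (\<lambda>x. h (p1 (q x)) * a x)"
    "\<And>t y. t > 0 \<Longrightarrow> h (p1 y) * ft (-t) (\<lambda>x. chr t (Q x) * A t x) y = ft (-t) (\<lambda>x. chr t (Q x) * B t x) y"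
    using add.IH(1)[OF add.prems] by blast
  obtain C where C: "asymptotic_family S C (\<lambda>x. h (p2 (q x)) * a x)"
    "\<And>t y. t > 0 \<Longrightarrow> h (p2 y) * ft (-t) (\<lambda>x. chr t (Q x) * A t x) y = ft (-t) (\<lambda>x. chr t (Q x) * C t x) y"
    using add.IH(2)[OF add.prems] by blast
  show ?case
  proof (intro exI[of _ "\<lambda>t x. B t x + C t x"] conjI allI impI)
    show "asymptotic_family S (\<lambda>t x. B t x + C t x) (\<lambda>x. h (p1 (q x) + p2 (q x)) * a x)"
      using asymptotic_family_add[OF B(1) C(1)] by (simp add: h_add distrib_right)
    fix t :: real and y assume t: "t > 0"
    have "test_fun_on S (\<lambda>x. chr t (Q x) * B t x)" "test_fun_on S (\<lambda>x. chr t (Q x) * C t x)"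
      using asymptotic_family_test_fun[OF B(1)] asymptotic_family_test_fun[OF C(1)]
      by (auto intro!: test_fun_on_mult[OF S smooth_on_chr[OF S smooth(1)]])
    from ft_add[OF this, of "-t" y] B(2)[OF t, of y] C(2)[OF t, of y]
    show "h (p1 y + p2 y) * ft (-t) (\<lambda>x. chr t (Q x) * A t x) y = ft (-t) (\<lambda>x. chr t (Q x) * (B t x + C t x)) y"
      by (simp add: h_add distrib_right distrib_left)
  qed
next
  case (mult p1 p2)
  \<comment> \<open>The amplitude is arbitrary in the induction, so the family produced by
    \<open>p2\<close> can be fed into the hypothesis for \<open>p1\<close>.\<close>
  obtain B where B: "asymptotic_family S B (\<lambda>x. h (p2 (q x)) * a x)"
    "\<And>t y. t > 0 \<Longrightarrow> h (p2 y) * ft (-t) (\<lambda>x. chr t (Q x) * A t x) y = ft (-t) (\<lambda>x. chr t (Q x) * B t x) y"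
    using mult.IH(2)[OF mult.prems] by blast
  obtain C where C: "asymptotic_family S C (\<lambda>x. h (p1 (q x)) * (h (p2 (q x)) * a x))"
    "\<And>t y. t > 0 \<Longrightarrow> h (p1 y) * ft (-t) (\<lambda>x. chr t (Q x) * B t x) y = ft (-t) (\<lambda>x. chr t (Q x) * C t x) y"
    using mult.IH(1)[OF B(1)] by blast
  show ?case
  proof (intro exI[of _ C] conjI allI impI)
    show "asymptotic_family S C (\<lambda>x. h (p1 (q x) * p2 (q x)) * a x)"
      using C(1) by (simp add: h_mult mult.assoc)
    fix t :: real and y assume t: "t > 0"
    show "h (p1 y * p2 y) * ft (-t) (\<lambda>x. chr t (Q x) * A t x) y = ft (-t) (\<lambda>x. chr t (Q x) * C t x) y"
      using B(2)[OF t, of y] C(2)[OF t, of y] by (simp add: h_mult mult.assoc)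
  qed
qed

section \<open>The equation for the distribution and its limit\<close>

lemma rapid_decay_ft:
  assumes "t \<noteq> 0" "test_fun_on UNIV f"
  shows "rapid_decay (ft t f)" "rapid_decay (dir_deriv v (ft t f))"
proof -
  show "rapid_decay (ft t f)" unfolding rapid_decay_def using ft_weighted_bound[OF assms] by blast
  show "rapid_decay (dir_deriv v (ft t f))"
    unfolding rapid_decay_def dir_deriv_ft[OF assms(2)]
    using ft_weighted_bound[OF assms(1) test_fun_on_inner_mult[OF assms(2) open_UNIV]] by blast
qed

text \<open>The fundamental lemma of the calculus of variations. Multiplying by the conjugate of
  \<open>g a\<close> makes the real part positive near \<open>a\<close>, and a nonnegative bump
  there gives a nonzero integral.\<close>

lemma continuous_eq_zero_of_test_funs:
  fixes g :: "'f ^ 'n \<Rightarrow> complex"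
  assumes S: "open S" and g: "continuous_on S g"
    and zero: "\<And>\<eta>. test_fun_on S \<eta> \<Longrightarrow> (LINT x|lborel. g x * \<eta> x) = 0" and a: "a \<in> S"
  shows "g a = 0"
proof (rule ccontr)
  assume nz: "g a \<noteq> 0"
  let ?k = "\<lambda>x. Re (g x * cnj (g a))"
  have k: "continuous_on S ?k" by (intro continuous_intros g)
  have pos: "?k a > 0" using nz by (simp add: complex_eq_iff sum_squares_gt_zero_iff)
  have "isCont ?k a" using k S a by (simp add: continuous_on_eq_continuous_at)
  then have "(?k \<longlongrightarrow> ?k a) (nhds a)"
    unfolding isCont_def by (rule tendsto_at_iff_tendsto_nhds[THEN iffD1])
  then have "\<forall>\<^sub>F x in nhds a. ?k x > 0" by (rule order_tendstoD(1)[OF _ pos])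
  moreover have "\<forall>\<^sub>F x in nhds a. x \<in> S" using S a by (rule eventually_nhds_in_open)
  ultimately have "\<forall>\<^sub>F x in nhds a. ?k x > 0 \<and> x \<in> S" by (rule eventually_conj)
  then obtain r where r: "r > 0" "\<And>x. dist x a < r \<Longrightarrow> ?k x > 0 \<and> x \<in> S"
    unfolding eventually_nhds_metric by blast
  \<comment> \<open>Half the radius, so that the closed ball carrying the support still lies in
    \<open>S\<close>.\<close>
  obtain \<eta> where \<eta>: "test_fun_on UNIV (\<lambda>x. complex_of_real (\<eta> x))" "\<And>x. \<eta> x \<ge> 0"
    "\<And>x. x \<in> ball a (r / 2) \<Longrightarrow> \<eta> x > 0" "\<And>x. x \<notin> ball a (r / 2) \<Longrightarrow> \<eta> x = 0"
    using ex_bump[of "r / 2" a] r(1) by (metis half_gt_zero)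
  have "cball a (r / 2) \<subseteq> S" using r by (force simp: dist_commute)
  then have \<eta>S: "test_fun_on S (\<lambda>x. complex_of_real (\<eta> x))"
    using \<eta>(1,4) ball_subset_cball unfolding test_fun_on_def by (metis compact_cball of_real_0 subsetD)
  have int: "integrable lborel (\<lambda>x. g x * complex_of_real (\<eta> x))"
    by (rule integrable_mult_test_fun(1)[OF S g \<eta>S])
  have "continuous_on UNIV (\<lambda>x. Re ((g x * cnj (g a)) * complex_of_real (\<eta> x)))"
    by (intro continuous_on_Re continuous_mult_test_fun[OF S _ \<eta>S] continuous_intros g)
  then have cont: "continuous_on UNIV (\<lambda>x. ?k x * \<eta> x)" by simp
  have nonneg: "?k x * \<eta> x \<ge> 0" for x
    using r(2)[of x] \<eta>(2,4)[of x] r(1) by (cases "x \<in> ball a (r / 2)") (auto simp: dist_commute)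
  have "integrable lborel (\<lambda>x. Re (cnj (g a) * (g x * complex_of_real (\<eta> x))))"
    by (intro integrable_Re integrable_mult_right int)
  then have intk: "integrable lborel (\<lambda>x. ?k x * \<eta> x)"
    by (rule back_subst[of "integrable lborel"]) (auto simp: fun_eq_iff algebra_simps)
  have "(LINT x|lborel. ?k x * \<eta> x) = (LINT x|lborel. Re (cnj (g a) * (g x * complex_of_real (\<eta> x))))"
    by (rule Bochner_Integration.integral_cong) (auto simp: algebra_simps)
  also have "\<dots> = Re (LINT x|lborel. cnj (g a) * (g x * complex_of_real (\<eta> x)))"
    by (rule integral_Re) (rule integrable_mult_right[OF int])
  also have "\<dots> = 0" using zero[OF \<eta>S] by simp
  finally have "AE x in lborel. ?k x * \<eta> x = 0"
    using integral_nonneg_eq_0_iff_AE[OF intk] nonneg by simp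
  then have "?k a * \<eta> a = 0"
    using mem_closed_if_AE_lebesgue[OF closed_Collect_eq[OF cont continuous_on_const], of 0 a] AE_completion by force
  then show False using pos \<eta>(3)[of a] r(1) by simp
qed

text \<open>The integral identity is an identity between values of \<open>T s\<close> only if each
  term is Schwartz. The hypotheses on \<open>f\<close> and \<open>F\<close> secure this by
  exhibiting every term as the transform of a test function; terms with factor \<open>s $ j\<close>
  are kept apart because their coefficients vary in the continuation.\<close>

lemma G_distribution_annihilated:
  fixes as bs Qs :: "'f ^ 'n \<Rightarrow> 'f" and Ps :: "'l::finite \<Rightarrow> 'f ^ 'n \<Rightarrow> 'f" and chis :: "'l \<Rightarrow> 'f \<Rightarrow> complex"
  assumes as: "polynomial_fun as" and bs: "nonzero_polynomial bs" and Qs: "\<forall>x. bs x \<noteq> 0 \<longrightarrow> Qs x = as x / bs x"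
    and Ps: "\<forall>j. nonzero_polynomial (Ps j)" and chis: "\<forall>j. multiplicative_char (chis j)"
    and e_def: "e = (\<lambda>x. bs x * (\<Prod>j\<in>UNIV. Ps j x))"
  shows "\<exists>A R \<sigma>. (\<forall>i. polynomial_fun (A i)) \<and> (\<forall>i j. polynomial_fun (R i j)) \<and>
    (\<forall>i x. e x \<noteq> 0 \<longrightarrow> A i x = (e x)\<^sup>2 * partial_deriv i Qs x) \<and>
    (\<forall>i t Ts f F. t \<noteq> 0 \<longrightarrow> G_distribution Ps Qs chis (chr t) Ts \<longrightarrow> test_fun_on UNIV f \<longrightarrow> test_fun_on UNIV F \<longrightarrow>
      (\<forall>j :: 'l. \<exists>g. test_fun_on UNIV g \<and> (\<forall>y. h (R i j y) * ft (-t) f y = ft (-t) g y)) \<longrightarrow>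
      (\<forall>y. wirt i (\<lambda>x. h ((e x)\<^sup>2) * ft (-t) f x) y + \<i> * of_real t * c0 * (h (A i y) * ft (-t) f y)
        + (\<Sum>j\<in>UNIV. \<sigma> j * (h (R i j y) * ft (-t) f y)) = ft (-t) F y) \<longrightarrow>
      Ts (ft (-t) F) = 0)"
proof -
  note ann = elementary_function_annihilated[OF assms]
  obtain A R \<sigma> \<sigma>' c
    where A: "\<forall>i. polynomial_fun (A i)" "\<forall>i (j :: 'l). polynomial_fun (R i j)"
    "\<forall>i x. e x \<noteq> 0 \<longrightarrow> A i x = (e x)\<^sup>2 * partial_deriv i Qs x"
    and zero: "\<forall>i (s :: complex ^ 'l) t \<phi>. (\<forall>j. Re (s $ j) > c) \<longrightarrow> (\<forall>x. \<phi> differentiable (at x)) \<longrightarrow>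
      rapid_decay \<phi> \<longrightarrow> (\<forall>v. rapid_decay (dir_deriv v \<phi>)) \<longrightarrow>
      (LINT x|lebesgue. G_fun Ps Qs (\<lambda>j. twist (chis j) (s $ j)) (chr t) x *
        (wirt i (\<lambda>x. h ((e x)\<^sup>2) * \<phi> x) x + \<i> * of_real t * c0 * (h (A i x) * \<phi> x)
          + (\<Sum>j\<in>UNIV. (\<sigma> j + s $ j * \<sigma>') * (h (R i j x) * \<phi> x)))) = 0"
    using ann by (elim exE conjE) (rule that, assumption+)
  have "Ts (ft (-t) F) = 0"
    if t: "t \<noteq> 0" and G: "G_distribution Ps Qs chis (chr t) Ts" and f: "test_fun_on UNIV f" and F: "test_fun_on UNIV F"
      and R': "\<forall>j. \<exists>g. test_fun_on UNIV g \<and> (\<forall>y. h (R i j y) * ft (-t) f y = ft (-t) g y)"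
      and eq: "\<forall>y. wirt i (\<lambda>x. h ((e x)\<^sup>2) * ft (-t) f x) y + \<i> * of_real t * c0 * (h (A i y) * ft (-t) f y)
        + (\<Sum>j\<in>UNIV. \<sigma> j * (h (R i j y) * ft (-t) f y)) = ft (-t) F y"
    for i t Ts f F
  proof -
    have t': "- t \<noteq> 0" using t by simp
    obtain g where g: "\<And>j. test_fun_on UNIV (g j)" "\<And>j y. h (R i j y) * ft (-t) f y = ft (-t) (g j) y"
      using R' by metis
    obtain U T c' where T: "meromorphic_family U T" and c': "\<And>(s :: complex ^ 'l) f. s \<in> U \<Longrightarrow> (\<And>j. Re (s $ j) > c') \<Longrightarrow>
        f \<in> schwartz \<Longrightarrow> T s f = distribution_of (G_fun Ps Qs (\<lambda>j. twist (chis j) (s $ j)) (chr t)) f"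
      and U: "0 \<in> U" and T0: "\<And>f. f \<in> schwartz \<Longrightarrow> Ts f = T 0 f"
      using G unfolding G_distribution_def by blast
    \<comment> \<open>The index \<open>None\<close> stands for the part of the equation without
      \<open>s\<close>, and \<open>Some j\<close> for the coefficient of \<open>s $ j\<close>. At
      \<open>s = 0\<close> only the first is left, which is the claim about
      \<open>F\<close>.\<close>
    define \<beta> where "\<beta> = (\<lambda>j. case j of None \<Rightarrow> F | Some j \<Rightarrow> (\<lambda>x. \<sigma>' * g j x))"
    define a where "a = (\<lambda>j (s :: complex ^ 'l). case j of None \<Rightarrow> 1 | Some j \<Rightarrow> s $ j)"
    have \<beta>: "test_fun_on UNIV (\<beta> j)" for j
      unfolding \<beta>_def using F g by (auto split: option.split intro: test_fun_on_cmult)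
    have "(\<Sum>j\<in>UNIV. a j 0 * T 0 (ft (-t) (\<beta> j))) = 0"
    proof (rule meromorphic_family_identity[OF T _ _ _ _ U, of UNIV "\<lambda>j. ft (-t) (\<beta> j)" a "\<lambda>_. 0" "max c c'"])
      show "ft (-t) (\<beta> j) \<in> schwartz" for j by (rule ft_schwartz[OF t' \<beta>])
      show "line_holomorphic (a j) UNIV" for j
        unfolding a_def by (cases j) (auto intro: line_holomorphic_const line_holomorphic_nth)
      show "line_holomorphic (\<lambda>_. 0) (UNIV :: (complex ^ 'l) set)" by (rule line_holomorphic_const)
      fix s :: "complex ^ 'l" assume s: "s \<in> U" "\<And>j. Re (s $ j) > max c c'"
      have "tempered_distribution (T s)" using T s(1) by (simp add: meromorphic_family_def)
      from tempered_distribution_sum_ft[where I=UNIV and c="\<lambda>j. a j s", OF this symmetric_isometry_axioms t' finite \<beta>]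
      have "(\<Sum>j\<in>UNIV. a j s * T s (ft (-t) (\<beta> j))) = T s (\<lambda>x. \<Sum>j\<in>UNIV. a j s * ft (-t) (\<beta> j) x)" by simp
      also have "\<dots> = distribution_of (G_fun Ps Qs (\<lambda>j. twist (chis j) (s $ j)) (chr t)) (\<lambda>x. \<Sum>j\<in>UNIV. a j s * ft (-t) (\<beta> j) x)"
      proof (rule c'[OF s(1)])
        have "(\<lambda>x. \<Sum>j\<in>UNIV. a j s * ft (-t) (\<beta> j) x) = ft (-t) (\<lambda>x. \<Sum>j\<in>UNIV. a j s * \<beta> j x)"
        proof
          fix x
          have "test_fun_on UNIV (\<lambda>x. a j s * \<beta> j x)" for j by (rule test_fun_on_cmult[OF \<beta>])
          from ft_sum[where I=UNIV and f="\<lambda>j x. a j s * \<beta> j x", OF this] show "(\<Sum>j\<in>UNIV. a j s * ft (-t) (\<beta> j) x) = ft (-t) (\<lambda>x. \<Sum>j\<in>UNIV. a j s * \<beta> j x) x"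
            by (simp add: ft_cmult)
        qed
        then show "(\<lambda>x. \<Sum>j\<in>UNIV. a j s * ft (-t) (\<beta> j) x) \<in> schwartz"
          by (simp add: ft_schwartz[OF t'] test_fun_on_sum test_fun_on_cmult \<beta>)
      qed (use s in auto)
      also have "\<dots> = (LINT x|lebesgue. G_fun Ps Qs (\<lambda>j. twist (chis j) (s $ j)) (chr t) x *
          (wirt i (\<lambda>x. h ((e x)\<^sup>2) * ft (-t) f x) x + \<i> * of_real t * c0 * (h (A i x) * ft (-t) f x)
          + (\<Sum>j\<in>UNIV. (\<sigma> j + s $ j * \<sigma>') * (h (R i j x) * ft (-t) f x))))"
        unfolding distribution_of_def
      proof (rule arg_cong[where f="integral\<^sup>L lebesgue"], rule ext, rule arg_cong[where f="(*) _"])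
        fix x
        have "(\<Sum>j\<in>UNIV. a j s * ft (-t) (\<beta> j) x) = ft (-t) F x + (\<Sum>j\<in>UNIV. s $ j * (\<sigma>' * ft (-t) (g j) x))"
          by (simp add: UNIV_option_conv sum.reindex a_def \<beta>_def ft_cmult)
        also have "\<dots> = wirt i (\<lambda>x. h ((e x)\<^sup>2) * ft (-t) f x) x + \<i> * of_real t * c0 * (h (A i x) * ft (-t) f x)
          + (\<Sum>j\<in>UNIV. (\<sigma> j + s $ j * \<sigma>') * (h (R i j x) * ft (-t) f x))"
          by (simp add: eq[rule_format, symmetric] g(2)[symmetric] distrib_right sum.distrib mult.assoc)
        finally show "(\<Sum>j\<in>UNIV. a j s * ft (-t) (\<beta> j) x) = \<dots>" .
      qed
      also have "\<dots> = 0"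
      proof (rule zero[rule_format])
        show "ft (-t) f differentiable (at x)" for x
          using ft_has_derivative[OF f] unfolding differentiable_def by blast
      qed (use s rapid_decay_ft[OF t' f] in auto)
      finally show "(\<Sum>j\<in>UNIV. a j s * T s (ft (-t) (\<beta> j))) = 0" .
    qed
    then have "T 0 (ft (-t) F) = 0"
      by (simp add: UNIV_option_conv sum.reindex a_def \<beta>_def)
    then show ?thesis using T0[OF ft_schwartz[OF t' F]] by simp
  qed
  then show ?thesis
    by - (rule exI[of _ A], rule exI[of _ R], rule exI[of _ \<sigma>], use A in blast)
qed

text \<open>What the limit yields is an equation multiplied by the square of
  \<open>e (differential Q x)\<close>; the condition in the conclusion is the division by this
  factor.\<close>

lemma key_identity:
  fixes P :: "'k::finite \<Rightarrow> 'f ^ 'n \<Rightarrow> 'f" and Ps :: "'l::finite \<Rightarrow> 'f ^ 'n \<Rightarrow> 'f"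
  assumes Q: "rational_fun Q" and Qs: "rational_fun Qs"
    and P: "\<And>j. nonzero_polynomial (P j)" and Ps: "\<And>j. nonzero_polynomial (Ps j)"
    and chi: "\<And>j. multiplicative_char (chi j)" and chis: "\<And>j. multiplicative_char (chis j)"
    and FT: "\<And>t. t > 0 \<Longrightarrow> \<exists>T Ts C. G_distribution P (\<lambda>x. - Q x) chi (chr t) T \<and> G_distribution Ps Qs chis (chr t) Ts \<and>
             (\<forall>\<phi>\<in>schwartz. fourier_distribution (chr t) T \<phi> = C * Ts \<phi>)"
  shows "\<exists>e. nonzero_polynomial e \<and>
    generically (\<lambda>x. \<forall>i. e (differential Q x) \<noteq> 0 \<longrightarrow> x $ i = partial_deriv i Qs (differential Q x))"
proof -
  obtain a b where ab: "polynomial_fun a" "nonzero_polynomial b" "\<And>x. b x \<noteq> 0 \<Longrightarrow> Q x = a x / b x"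
    using Q unfolding rational_fun_iff by blast
  obtain as bs where abs: "polynomial_fun as" "nonzero_polynomial bs" "\<And>x. bs x \<noteq> 0 \<Longrightarrow> Qs x = as x / bs x"
    using Qs unfolding rational_fun_iff by blast
  define e where "e = (\<lambda>x. bs x * (\<Prod>j\<in>UNIV. Ps j x))"
  have e: "nonzero_polynomial e"
    unfolding e_def by (intro nonzero_polynomial_mult nonzero_polynomial_prod abs Ps)
  have "\<forall>x. bs x \<noteq> 0 \<longrightarrow> Qs x = as x / bs x" "\<forall>j. nonzero_polynomial (Ps j)" "\<forall>j. multiplicative_char (chis j)"
    using abs(3) Ps chis by blast+
  note ann = G_distribution_annihilated[OF abs(1,2) this e_def]
  obtain A R \<sigma> where A: "\<forall>i. polynomial_fun (A i)" "\<forall>i (j :: 'l). polynomial_fun (R i j)"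
    "\<forall>i x. e x \<noteq> 0 \<longrightarrow> A i x = (e x)\<^sup>2 * partial_deriv i Qs x"
    and zero: "\<forall>i t Ts f F. t \<noteq> 0 \<longrightarrow> G_distribution Ps Qs chis (chr t) Ts \<longrightarrow> test_fun_on UNIV f \<longrightarrow> test_fun_on UNIV F \<longrightarrow>
      (\<forall>j :: 'l. \<exists>g. test_fun_on UNIV g \<and> (\<forall>y. h (R i j y) * ft (-t) f y = ft (-t) g y)) \<longrightarrow>
      (\<forall>y. wirt i (\<lambda>x. h ((e x)\<^sup>2) * ft (-t) f x) y + \<i> * of_real t * c0 * (h (A i y) * ft (-t) f y)
        + (\<Sum>j\<in>UNIV. \<sigma> j * (h (R i j y) * ft (-t) f y)) = ft (-t) F y) \<longrightarrow>
      Ts (ft (-t) F) = 0"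
    using ann by (elim exE conjE) (rule that, assumption+)
  note A = A[rule_format]
  obtain n where n: "\<And>i. polynomial_fun (n i)"
    "\<And>x. b x \<noteq> 0 \<Longrightarrow> (Q has_derivative scalar_product (\<chi> i. n i x / (b x)\<^sup>2)) (at x)"
    by (rule quotient_has_derivative[OF ab(1) nonzero_polynomialD[OF ab(2)] ab(3)]) auto
  define d where "d = (\<lambda>x. b x * (\<Prod>j\<in>UNIV. P j x))"
  have d: "nonzero_polynomial d"
    unfolding d_def by (intro nonzero_polynomial_mult nonzero_polynomial_prod ab P)
  \<comment> \<open>On \<open>S\<close> the function \<open>Q\<close> and its gradient are smooth
    and no character has a zero argument, so the distribution on V is there a continuous function
    without zeros.\<close>
  define S where "S = {x. d x \<noteq> 0}"
  have S: "open S" unfolding S_def by (rule open_nonzero_polynomial[OF nonzero_polynomialD[OF d]])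
  have S_nz: "b x \<noteq> 0" "P j x \<noteq> 0" if "x \<in> S" for x j
    using that by (auto simp: S_def d_def)
  define q where "q = differential Q"
  have q: "(Q has_derivative scalar_product (q x)) (at x)" "q x $ i = n i x / (b x)\<^sup>2" if "x \<in> S" for x i
    using n(2)[OF S_nz(1)[OF that]] differential_eqI[OF n(2)[OF S_nz(1)[OF that]]] by (simp_all add: q_def)
  have smooth_Q: "smooth_on S (\<lambda>x. h (Q x))"
    by (rule smooth_on_h_quotient[OF S ab(1) nonzero_polynomialD[OF ab(2)]]) (use S_nz(1) ab(3) in blast)
  have smooth_q: "smooth_on S (\<lambda>x. h (q x $ i))" for i
    by (rule smooth_on_h_quotient[where a="n i" and b="\<lambda>x. (b x)\<^sup>2", OF S n(1) polynomial_fun_power[OF nonzero_polynomialD[OF ab(2)]]])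
       (use S_nz(1) q(2) in auto)
  note poly_rule = polynomial_mult_ft[OF S _ q(1) smooth_Q smooth_q]
  have e2: "polynomial_fun (\<lambda>x. (e x)\<^sup>2)" by (intro polynomial_fun_power nonzero_polynomialD e)
  \<comment> \<open>The amplitude: \<open>G_fun\<close> with phase \<open>- Q\<close> is
    \<open>chr t (- Q x) * g x\<close>, and \<open>g\<close> does not depend on
    \<open>t\<close>.\<close>
  define g where "g = (\<lambda>x. \<Prod>j\<in>UNIV. chi j (P j x))"
  have g_cont: "continuous_on S g"
  proof -
    have "continuous_on S (\<lambda>x. chi j (P j x))" for j
      using chi[of j] S_nz(2)
      by (intro continuous_on_compose2[OF _ continuous_polynomial_fun[OF nonzero_polynomialD[OF P[of j]]], of "- {0}"])
         (auto simp: multiplicative_char_def)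
    then show ?thesis unfolding g_def by (intro continuous_on_prod)
  qed
  have "x $ i * (e (q x))\<^sup>2 = A i (q x)" if x: "x \<in> S" for x i
  proof -
    let ?k = "\<lambda>x. h (x $ i) * h ((e (q x))\<^sup>2) - h (A i (q x))"
    have "(LINT x|lborel. (g x * ?k x) * \<eta> x) = 0" if \<eta>: "test_fun_on S \<eta>" for \<eta>
    proof -
      note const = asymptotic_family.const[OF \<eta>]
      obtain B where B: "asymptotic_family S B (\<lambda>x. h ((e (q x))\<^sup>2) * \<eta> x)"
        "\<And>t y. t > 0 \<Longrightarrow> h ((e y)\<^sup>2) * ft (-t) (\<lambda>x. chr t (Q x) * \<eta> x) y = ft (-t) (\<lambda>x. chr t (Q x) * B t x) y"
        using poly_rule[OF e2 _ const] by blast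
      obtain BA where BA: "asymptotic_family S BA (\<lambda>x. h (A i (q x)) * \<eta> x)"
        "\<And>t y. t > 0 \<Longrightarrow> h (A i y) * ft (-t) (\<lambda>x. chr t (Q x) * \<eta> x) y = ft (-t) (\<lambda>x. chr t (Q x) * BA t x) y"
        using poly_rule[OF A(1) _ const] by blast
      have "\<forall>j. \<exists>BR. asymptotic_family S BR (\<lambda>x. h (R i j (q x)) * \<eta> x) \<and>
        (\<forall>t>0. \<forall>y. h (R i j y) * ft (-t) (\<lambda>x. chr t (Q x) * \<eta> x) y = ft (-t) (\<lambda>x. chr t (Q x) * BR t x) y)"
        using poly_rule[OF A(2) _ const] by blast
      from choice[OF this] obtain BR where BR_all: "\<forall>j. asymptotic_family S (BR j) (\<lambda>x. h (R i j (q x)) * \<eta> x) \<and>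
        (\<forall>t>0. \<forall>y. h (R i j y) * ft (-t) (\<lambda>x. chr t (Q x) * \<eta> x) y = ft (-t) (\<lambda>x. chr t (Q x) * BR j t x) y)" ..
      have BR: "asymptotic_family S (BR j) (\<lambda>x. h (R i j (q x)) * \<eta> x)"
        "t > 0 \<Longrightarrow> h (R i j y) * ft (-t) (\<lambda>x. chr t (Q x) * \<eta> x) y = ft (-t) (\<lambda>x. chr t (Q x) * BR j t x) y" for j t y
        using BR_all by blast+
      \<comment> \<open>The equation applied to the oscillating function, transported to V, divided
        by \<open>- (\<i> * of_real t * c0)\<close> and stripped of \<open>chr t (Q x)\<close>. The
        contributions of the characters carry no factor \<open>t\<close> in the equation and
        therefore drop to order \<open>1 / t\<close>.\<close>
      define Z where "Z = (\<lambda>t x. (h (x $ i) * B t x + (- 1) * BA t x) + (\<Sum>j\<in>UNIV. (- \<sigma> j / (\<i> * c0)) * BR j t x) / of_real t)"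
      have Z: "asymptotic_family S Z (\<lambda>x. h (x $ i) * (h ((e (q x))\<^sup>2) * \<eta> x) + (- 1) * (h (A i (q x)) * \<eta> x))"
        unfolding Z_def
        by (rule asymptotic_family_shift[OF asymptotic_family_add[OF
              asymptotic_family_mult[OF S smooth_on_h_polynomial[OF S polynomial_fun.coord] B(1)]
              asymptotic_family_mult[OF S smooth_on_const BA(1)]]
              asymptotic_family_sum[OF asymptotic_family_mult[OF S smooth_on_const BR(1)]]])
      have osc: "test_fun_on UNIV (\<lambda>x. chr t (Q x) * f x)" if "test_fun_on S f" for f t
        by (rule test_fun_on_mono[OF test_fun_on_mult[OF S smooth_on_chr[OF S smooth_Q] that]]) simp
      have B_test: "test_fun_on S (B t)" and BA_test: "test_fun_on S (BA t)" and BR_test: "test_fun_on S (BR j t)"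
        and Z_test: "test_fun_on S (Z t)" for t j
        using B(1) BA(1) BR(1) Z asymptotic_family_test_fun by blast+
      have "(LINT x|lborel. g x * Z t x) = 0" if t: "t > 0" for t
      proof -
        obtain T Ts C where T: "G_distribution P (\<lambda>x. - Q x) chi (chr t) T" "G_distribution Ps Qs chis (chr t) Ts"
          "\<And>\<phi>. \<phi> \<in> schwartz \<Longrightarrow> fourier_distribution (chr t) T \<phi> = C * Ts \<phi>"
          using FT[OF t] by blast
        let ?c = "- (\<i> * of_real t * c0)"
        let ?f = "\<lambda>x. chr t (Q x) * \<eta> x"
        define F where "F = (\<lambda>x. ?c * (chr t (Q x) * Z t x))"
        have F: "test_fun_on UNIV F" unfolding F_def by (intro test_fun_on_cmult osc Z_test)
        have t': "t \<noteq> 0" "- t \<noteq> 0" using t by auto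
        have "Ts (ft (-t) F) = 0"
        proof (rule zero[rule_format, OF t'(1) T(2) osc[OF \<eta>] F])
          show "\<exists>g. test_fun_on UNIV g \<and> (\<forall>y. h (R i j y) * ft (-t) ?f y = ft (-t) g y)" for j
            using BR(2)[OF t, of j] osc[OF BR_test[of j t]] by blast
          fix y
          have B_eq: "(\<lambda>y. h ((e y)\<^sup>2) * ft (-t) ?f y) = ft (-t) (\<lambda>x. chr t (Q x) * B t x)"
            using B(2)[OF t] by (simp add: fun_eq_iff)
          let ?f1 = "\<lambda>x. ?c * (h (x $ i) * (chr t (Q x) * B t x))"
          let ?f2 = "\<lambda>x. - ?c * (chr t (Q x) * BA t x)"
          let ?f3 = "\<lambda>j x. \<sigma> j * (chr t (Q x) * BR j t x)"
          have tests: "test_fun_on UNIV ?f1" "test_fun_on UNIV ?f2" "test_fun_on UNIV (?f3 j)" for j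
            by (intro test_fun_on_cmult osc BA_test BR_test
                test_fun_on_mult[OF open_UNIV smooth_on_h_polynomial[OF open_UNIV polynomial_fun.coord]] B_test)+
          have "wirt i (\<lambda>x. h ((e x)\<^sup>2) * ft (-t) ?f x) y + \<i> * of_real t * c0 * (h (A i y) * ft (-t) ?f y)
            + (\<Sum>j\<in>UNIV. \<sigma> j * (h (R i j y) * ft (-t) ?f y)) = ft (-t) ?f1 y + ft (-t) ?f2 y + (\<Sum>j\<in>UNIV. ft (-t) (?f3 j) y)"
            unfolding B_eq wirt_ft[OF osc[OF B_test]] BA(2)[OF t] BR(2)[OF t] by (simp add: ft_cmult)
          also have "\<dots> = ft (-t) (\<lambda>x. ?f1 x + ?f2 x + (\<Sum>j\<in>UNIV. ?f3 j x)) y"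
            by (simp only: ft_add[OF test_fun_on_add[OF tests(1,2)] test_fun_on_sum[OF tests(3)]]
                ft_add[OF tests(1,2)] ft_sum[OF tests(3)])
          also have "(\<lambda>x. ?f1 x + ?f2 x + (\<Sum>j\<in>UNIV. ?f3 j x)) = F"
          proof
            fix x
            have "?c * ((\<Sum>j\<in>UNIV. (- \<sigma> j / (\<i> * c0)) * BR j t x) / of_real t) = (\<Sum>j\<in>UNIV. \<sigma> j * BR j t x)"
              unfolding sum_divide_distrib sum_distrib_left
              by (rule sum.cong) (use t' c0 in \<open>auto simp: field_simps\<close>)
            then have "F x = chr t (Q x) * (?c * (h (x $ i) * B t x + (- 1) * BA t x) + (\<Sum>j\<in>UNIV. \<sigma> j * BR j t x))"
              unfolding F_def Z_def by (simp only: distrib_left[of ?c] mult.left_commute[of ?c "chr t (Q x)"])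
            then show "?f1 x + ?f2 x + (\<Sum>j\<in>UNIV. ?f3 j x) = F x"
              by (simp add: algebra_simps sum_distrib_left)
          qed
          finally show "wirt i (\<lambda>x. h ((e x)\<^sup>2) * ft (-t) ?f x) y + \<i> * of_real t * c0 * (h (A i y) * ft (-t) ?f y)
            + (\<Sum>j\<in>UNIV. \<sigma> j * (h (R i j y) * ft (-t) ?f y)) = ft (-t) F y" .
        qed
        \<comment> \<open>The constant \<open>C\<close> disappears here, being multiplied by
          zero.\<close>
        then have FT0: "T (fourier (chr t) (ft (-t) F)) = 0"
          using T(3)[OF ft_schwartz[OF t'(2) F]] by (simp add: fourier_distribution_def)
        obtain \<kappa> where \<kappa>: "\<kappa> \<noteq> 0" "\<And>f x. test_fun_on UNIV f \<Longrightarrow> ft t (ft (-t) f) x = \<kappa> * f x"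
          using ft_inversion[OF t'(1)] by blast
        have "fourier (chr t) (ft (-t) F) = (\<lambda>x. \<kappa> * F x)"
          unfolding fourier_chr[OF continuous_ft[OF F]] by (rule ext) (rule \<kappa>(2)[OF F])
        with FT0 have "T (\<lambda>x. \<kappa> * F x) = 0" by simp
        \<comment> \<open>The support in \<open>S\<close> is what allows the value of
          \<open>T\<close> to be computed as an integral of the function.\<close>
        moreover have "test_fun_on S (\<lambda>x. \<kappa> * F x)"
          unfolding F_def by (intro test_fun_on_cmult test_fun_on_mult[OF S smooth_on_chr[OF S smooth_Q]] Z_test)
        then have "T (\<lambda>x. \<kappa> * F x) = (LINT x|lebesgue. G_fun P (\<lambda>x. - Q x) chi (chr t) x * (\<kappa> * F x))"
        proof (rule G_distribution_test_fun[OF T(1) S _ _ S_nz(2) chi, rotated -1])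
          have "smooth_on S (\<lambda>x. h (- Q x))"
          proof (rule smooth_on_cong[OF S smooth_on_mult[OF S smooth_on_const[of S "-1"] smooth_Q]])
            show "h (- Q x) = - 1 * h (Q x)" for x using h_diff[of 0 "Q x"] by simp
          qed
          then show "continuous_on S (\<lambda>x. chr t (- Q x))"
            by (intro smooth_on_continuous smooth_on_chr[OF S])
          show "continuous_on S (P j)" for j by (rule continuous_polynomial_fun[OF nonzero_polynomialD[OF P]])
        qed
        also have "\<dots> = (LINT x|lebesgue. (\<kappa> * ?c) * (g x * Z t x))"
        proof (rule Bochner_Integration.integral_cong)
          fix x
          \<comment> \<open>The two phases cancel; from here on \<open>t\<close> enters only through
            the amplitude \<open>Z t\<close>.\<close>
          have "G_fun P (\<lambda>x. - Q x) chi (chr t) x * (\<kappa> * F x) = (chr t (- Q x) * chr t (Q x)) * ((\<kappa> * ?c) * (g x * Z t x))"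
            by (simp add: G_fun_def F_def g_def mult_ac)
          then show "G_fun P (\<lambda>x. - Q x) chi (chr t) x * (\<kappa> * F x) = (\<kappa> * ?c) * (g x * Z t x)"
            by (simp only: chr_minus mult_1)
        qed simp
        also have "\<dots> = (\<kappa> * ?c) * (LINT x|lborel. g x * Z t x)"
          using borel_measurable_continuous_onI[OF continuous_mult_test_fun[OF S g_cont Z_test[of t]]]
          by (simp add: integral_completion)
        ultimately show ?thesis using \<kappa>(1) t' c0 by simp
      qed
      \<comment> \<open>The integrals vanish for all positive \<open>t\<close>, while their limit is
        the integral against the coefficient of order zero of \<open>Z\<close>; so the latter is
        zero.\<close>
      then have "((\<lambda>t. LINT x|lborel. g x * Z t x) \<longlongrightarrow> 0) at_top"
        by (intro tendsto_eventually) (auto intro: eventually_mono[OF eventually_gt_at_top[of 0]])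
      from tendsto_unique[OF _ asymptotic_family_limit[OF S g_cont Z] this]
      show ?thesis by (simp add: algebra_simps)
    qed
    note zero_integral = this
    have cont: "continuous_on S (\<lambda>x. g x * ?k x)"
    proof -
      have "continuous_on S q"
      proof (rule continuous_on_cong[THEN iffD1])
        show "continuous_on S (\<lambda>x. \<chi> i. n i x / (b x)\<^sup>2)"
          using S_nz(1) by (intro continuous_intros continuous_polynomial_fun n nonzero_polynomialD ab) auto
        show "(\<chi> i. n i x / (b x)\<^sup>2) = q x" if "x \<in> S" for x
          using q(2)[OF that] by (simp add: vec_eq_iff)
      qed simp
      then have "continuous_on S (\<lambda>x. e (q x))" "continuous_on S (\<lambda>x. A i (q x))"
        using continuous_on_compose2[OF continuous_polynomial_fun[OF nonzero_polynomialD[OF e], of UNIV]]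
          continuous_on_compose2[OF continuous_polynomial_fun[OF A(1), of UNIV]] by auto
      then show ?thesis by (intro continuous_intros g_cont)
    qed
    have "g x * ?k x = 0"
      by (rule continuous_eq_zero_of_test_funs[where g="\<lambda>x. g x * ?k x", OF S cont _ x]) (rule zero_integral)
    \<comment> \<open>Characters take nonzero values at nonzero arguments, so the amplitude can be
      divided out.\<close>
    moreover have "g x \<noteq> 0"
      unfolding g_def using chi S_nz(2)[OF x] by (auto simp: multiplicative_char_def)
    ultimately have "h (x $ i * (e (q x))\<^sup>2) = h (A i (q x))" by (simp add: h_mult)
    then show ?thesis by (simp only: h_eq_iff)
  qed
  note key = this
  have "x $ i = partial_deriv i Qs (q x)" if "x \<in> S" "e (q x) \<noteq> 0" for x i
    using A(3)[OF that(2), of i] key[OF that(1), of i] that(2) by (simp add: mult.commute)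
  then show ?thesis
    using e d unfolding generically_def q_def S_def by blast
qed

end

text \<open>Both conclusions follow from the single fact that \<open>differential Qs\<close> is a
  generic left inverse of the dominant map \<open>differential Q\<close>. The constant
  \<open>c\<close> is the constant of integration left open when \<open>Qs\<close> is recovered from
  its gradient.\<close>

theorem theorem2p1:
  fixes Q :: "'f::real_or_complex ^ 'n \<Rightarrow> 'f"
    and P :: "'k::finite \<Rightarrow> 'f ^ 'n \<Rightarrow> 'f"
    and Qs :: "'f ^ 'n \<Rightarrow> 'f"
    and Ps :: "'l::finite \<Rightarrow> 'f ^ 'n \<Rightarrow> 'f"
    and chi :: "'k \<Rightarrow> 'f \<Rightarrow> complex"
    and chis :: "'l \<Rightarrow> 'f \<Rightarrow> complex"
  assumes "rational_fun Q"
    and "rational_fun Qs"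
    and "\<And>j. nonzero_polynomial (P j)"
    and "\<And>j. nonzero_polynomial (Ps j)"
    and "\<And>j. multiplicative_char (chi j)"
    and "\<And>j. multiplicative_char (chis j)"
    and "pole_divisor_contained_in Q (\<lambda>x. \<Prod>j\<in>UNIV. P j x)"
    and "pole_divisor_contained_in Qs (\<lambda>y. \<Prod>j\<in>UNIV. Ps j y)"
    and "\<And>\<psi> :: 'f \<Rightarrow> complex. nontrivial_unitary_additive_char \<psi> \<Longrightarrow>
           \<exists>T Ts C. G_distribution P (\<lambda>x. - Q x) chi \<psi> T \<and> G_distribution Ps Qs chis \<psi> Ts \<and>
             (\<forall>\<phi>\<in>schwartz. fourier_distribution \<psi> T \<phi> = C * Ts \<phi>)"
    and "\<not> generically (\<lambda>x. det (hessian Q x) = 0)"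
  shows "birational_isomorphism (differential Q)
    \<and> (\<exists>c. is_legendre_transform Q (\<lambda>p. Qs p + c))"
proof -
  note Q = assms(1) and Qs = assms(2) and det = assms(10)
  obtain h :: "'f \<Rightarrow> complex" where "\<forall>x y. h (x + y) = h x + h y" "\<forall>x y. h (x * y) = h x * h y"
    "\<forall>x. norm (h x) = norm x" "range h = \<real> \<or> range h = UNIV"
    using isometric_to_real_or_complex by blast
  then interpret field_embedding h by unfold_locales auto
  obtain D :: "'f ^ 'n \<Rightarrow> 'f ^ 'n" where D: "symmetric_isometry D" "\<And>x y. D y \<bullet> x = Re (h (scalar_product y x))"
    using ex_dual_isometry by blast
  obtain J k1 k2 c0 where W: "c0 \<noteq> 0" "\<And>q. k1 * of_real (Re (h q)) + k2 * of_real (Re (h (J * q))) = c0 * h q"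
    "\<And>q. k1 * h q + k2 * h (J * q) = h q"
    "\<And>l :: 'f \<Rightarrow> complex. bounded_linear l \<Longrightarrow> \<exists>\<sigma>. \<forall>q. k1 * l q + k2 * l (J * q) = \<sigma> * h q"
    by (rule ex_wirtinger) (rule that, assumption, blast+)
  interpret symmetric_isometry D by (rule D(1))
  interpret fourier_pairing h D J k1 k2 c0
    by unfold_locales (use D(2) W in auto)
  note rat = rational_map_differential[OF Q] and dom = dominant_map_differential[OF Q det]
  have FT: "\<exists>T Ts C. G_distribution P (\<lambda>x. - Q x) chi (chr t) T \<and> G_distribution Ps Qs chis (chr t) Ts \<and>
             (\<forall>\<phi>\<in>schwartz. fourier_distribution (chr t) T \<phi> = C * Ts \<phi>)" if "t > 0" for t
    using that by (intro assms(9) nontrivial_chr) simp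
  obtain e where e: "nonzero_polynomial e"
    "generically (\<lambda>x. \<forall>i. e (differential Q x) \<noteq> 0 \<longrightarrow> x $ i = partial_deriv i Qs (differential Q x))"
    using key_identity[where P=P and Ps=Ps and chi=chi and chis=chis, OF Q Qs assms(3,4,5,6) FT] by blast
  \<comment> \<open>Dominance of the gradient map discards the points at which
    \<open>e (differential Q x)\<close> vanishes.\<close>
  have "generically (\<lambda>x. differential Qs (differential Q x) = x)"
    by (rule generically_mono[OF generically_conj[OF e(2) generically_nonzero_compose[OF e(1) rat dom]]])
       (auto simp: vec_eq_iff differential_def)
  then show ?thesis
    using birational_isomorphismI[OF rat dom rational_map_differential[OF Qs]] is_legendre_transformI[OF Q Qs det] by blast
qed

end
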